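(* Let $N=12$ and let $\mu=c=1$. Then $V_{Hyp}^+$ has the structure of an irreducible module for the Lie algebra $\mathcal{DK}(1)=\mathcal D_{\rm div}\oplus\mathcal K$, with the action ($r\in\mathbb Z^{12}$, $a,b,p\in\{1,\dots,12\}$) $$k_0(r,z)\mapsto Y(e^{ru},z),\qquad k_p(r,z)\mapsto u_p(z)Y(e^{ru},z),$$ $$d_{ab}(r,z)\mapsto\ :\bigl(r_bv_a(z)-r_av_b(z)\bigr)Y(e^{ru},z):,$$ $$d_0\mapsto\mathrm{Id}-\omega_{(1)},\qquad d_p(z)\mapsto v_p(z),$$ $$\widehat d_a(r,z)\mapsto r_a:\omega(z)Y(e^{ru},z):-\Bigl(z^{-1}+\frac{\partial}{\partial z}\Bigr):v_a(z)Y(e^{ru},z):,$$ where $\omega$ is the Virasoro element of $V_{Hyp}^+$ and $\omega(z)=Y(\omega,z)$.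
   Context: **The Lie algebra.** $N\ge1$ is an integer (here $N=12$); $\mathcal R=\mathbb C[t_0^{\pm1},\dots,t_N^{\pm1}]$; for $r\in\mathbb Z^{N+1}$, $t^r=t_0^{r_0}\cdots t_N^{r_N}$. $\Omega_{\mathcal R}=\bigoplus_{p=0}^N\mathcal R k_p$ with $k_p=t_p^{-1}dt_p$, $d(f)=\sum_{p=0}^N t_p\frac{\partial f}{\partial t_p}k_p$, $\mathcal K=\Omega_{\mathcal R}/d(\mathcal R)$ (elements of $\mathcal K$ are denoted by representatives). $\mathcal D=\bigoplus_{p=0}^N\mathcal R d_p$, $d_p=t_p\frac{\partial}{\partial t_p}$. For $\mu\in\mathbb C$, $\mathcal D\oplus\mathcal K$ is a Lie algebra with $\mathcal K$ abelian and (for $r,m\in\mathbb Z^{N+1}$, $0\le a,b\le N$) $$[t^rd_a,t^mk_b]=m_at^{r+m}k_b+\delta_{ab}\sum_{p=0}^Nr_pt^{r+m}k_p,\qquad [t^rd_a,t^md_b]=m_at^{r+m}d_b-r_bt^{r+m}d_a+\mu m_ar_b\sum_{p=0}^Nm_pt^{r+m}k_p.$$ $\mathcal{DK}(\mu)=\mathcal D_{\rm div}\oplus\mathcal K$ is the subalgebra with $\mathcal D_{\rm div}=\{\sum_pf_pd_p:\sum_pt_p\frac{\partial f_p}{\partial t_p}=0\}$. **Fields.** From here on $r\in\mathbb Z^N$ and $t^r=t_1^{r_1}\cdots t_N^{r_N}$. Put $t_0^jt^r\tilde d_0=-t_0^jt^rd_0+\mu(j+\frac12)t_0^jt^rk_0$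 and, for $1\le a\le N$, $t_0^jt^r\widehat d_a=r_at_0^jt^r\tilde d_0+jt_0^jt^rd_a+\frac{r_a}{2cN}(N-1+\mu c)t_0^jt^rk_0$ (for $N=12$, $\mu=c=1$ the last coefficient is $r_a/2$). Then $\mathcal{DK}(\mu)$ is spanned by $d_0$ and the coefficients of the fields (sums over $j\in\mathbb Z$, $1\le a,b,p\le N$) $k_0(r,z)=\sum_jt_0^jt^rk_0z^{-j}$, $k_p(r,z)=\sum_jt_0^jt^rk_pz^{-j-1}$, $d_p(z)=\sum_jt_0^jd_pz^{-j-1}$, $d_{ab}(r,z)=\sum_j(r_bt_0^jt^rd_a-r_at_0^jt^rd_b)z^{-j-1}$, $\widehat d_a(r,z)=\sum_jt_0^jt^r\widehat d_az^{-j-2}$. A correspondence "field $\mapsto$ field" specifies the action of all coefficients. **The VOA $V_{Hyp}^+$.** $Hyp$ is the lattice with basis $u_1,\dots,u_N,v_1,\dots,v_N$ and $(u_i|v_j)=\delta_{ij}$, $(u_i|u_j)=(v_i|v_j)=0$. $\widehat H=(\mathbb C[t,t^{-1}]\otimes_{\mathbb Z}Hyp)\oplus\mathbb CK$ with $[x(n),y(m)]=n(x|y)\delta_{n,-m}K$, $K$ central, $x(n)=t^n\otimes x$; $\widehat H_-$ is spanned by the $x(n)$ with $n<0$. $Hyp^+$ is the sublattice generated by the $u_i$, and for $r\in\mathbb Z^N$, $ru=\sum r_iu_i$. $V_{Hyp}^+=S(\widehat H_-)\otimes\mathbb C[Hyp^+]$ with ordinary group algebra $\mathbb C[Hyp^+]$,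 vacuum $\mathbf 1=e^0$, $x(0)e^y=(x|y)e^y$, $K=1$, $x(n)e^y=0$ for $n>0$; $Y(x(-1)\mathbf 1,z)=x(z)=\sum_nx(n)z^{-n-1}$ for $x=u_p,v_p$, and $$Y(e^{x},z)=\exp\Bigl(\sum_{j\ge1}\frac{x(-j)}jz^j\Bigr)\exp\Bigl(-\sum_{j\ge1}\frac{x(j)}jz^{-j}\Bigr)e^xz^x,\quad z^xe^y=z^{(x|y)}e^y,\quad x\in Hyp^+.$$ The Virasoro element is $\omega=\sum_{p=1}^Nu_p(-1)v_p(-1)\mathbf 1$ (rank $2N$). **Notation.** $Y(a,z)=\sum_na_{(n)}z^{-n-1}$; $:a(z)b(z):$ is the normally ordered product, so $:Y(a,z)Y(b,z):\,=Y(a_{(-1)}b,z)$. *)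

theory Defs
  imports "HOL-Analysis.Finite_Cartesian_Product" "HOL-Library.Poly_Mapping" "HOL-Library.Multiset"
    "HOL-Library.Function_Algebras"
begin

section \<open>Complex vector spaces with a basis\<close>

text \<open>
  The space of finitely supported functions \<^typ>\<open>'k \<Rightarrow>\<^sub>0 complex\<close> is the complex vector space
  with basis the vectors \<open>Poly_Mapping.single k 1\<close>; \<open>lin_ext f\<close> is the linear map with prescribed values
  \<open>f k\<close> on that basis.
\<close>

definition cscale :: "complex \<Rightarrow> ('k \<Rightarrow>\<^sub>0 complex) \<Rightarrow> ('k \<Rightarrow>\<^sub>0 complex)" where
  "cscale c v = Poly_Mapping.map ((*) c) v"

lemma lookup_cscale [simp]: "Poly_Mapping.lookup (cscale c v) k = c * Poly_Mapping.lookup v k"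
  by (simp add: cscale_def Poly_Mapping.map.rep_eq when_def)

global_interpretation fvec: vector_space "cscale :: complex \<Rightarrow> ('k \<Rightarrow>\<^sub>0 complex) \<Rightarrow> ('k \<Rightarrow>\<^sub>0 complex)"
  by unfold_locales (auto intro!: poly_mapping_eqI simp: lookup_add algebra_simps)

definition lin_ext :: "('k \<Rightarrow> ('b \<Rightarrow>\<^sub>0 complex)) \<Rightarrow> ('k \<Rightarrow>\<^sub>0 complex) \<Rightarrow> ('b \<Rightarrow>\<^sub>0 complex)" where
  "lin_ext f v = (\<Sum>k\<in>Poly_Mapping.keys v. cscale (Poly_Mapping.lookup v k) (f k))"

lemma lin_ext_superset:
  assumes "finite S" "Poly_Mapping.keys v \<subseteq> S"
  shows "lin_ext f v = (\<Sum>k\<in>S. cscale (Poly_Mapping.lookup v k) (f k))"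
  unfolding lin_ext_def using assms
  by (intro sum.mono_neutral_left) (auto simp: in_keys_iff)

lemma lin_ext_zero [simp]: "lin_ext f 0 = 0"
  by (simp add: lin_ext_def)

lemma lin_ext_add: "lin_ext f (v + w) = lin_ext f v + lin_ext f w"
proof -
  let ?S = "Poly_Mapping.keys v \<union> Poly_Mapping.keys w"
  have "Poly_Mapping.keys (v + w) \<subseteq> ?S" by (rule keys_add)
  then show ?thesis
    by (simp add: lin_ext_superset[of ?S] lookup_add fvec.scale_left_distrib sum.distrib)
qed

lemma lin_ext_cscale: "lin_ext f (cscale c v) = cscale c (lin_ext f v)"
proof -
  have "Poly_Mapping.keys (cscale c v) \<subseteq> Poly_Mapping.keys v"
    by (auto simp: in_keys_iff)
  then show ?thesis
    by (simp add: lin_ext_superset[of "Poly_Mapping.keys v"] fvec.scale_sum_right)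
qed

lemma lin_ext_single: "lin_ext f (Poly_Mapping.single k c) = cscale c (f k)"
  by (simp add: lin_ext_def)

lemma linear_lin_ext: "Vector_Spaces.linear cscale cscale (lin_ext f)"
  by (auto intro!: Vector_Spaces.linear.intro simp: module_hom_def module_hom_axioms_def
      fvec.vector_space_axioms fvec.module_axioms lin_ext_add lin_ext_cscale)

lemma lin_ext_diff: "lin_ext f (v - w) = lin_ext f v - lin_ext f w"
  by (metis add_diff_cancel_right' diff_add_cancel lin_ext_add)

lemma lin_ext_sum: "lin_ext f (\<Sum>i\<in>I. v i) = (\<Sum>i\<in>I. lin_ext f (v i))"
  by (induction I rule: infinite_finite_induct) (auto simp: lin_ext_add)

lemma cscale_single: "cscale c (Poly_Mapping.single k x) = Poly_Mapping.single k (c * x)"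
  by (rule poly_mapping_eqI) (simp add: lookup_single when_def)

lemma basis_expansion: "v = (\<Sum>k\<in>Poly_Mapping.keys v. Poly_Mapping.single k (Poly_Mapping.lookup v k))"
  by (rule poly_mapping_eqI)
    (auto simp: lookup_sum lookup_single when_def in_keys_iff if_distrib cong: if_cong)

section \<open>The Lie algebra\<close>

text \<open>
  The index set \<open>{0, \<dots>, N}\<close> is \<^typ>\<open>'n option\<close> with \<open>N = CARD('n)\<close>: \<^term>\<open>None\<close> stands for \<open>0\<close> and
  \<open>Some p\<close> for \<open>p \<in> {1, \<dots>, N}\<close>.  The basis vector \<open>Poly_Mapping.single (r, p) 1\<close> is \<open>t\<^sup>r d\<^sub>p\<close> in \<open>vfield\<close> and
  \<open>t\<^sup>r k\<^sub>p\<close> in \<open>oneform\<close>.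
\<close>

type_synonym 'n expo = "int ^ 'n option"
type_synonym 'n laurent = "'n expo \<Rightarrow>\<^sub>0 complex"
type_synonym 'n vfield = "('n expo \<times> 'n option) \<Rightarrow>\<^sub>0 complex"
type_synonym 'n oneform = "('n expo \<times> 'n option) \<Rightarrow>\<^sub>0 complex"

definition exterior_d :: "'n::finite laurent \<Rightarrow> 'n oneform" where
  "exterior_d = lin_ext (\<lambda>r. \<Sum>p\<in>UNIV. Poly_Mapping.single (r, p) (of_int (r $ p)))"

lemma exterior_d_add: "exterior_d (f + g) = exterior_d f + exterior_d g"
  and exterior_d_diff: "exterior_d (f - g) = exterior_d f - exterior_d g"
  and exterior_d_cscale: "exterior_d (cscale c f) = cscale c (exterior_d f)"
  by (simp_all add: exterior_d_def lin_ext_add lin_ext_diff lin_ext_cscale)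

definition exact_rel :: "'n::finite oneform \<Rightarrow> 'n oneform \<Rightarrow> bool" where
  "exact_rel w w' \<longleftrightarrow> w - w' \<in> range exterior_d"

lemma exact_zero: "0 \<in> range exterior_d"
  by (rule range_eqI[of _ _ 0]) (simp add: exterior_d_def)

lemma exact_add: "w \<in> range exterior_d \<Longrightarrow> w' \<in> range exterior_d \<Longrightarrow> w + w' \<in> range exterior_d"
  by (auto simp flip: exterior_d_add)

lemma exact_cscale: "w \<in> range exterior_d \<Longrightarrow> cscale c w \<in> range exterior_d"
  by (auto simp flip: exterior_d_cscale)

lemma exact_uminus: "w \<in> range exterior_d \<Longrightarrow> - w \<in> range exterior_d"
  using exact_cscale[of w "-1"] by simp

lemma exact_sum: "(\<And>i. i \<in> I \<Longrightarrow> w i \<in> range exterior_d) \<Longrightarrow> (\<Sum>i\<in>I. w i) \<in> range exterior_d"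
  by (induction I rule: infinite_finite_induct) (auto intro: exact_zero exact_add)

lemma equivp_exact_rel: "equivp (exact_rel :: 'n::finite oneform \<Rightarrow> 'n oneform \<Rightarrow> bool)"
proof (rule equivpI)
  show "reflp (exact_rel :: 'n oneform \<Rightarrow> 'n oneform \<Rightarrow> bool)"
    by (auto intro!: reflpI exact_zero simp: exact_rel_def)
  show "symp (exact_rel :: 'n oneform \<Rightarrow> 'n oneform \<Rightarrow> bool)"
    unfolding exact_rel_def by (rule sympI) (metis exact_uminus minus_diff_eq)
  show "transp (exact_rel :: 'n oneform \<Rightarrow> 'n oneform \<Rightarrow> bool)"
  proof (rule transpI)
    fix w x y :: "'n oneform"
    assume "exact_rel w x" "exact_rel x y"
    then have "(w - x) + (x - y) \<in> range exterior_d"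
      unfolding exact_rel_def by (rule exact_add)
    then show "exact_rel w y" by (simp add: exact_rel_def)
  qed
qed

quotient_type (overloaded) 'n Kspace = "'n::finite oneform" / exact_rel
  morphisms rep_K abs_K by (rule equivp_exact_rel)

instantiation Kspace :: (finite) ab_group_add
begin

lift_definition zero_Kspace :: "'a Kspace" is 0 .

lift_definition plus_Kspace :: "'a Kspace \<Rightarrow> 'a Kspace \<Rightarrow> 'a Kspace" is "(+)"
  by (auto simp: exact_rel_def add_diff_add intro: exact_add)

lift_definition uminus_Kspace :: "'a Kspace \<Rightarrow> 'a Kspace" is uminus
  unfolding exact_rel_def by (metis exact_uminus minus_diff_minus)

lift_definition minus_Kspace :: "'a Kspace \<Rightarrow> 'a Kspace \<Rightarrow> 'a Kspace" is "(-)"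
proof -
  fix w w' x x' :: "'a oneform"
  assume "exact_rel w w'" "exact_rel x x'"
  then have "(w - w') + - (x - x') \<in> range exterior_d"
    unfolding exact_rel_def by (intro exact_add exact_uminus)
  then show "exact_rel (w - x) (w' - x')"
    by (simp add: exact_rel_def algebra_simps)
qed

instance
  by standard (transfer; simp add: exact_rel_def exact_zero algebra_simps)+

end

lift_definition K_scale :: "complex \<Rightarrow> 'n::finite Kspace \<Rightarrow> 'n Kspace" is cscale
  unfolding exact_rel_def by (metis exact_cscale fvec.scale_right_diff_distrib)

text \<open>
  The bracket of \<open>\<D> \<oplus> \<K>\<close>: bilinear extension of the formulas on basis vectors.  The term
  \<open>\<mu> m\<^sub>a r\<^sub>b \<Sum>\<^sub>p m\<^sub>p t\<^sup>r\<^sup>+\<^sup>m k\<^sub>p\<close> of \<open>[t\<^sup>r d\<^sub>a, t\<^sup>m d\<^sub>b]\<close> is \<open>\<mu>\<close> times \<open>vf_cocycle\<close>.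
\<close>

definition bilin_ext ::
  "('j \<Rightarrow> 'k \<Rightarrow> ('b \<Rightarrow>\<^sub>0 complex)) \<Rightarrow> ('j \<Rightarrow>\<^sub>0 complex) \<Rightarrow> ('k \<Rightarrow>\<^sub>0 complex) \<Rightarrow> ('b \<Rightarrow>\<^sub>0 complex)" where
  "bilin_ext f v w = lin_ext (\<lambda>j. lin_ext (f j) w) v"

lemma bilin_ext_diff_right: "bilin_ext f v (w - w') = bilin_ext f v w - bilin_ext f v w'"
  by (simp add: bilin_ext_def lin_ext_diff lin_ext_def[of _ v] fvec.scale_right_diff_distrib
      sum_subtractf)

lemma bilin_ext_sum:
  "bilin_ext f (\<Sum>i\<in>I. v i) (\<Sum>j\<in>J. w j) = (\<Sum>j\<in>J. \<Sum>i\<in>I. bilin_ext f (v i) (w j))"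
proof -
  have "bilin_ext f x (\<Sum>j\<in>J. w j) = (\<Sum>j\<in>J. bilin_ext f x (w j))" for x
    by (simp add: bilin_ext_def lin_ext_sum lin_ext_def[of _ x] fvec.scale_sum_right sum.swap[of _ J])
  then show ?thesis
    by (simp only:) (simp add: bilin_ext_def lin_ext_sum)
qed

definition vf_bracket :: "'n::finite vfield \<Rightarrow> 'n vfield \<Rightarrow> 'n vfield" where
  "vf_bracket = bilin_ext (\<lambda>(r, a) (m, b).
     Poly_Mapping.single (r + m, b) (of_int (m $ a)) - Poly_Mapping.single (r + m, a) (of_int (r $ b)))"

definition vf_cocycle :: "'n::finite vfield \<Rightarrow> 'n vfield \<Rightarrow> 'n oneform" where
  "vf_cocycle = bilin_ext (\<lambda>(r, a) (m, b).
     \<Sum>p\<in>UNIV. Poly_Mapping.single (r + m, p) (of_int (m $ a * r $ b * m $ p)))"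

definition vf_form_action :: "'n::finite vfield \<Rightarrow> 'n oneform \<Rightarrow> 'n oneform" where
  "vf_form_action = bilin_ext (\<lambda>(r, a) (m, b).
     Poly_Mapping.single (r + m, b) (of_int (m $ a))
     + (if a = b then \<Sum>p\<in>UNIV. Poly_Mapping.single (r + m, p) (of_int (r $ p)) else 0))"

lemma vf_form_action_exact: "vf_form_action X (exterior_d f) \<in> range exterior_d"
proof -
  have basis: "vf_form_action (Poly_Mapping.single (r, a) x) (exterior_d (Poly_Mapping.single m y))
      = exterior_d (Poly_Mapping.single (r + m) (x * y * of_int (m $ a)))" for r m :: "'a expo" and a x y
  proof -
    have "vf_form_action (Poly_Mapping.single (r, a) x) (exterior_d (Poly_Mapping.single m y))
       = (\<Sum>b\<in>UNIV. Poly_Mapping.single (r + m, b) (x * y * of_int (m $ b) * of_int (m $ a))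
           + (if a = b then \<Sum>p\<in>UNIV. Poly_Mapping.single (r + m, p) (x * y * of_int (m $ b) * of_int (r $ p)) else 0))"
      by (auto simp: vf_form_action_def bilin_ext_def exterior_d_def lin_ext_single lin_ext_sum
          fvec.scale_right_distrib fvec.scale_sum_right cscale_single mult.assoc intro!: sum.cong)
    also have "\<dots> = exterior_d (Poly_Mapping.single (r + m) (x * y * of_int (m $ a)))"
      by (simp add: exterior_d_def lin_ext_single sum.distrib fvec.scale_sum_right cscale_single
          single_add ring_distribs add.commute mult_ac fvec.scale_right_distrib)
    finally show ?thesis .
  qed
  have "vf_form_action X (exterior_d f)
      = (\<Sum>m\<in>Poly_Mapping.keys f. \<Sum>k\<in>Poly_Mapping.keys X.
          vf_form_action (Poly_Mapping.single k (Poly_Mapping.lookup X k)) (exterior_d (Poly_Mapping.single m (Poly_Mapping.lookup f m))))"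
    unfolding vf_form_action_def
    by (subst basis_expansion[of X], subst basis_expansion[of f])
      (simp only: exterior_d_def lin_ext_sum bilin_ext_sum)
  also have "\<dots> \<in> range exterior_d"
    by (intro exact_sum) (metis basis rangeI surj_pair)
  finally show ?thesis .
qed

lift_definition K_action :: "'n::finite vfield \<Rightarrow> 'n Kspace \<Rightarrow> 'n Kspace" is vf_form_action
proof -
  fix X :: "'n vfield" and w w' :: "'n oneform"
  assume "exact_rel w w'"
  then obtain f where "w - w' = exterior_d f" by (auto simp: exact_rel_def)
  moreover have "vf_form_action X w - vf_form_action X w' = vf_form_action X (w - w')"
    by (simp add: vf_form_action_def bilin_ext_diff_right)
  ultimately show "exact_rel (vf_form_action X w) (vf_form_action X w')"
    by (simp add: exact_rel_def vf_form_action_exact)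
qed

type_synonym 'n dk = "'n vfield \<times> 'n Kspace"

definition dk_scale :: "complex \<Rightarrow> 'n::finite dk \<Rightarrow> 'n dk" where
  "dk_scale c x = (cscale c (fst x), K_scale c (snd x))"

definition dk_bracket :: "complex \<Rightarrow> 'n::finite dk \<Rightarrow> 'n dk \<Rightarrow> 'n dk" where
  "dk_bracket \<mu> x y =
     (vf_bracket (fst x) (fst y),
      K_action (fst x) (snd y) - K_action (fst y) (snd x)
        + abs_K (cscale \<mu> (vf_cocycle (fst x) (fst y))))"

text \<open>The sum below is the coefficient of \<open>t\<^sup>r\<close> in \<open>\<Sum>\<^sub>p t\<^sub>p (\<partial>f\<^sub>p / \<partial>t\<^sub>p)\<close> for \<open>X = \<Sum>\<^sub>p f\<^sub>p d\<^sub>p\<close>.\<close>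

definition D_div :: "'n::finite vfield set" where
  "D_div = {X. \<forall>r. (\<Sum>p\<in>UNIV. of_int (r $ p) * Poly_Mapping.lookup X (r, p)) = 0}"

definition DK :: "'n::finite dk set" where
  "DK = D_div \<times> UNIV"


definition mk_expo :: "int \<Rightarrow> int ^ 'n::finite \<Rightarrow> 'n expo" where
  "mk_expo j r = (\<chi> i. case i of None \<Rightarrow> j | Some p \<Rightarrow> r $ p)"

text \<open>\<open>t\<^sub>0\<^sup>j t\<^sup>r d\<^sub>a\<close>, \<open>t\<^sub>0\<^sup>j t\<^sup>r k\<^sub>a\<close>, \<open>t\<^sub>0\<^sup>j t\<^sup>r d\<^sub>0\<close> with tilde, \<open>t\<^sub>0\<^sup>j t\<^sup>r d\<^sub>a\<close> with hat, and the coefficient of \<open>d\<^sub>a\<^sub>b(r, z)\<close>\<close>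

definition td :: "int \<Rightarrow> int ^ 'n::finite \<Rightarrow> 'n option \<Rightarrow> 'n dk" where
  "td j r a = (Poly_Mapping.single (mk_expo j r, a) 1, 0)"

definition tk :: "int \<Rightarrow> int ^ 'n::finite \<Rightarrow> 'n option \<Rightarrow> 'n dk" where
  "tk j r a = (0, abs_K (Poly_Mapping.single (mk_expo j r, a) 1))"

definition td0_tilde :: "complex \<Rightarrow> int \<Rightarrow> int ^ 'n::finite \<Rightarrow> 'n dk" where
  "td0_tilde \<mu> j r = - td j r None + dk_scale (\<mu> * (of_int j + 1/2)) (tk j r None)"

definition td_hat :: "complex \<Rightarrow> complex \<Rightarrow> int \<Rightarrow> int ^ 'n::finite \<Rightarrow> 'n \<Rightarrow> 'n dk" where
  "td_hat \<mu> c j r a =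
     dk_scale (of_int (r $ a)) (td0_tilde \<mu> j r) + dk_scale (of_int j) (td j r (Some a))
     + dk_scale (of_int (r $ a) / (2 * c * of_nat CARD('n)) * (of_nat CARD('n) - 1 + \<mu> * c))
         (tk j r None)"

definition td_ab :: "int \<Rightarrow> int ^ 'n::finite \<Rightarrow> 'n \<Rightarrow> 'n \<Rightarrow> 'n dk" where
  "td_ab j r a b =
     dk_scale (of_int (r $ b)) (td j r (Some a)) - dk_scale (of_int (r $ a)) (td j r (Some b))"

section \<open>Modules over a Lie algebra\<close>

text \<open>
  The Lie algebra is a complex subspace \<open>L\<close>, closed under the bracket \<open>br\<close>; the values of \<open>\<rho>\<close> outside \<open>L\<close>
  are irrelevant.
\<close>

definition lie_module ::
  "'l::ab_group_add set \<Rightarrow> (complex \<Rightarrow> 'l \<Rightarrow> 'l) \<Rightarrow> ('l \<Rightarrow> 'l \<Rightarrow> 'l) \<Rightarrow>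
   (complex \<Rightarrow> 'v::ab_group_add \<Rightarrow> 'v) \<Rightarrow> ('l \<Rightarrow> 'v \<Rightarrow> 'v) \<Rightarrow> bool" where
  "lie_module L scL br scV \<rho> \<longleftrightarrow>
     (\<forall>x\<in>L. Vector_Spaces.linear scV scV (\<rho> x)) \<and>
     (\<forall>x\<in>L. \<forall>y\<in>L. \<forall>v. \<rho> (x + y) v = \<rho> x v + \<rho> y v) \<and>
     (\<forall>c. \<forall>x\<in>L. \<forall>v. \<rho> (scL c x) v = scV c (\<rho> x v)) \<and>
     (\<forall>x\<in>L. \<forall>y\<in>L. \<forall>v. \<rho> (br x y) v = \<rho> x (\<rho> y v) - \<rho> y (\<rho> x v))"

definition irreducible_lie_module ::
  "'l::ab_group_add set \<Rightarrow> (complex \<Rightarrow> 'l \<Rightarrow> 'l) \<Rightarrow> ('l \<Rightarrow> 'l \<Rightarrow> 'l) \<Rightarrow>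
   (complex \<Rightarrow> 'v::ab_group_add \<Rightarrow> 'v) \<Rightarrow> ('l \<Rightarrow> 'v \<Rightarrow> 'v) \<Rightarrow> bool" where
  "irreducible_lie_module L scL br scV \<rho> \<longleftrightarrow>
     lie_module L scL br scV \<rho> \<and> (UNIV :: 'v set) \<noteq> {0} \<and>
     (\<forall>W. module.subspace scV W \<and> (\<forall>x\<in>L. \<rho> x ` W \<subseteq> W) \<longrightarrow> W = {0} \<or> W = UNIV)"

section \<open>The Fock space\<close>

text \<open>
  A vector of \<open>Hyp\<close> is given by its coordinates: \<open>Inl p\<close> is the coordinate at \<open>u\<^sub>p\<close> and \<open>Inr p\<close> that at \<open>v\<^sub>p\<close>.
\<close>

type_synonym 'n hyp = "int ^ ('n + 'n)"

definition hyp_form :: "'n::finite hyp \<Rightarrow> 'n hyp \<Rightarrow> int" where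
  "hyp_form x y = (\<Sum>p\<in>UNIV. x $ Inl p * y $ Inr p + x $ Inr p * y $ Inl p)"

definition hyp_u :: "'n::finite \<Rightarrow> 'n hyp" where "hyp_u p = axis (Inl p) 1"
definition hyp_v :: "'n::finite \<Rightarrow> 'n hyp" where "hyp_v p = axis (Inr p) 1"

definition hyp_ru :: "int ^ 'n::finite \<Rightarrow> 'n hyp" where
  "hyp_ru r = (\<Sum>p\<in>UNIV. r $ p *s hyp_u p)"

text \<open>
  The oscillator \<open>(Inl p, k)\<close> is \<open>u\<^sub>p(-k-1)\<close> and \<open>(Inr p, k)\<close> is \<open>v\<^sub>p(-k-1)\<close>; these form a basis of
  \<open>H\<^sub>-\<close>, so multisets of them form the monomial basis of \<open>S(H\<^sub>-)\<close>.  The basis vector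
  \<open>Poly_Mapping.single (M, r) 1\<close> of the Fock space is \<open>M \<otimes> e\<^sup>r\<^sup>u\<close>.
\<close>

type_synonym 'n osc = "('n + 'n) \<times> nat"
type_synonym 'n fock = "('n osc multiset \<times> (int ^ 'n)) \<Rightarrow>\<^sub>0 complex"

definition exp_vec :: "int ^ 'n::finite \<Rightarrow> 'n fock" where "exp_vec r = Poly_Mapping.single ({#}, r) 1"
definition vacuum :: "'n::finite fock" where "vacuum = exp_vec 0"

text \<open>
  The action of \<open>x(n)\<close>: multiplication by \<open>x(n)\<close> for \<open>n < 0\<close>, the scalar \<open>(x | ru)\<close> on \<open>S(H\<^sub>-) \<otimes> e\<^sup>r\<^sup>u\<close> for
  \<open>n = 0\<close>, and for \<open>n > 0\<close> the derivation of \<open>S(H\<^sub>-)\<close> with \<open>y(-m) \<mapsto> n (x|y) \<delta>\<^sub>n\<^sub>m\<close>.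
\<close>

definition heis :: "'n::finite hyp \<Rightarrow> int \<Rightarrow> 'n fock \<Rightarrow> 'n fock" where
  "heis x n = lin_ext (\<lambda>(M, r).
     if n < 0 then \<Sum>b\<in>UNIV. Poly_Mapping.single (add_mset (b, nat (- n - 1)) M, r) (of_int (x $ b))
     else if n = 0 then Poly_Mapping.single (M, r) (of_int (hyp_form x (hyp_ru r)))
     else \<Sum>b\<in>UNIV. Poly_Mapping.single (M - {#(b, nat (n - 1))#}, r)
       (of_int (n * hyp_form x (axis b 1)) * of_nat (count M (b, nat (n - 1)))))"

section \<open>Fields and vertex operators\<close>

text \<open>
  The formal distribution \<open>\<Sum>\<^sub>n F n z\<^sup>-\<^sup>n\<^sup>-\<^sup>1\<close> is given by its modes \<open>F n\<close>; its coefficient of \<open>z\<^sup>k\<close> is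
  \<open>zcoeff F k\<close>.  \<open>nop\<close> is the normally ordered product, \<open>fprod\<close> the plain one.  The infinite sums of
  operators below have, on each vector, only finitely many nonzero terms.
\<close>

type_synonym 'n field = "int \<Rightarrow> 'n fock \<Rightarrow> 'n fock"

definition zcoeff :: "'n field \<Rightarrow> int \<Rightarrow> 'n fock \<Rightarrow> 'n fock" where
  "zcoeff F k = F (- k - 1)"

definition fscale :: "complex \<Rightarrow> 'n field \<Rightarrow> 'n field" where
  "fscale c F = (\<lambda>n w. cscale c (F n w))"

definition fderiv :: "'n field \<Rightarrow> 'n field" where
  "fderiv F = (\<lambda>n w. cscale (- of_int n) (F (n - 1) w))"

definition zinv_mult :: "'n field \<Rightarrow> 'n field" where
  "zinv_mult F = (\<lambda>n. F (n - 1))"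

definition fprod :: "'n field \<Rightarrow> 'n field \<Rightarrow> 'n field" where
  "fprod A B = (\<lambda>m w. Sum_any (\<lambda>n. A n (B (m - n - 1) w)))"

definition nop :: "'n field \<Rightarrow> 'n field \<Rightarrow> 'n field" where
  "nop A B = (\<lambda>m w. Sum_any (\<lambda>n.
     if n < 0 then A n (B (m - n - 1) w) else B (m - n - 1) (A n w)))"

text \<open>
  For operators \<open>A j\<close> (\<open>j \<ge> 1\<close>), the coefficient of \<open>z\<^sup>k\<close> in \<open>exp (\<Sum>\<^sub>j A j z\<^sup>j)\<close>: the sum over all
  \<open>(j\<^sub>1, \<dots>, j\<^sub>l)\<close> with \<open>j\<^sub>1 + \<dots> + j\<^sub>l = k\<close> of \<open>(1 / l!) A j\<^sub>1 \<circ> \<dots> \<circ> A j\<^sub>l\<close>.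
\<close>

definition exp_coeff :: "(nat \<Rightarrow> 'n fock \<Rightarrow> 'n fock) \<Rightarrow> nat \<Rightarrow> 'n fock \<Rightarrow> 'n fock" where
  "exp_coeff A k w =
     (\<Sum>js | 0 \<notin> set js \<and> sum_list js = k. cscale (1 / fact (length js)) (foldr A js w))"

text \<open>Multiplication by \<open>e\<^sup>r\<^sup>u\<close>, and the coefficient of \<open>z\<^sup>s\<close> in the operator \<open>z\<^sup>r\<^sup>u\<close>\<close>

definition exp_mult :: "int ^ 'n::finite \<Rightarrow> 'n fock \<Rightarrow> 'n fock" where
  "exp_mult r = lin_ext (\<lambda>(M, q). Poly_Mapping.single (M, r + q) 1)"

definition zpow_coeff :: "int ^ 'n::finite \<Rightarrow> int \<Rightarrow> 'n fock \<Rightarrow> 'n fock" where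
  "zpow_coeff r s = lin_ext (\<lambda>(M, q).
     if hyp_form (hyp_ru r) (hyp_ru q) = s then Poly_Mapping.single (M, q) 1 else 0)"

definition exp_field :: "int ^ 'n::finite \<Rightarrow> 'n field" where
  "exp_field r = (\<lambda>n w. Sum_any (\<lambda>(i, l, s).
     if int i - int l + s = - n - 1
     then exp_coeff (\<lambda>j w. cscale (1 / of_nat j) (heis (hyp_ru r) (- int j) w)) i
           (exp_coeff (\<lambda>j w. cscale (- 1 / of_nat j) (heis (hyp_ru r) (int j) w)) l
             (exp_mult r (zpow_coeff r s w)))
     else 0))"

text \<open>
  The state-field correspondence.  For \<open>b \<in> {u\<^sub>p, v\<^sub>p}\<close>, \<open>osc_field (b, k)\<close> is \<open>(1 / k!) (\<partial> / \<partial>z)\<^sup>k b(z)\<close>,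
  the field of \<open>b(-k-1)\<one>\<close>; it is the normally ordered product with this field that corresponds to
  the operator \<open>b(-k-1)\<close>, and such products with different oscillators commute.
\<close>

definition osc_field :: "'n::finite osc \<Rightarrow> 'n field" where
  "osc_field = (\<lambda>(b, k). fscale (1 / fact k) ((fderiv ^^ k) (heis (axis b 1))))"

definition monomial_field :: "'n::finite osc multiset \<times> (int ^ 'n) \<Rightarrow> 'n field" where
  "monomial_field = (\<lambda>(M, r). fold_mset (\<lambda>x F. nop (osc_field x) F) (exp_field r) M)"

definition vertex_op :: "'n::finite fock \<Rightarrow> 'n field" where
  "vertex_op a = (\<lambda>n w. lin_ext (\<lambda>k. monomial_field k n w) a)"

definition omega :: "'n::finite fock" where
  "omega = (\<Sum>p\<in>UNIV. heis (hyp_u p) (-1) (heis (hyp_v p) (-1) vacuum))"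

section \<open>The Heisenberg relations and the fields of the generators\<close>


lemma hyp_form_axis: "hyp_form x (axis b 1) = (case b of Inl p \<Rightarrow> x $ Inr p | Inr p \<Rightarrow> x $ Inl p)"
  by (cases b) (auto simp: hyp_form_def axis_def if_distrib[of "(*) _"] sum.delta cong: if_cong)

lemma hyp_form_expand: "hyp_form x y = (\<Sum>b\<in>UNIV. x $ b * hyp_form y (axis b 1))"
  unfolding UNIV_Plus_UNIV[symmetric] sum.Plus[OF finite finite]
  by (simp add: hyp_form_axis, simp add: hyp_form_def sum.distrib)

lemma hyp_form_uv: "hyp_form (hyp_u p) (hyp_v q) = (if p = q then 1 else 0)"
  and hyp_form_uu: "hyp_form (hyp_u p) (hyp_u q) = 0"
  and hyp_form_vv: "hyp_form (hyp_v p) (hyp_v q) = 0"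
  unfolding hyp_u_def hyp_v_def by (simp_all add: hyp_form_axis) (auto simp: axis_def)

lemma hyp_ru_nth [simp]: "hyp_ru r $ Inl p = r $ p" "hyp_ru r $ Inr p = 0"
  by (auto simp: hyp_ru_def hyp_u_def axis_def if_distrib[of "(*) _"] cong: if_cong)

lemma hyp_form_ru_ru [simp]: "hyp_form (hyp_ru r) (hyp_ru q) = 0"
  by (simp add: hyp_form_def)

lemma linearI_cscale:
  assumes "\<And>v w. f (v + w) = f v + f w" "\<And>c v. f (cscale c v) = cscale c (f v)"
  shows "Vector_Spaces.linear cscale cscale f"
  by (auto intro!: Vector_Spaces.linear.intro simp: module_hom_def module_hom_axioms_def
      fvec.vector_space_axioms fvec.module_axioms assms)

lemma linear_ext_eq:
  assumes "Vector_Spaces.linear cscale cscale f" "Vector_Spaces.linear cscale cscale g"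
    and eq: "\<And>k. f (Poly_Mapping.single k 1) = g (Poly_Mapping.single k 1)"
  shows "f w = g w"
proof -
  interpret f: Vector_Spaces.linear cscale cscale f by fact
  interpret g: Vector_Spaces.linear cscale cscale g by fact
  have s: "f (Poly_Mapping.single k c) = g (Poly_Mapping.single k c)" for k c
    using eq[of k] f.scale[of c "Poly_Mapping.single k 1"] g.scale[of c "Poly_Mapping.single k 1"] by (simp add: cscale_single)
  show ?thesis
    by (subst (1 2) basis_expansion[of w]) (simp add: f.sum g.sum s)
qed

lemma linear_heis: "Vector_Spaces.linear cscale cscale (heis x n)"
  unfolding heis_def by (rule linear_lin_ext)

lemma heis_add: "heis x n (v + w) = heis x n v + heis x n w"
  and heis_cscale: "heis x n (cscale c v) = cscale c (heis x n v)"
  and heis_sum: "heis x n (\<Sum>i\<in>I. f i) = (\<Sum>i\<in>I. heis x n (f i))"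
  and heis_zero [simp]: "heis x n 0 = 0"
  by (simp_all add: heis_def lin_ext_add lin_ext_cscale lin_ext_sum)

lemma heis_neg: "n < 0 \<Longrightarrow> heis x n (Poly_Mapping.single (M, r) c) =
    (\<Sum>b\<in>UNIV. Poly_Mapping.single (add_mset (b, nat (- n - 1)) M, r) (c * of_int (x $ b)))"
  and heis_0: "heis x 0 (Poly_Mapping.single (M, r) c) = Poly_Mapping.single (M, r) (c * of_int (hyp_form x (hyp_ru r)))"
  and heis_pos: "n > 0 \<Longrightarrow> heis x n (Poly_Mapping.single (M, r) c) =
    (\<Sum>b\<in>UNIV. Poly_Mapping.single (M - {#(b, nat (n - 1))#}, r)
      (c * (of_int (n * hyp_form x (axis b 1)) * of_nat (count M (b, nat (n - 1))))))"
  by (simp_all add: heis_def lin_ext_single fvec.scale_sum_right cscale_single)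

lemma heis_commute_term:
  "Poly_Mapping.single (add_mset o1 M - {#o2#}, r) (a * of_nat (count (add_mset o1 M) o2) :: complex)
   = Poly_Mapping.single (add_mset o1 (M - {#o2#}), r) (a * of_nat (count M o2)) + (if o1 = o2 then Poly_Mapping.single (M, r) a else 0)"
proof (cases "o2 \<in># M")
  case True
  then show ?thesis
    by (auto simp: ring_distribs single_add)
next
  case False
  then have "count M o2 = 0" by (simp add: not_in_iff)
  then show ?thesis by auto
qed

lemma heis_commutator_mixed:
  assumes "n < 0" "m > 0"
  shows "heis y m (heis x n (Poly_Mapping.single (M, r) 1)) = heis x n (heis y m (Poly_Mapping.single (M, r) 1))
    + cscale (if m = - n then of_int (m * hyp_form x y) else 0) (Poly_Mapping.single (M, r) 1)"
proof -
  define k l where "k = nat (- n - 1)" and "l = nat (m - 1)"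
  have kl: "k = l \<longleftrightarrow> m = - n" using assms by (auto simp: k_def l_def)
  let ?a = "\<lambda>b b'. complex_of_int (x $ b) * of_int (m * hyp_form y (axis b' 1))"
  have "heis y m (heis x n (Poly_Mapping.single (M, r) 1)) = (\<Sum>b\<in>UNIV. \<Sum>b'\<in>UNIV.
      Poly_Mapping.single (add_mset (b, k) M - {#(b', l)#}, r) (?a b b' * of_nat (count (add_mset (b, k) M) (b', l))))"
    using assms by (simp add: heis_neg heis_pos heis_sum k_def l_def mult.assoc)
  also have "\<dots> = (\<Sum>b\<in>UNIV. \<Sum>b'\<in>UNIV.
      Poly_Mapping.single (add_mset (b, k) (M - {#(b', l)#}), r) (?a b b' * of_nat (count M (b', l))))
     + (\<Sum>b\<in>UNIV. \<Sum>b'\<in>UNIV. if (b, k) = (b', l) then Poly_Mapping.single (M, r) (?a b b') else 0)"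
    unfolding heis_commute_term by (simp add: sum.distrib)
  also have "(\<Sum>b\<in>UNIV. \<Sum>b'\<in>UNIV.
      Poly_Mapping.single (add_mset (b, k) (M - {#(b', l)#}), r) (?a b b' * of_nat (count M (b', l))))
     = heis x n (heis y m (Poly_Mapping.single (M, r) 1))"
    using assms by (subst sum.swap) (simp add: heis_neg heis_pos heis_sum k_def l_def mult_ac)
  also have "(\<Sum>b\<in>UNIV. \<Sum>b'\<in>UNIV. if (b, k) = (b', l) then Poly_Mapping.single (M, r) (?a b b') else 0)
     = cscale (if m = - n then of_int (m * hyp_form x y) else 0) (Poly_Mapping.single (M, r) 1)"
  proof (cases "k = l")
    case True
    have "(\<Sum>b\<in>UNIV. Poly_Mapping.single (M, r) (?a b b)) = Poly_Mapping.single (M, r) (\<Sum>b\<in>UNIV. ?a b b)"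
      by (rule poly_mapping_eqI) (auto simp: lookup_sum lookup_single when_def)
    also have "(\<Sum>b\<in>UNIV. ?a b b) = of_int (m * hyp_form x y)"
      unfolding hyp_form_expand[of x y] by (simp add: sum_distrib_left mult_ac)
    finally show ?thesis using True kl by (simp add: cscale_single if_distrib[of "Poly_Mapping.single _"] cong: if_cong)
  next
    case False
    then show ?thesis using kl by (simp add: cscale_single)
  qed
  finally show ?thesis .
qed

lemma hyp_form_commute: "hyp_form x y = hyp_form y x"
  by (simp add: hyp_form_def mult.commute add.commute)

lemma heis_annihilate_term:
  "Poly_Mapping.single (M - {#o1#} - {#o2#}, r) (1 * (a * of_nat (count M o1)) * (b * of_nat (count (M - {#o1#}) o2)) :: complex)
   = Poly_Mapping.single (M - {#o2#} - {#o1#}, r) (1 * (b * of_nat (count M o2)) * (a * of_nat (count (M - {#o2#}) o1)))"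
  by (cases "o1 = o2") (auto simp: mult_ac add_mset_commute)

lemma heis_commutator_basis:
  "heis x n (heis y m (Poly_Mapping.single (M, r) 1)) = heis y m (heis x n (Poly_Mapping.single (M, r) 1))
     + cscale (if m = - n then of_int (n * hyp_form x y) else 0) (Poly_Mapping.single (M, r) 1)"
proof -
  consider "n < 0" "m < 0" | "n < 0" "m > 0" | "n > 0" "m < 0" | "n > 0" "m > 0" | "n = 0" | "m = 0"
    by linarith
  then show ?thesis
  proof cases
    case 1
    then show ?thesis
      by (simp add: heis_neg heis_sum) (subst sum.swap, simp add: mult.commute add_mset_commute)
  next
    case 2
    from heis_commutator_mixed[OF this, where x = x and y = y and M = M and r = r] 2 show ?thesis
      by (auto simp: cscale_single algebra_simps simp flip: single_add)
  next
    case 3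
    from heis_commutator_mixed[OF 3(2,1), where x = y and y = x and M = M and r = r] 3 show ?thesis
      by (auto simp: hyp_form_commute[of y x])
  next
    case 4
    have "heis x n (heis y m (Poly_Mapping.single (M, r) 1)) = heis y m (heis x n (Poly_Mapping.single (M, r) 1))"
      unfolding heis_pos[OF 4(1)] heis_pos[OF 4(2)] heis_sum
      by (subst sum.swap) (intro sum.cong refl heis_annihilate_term)
    then show ?thesis using 4 by simp
  next
    case 5
    then show ?thesis
      by (cases "m = 0"; cases "m < 0") (simp_all add: heis_0 heis_neg heis_pos heis_sum mult_ac)
  next
    case 6
    then show ?thesis
      by (cases "n = 0"; cases "n < 0") (simp_all add: heis_0 heis_neg heis_pos heis_sum mult_ac)
  qed
qed

theorem heis_commutator:
  "heis x n (heis y m w) - heis y m (heis x n w)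
     = cscale (if m = - n then of_int (n * hyp_form x y) else 0) w"
proof -
  have "heis x n (heis y m w) = heis y m (heis x n w)
     + cscale (if m = - n then of_int (n * hyp_form x y) else 0) w"
  proof (rule linear_ext_eq[where f = "\<lambda>w. heis x n (heis y m w)" and g = "\<lambda>w. heis y m (heis x n w)
        + cscale (if m = - n then of_int (n * hyp_form x y) else 0) w"])
    show "heis x n (heis y m (Poly_Mapping.single k 1)) = heis y m (heis x n (Poly_Mapping.single k 1))
        + cscale (if m = - n then of_int (n * hyp_form x y) else 0) (Poly_Mapping.single k 1)" for k
      by (cases k, hypsubst, rule heis_commutator_basis)
    show "Vector_Spaces.linear cscale cscale (\<lambda>w. heis x n (heis y m w))"
      by (rule linearI_cscale) (simp_all add: heis_add heis_cscale)
    show "Vector_Spaces.linear cscale cscale (\<lambda>w. heis y m (heis x n w)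
        + cscale (if m = - n then of_int (n * hyp_form x y) else 0) w)"
      by (rule linearI_cscale)
        (simp_all add: heis_add heis_cscale fvec.scale_right_distrib fvec.scale_left_commute)
  qed
  then show ?thesis by simp
qed

lemma heis_exp_vec:
  "n > 0 \<Longrightarrow> heis x n (exp_vec r) = 0"
  "heis x 0 (exp_vec r) = cscale (of_int (hyp_form x (hyp_ru r))) (exp_vec r)"
  by (simp_all add: exp_vec_def heis_pos heis_0 cscale_single)

lemma vertex_op_add: "vertex_op (a + b) n w = vertex_op a n w + vertex_op b n w"
  and vertex_op_cscale: "vertex_op (cscale c a) n w = cscale c (vertex_op a n w)"
  and vertex_op_single: "vertex_op (Poly_Mapping.single k c) n w = cscale c (monomial_field k n w)"
  and vertex_op_sum: "vertex_op (\<Sum>i\<in>I. f i) n w = (\<Sum>i\<in>I. vertex_op (f i) n w)"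
  by (simp_all add: vertex_op_def lin_ext_add lin_ext_cscale lin_ext_single lin_ext_sum)

lemma vertex_op_exp_vec: "vertex_op (exp_vec r) = exp_field r"
  by (intro ext) (simp add: exp_vec_def vertex_op_single monomial_field_def)

lemma exp_coeff_zero:
  assumes "\<And>j w. A j w = 0"
  shows "exp_coeff A k w = (if k = 0 then w else 0)"
proof (cases "k = 0")
  case True
  have "js = []" if "0 \<notin> set js" "sum_list js = 0" for js :: "nat list"
    using that by (cases js) auto
  then have "{js :: nat list. 0 \<notin> set js \<and> sum_list js = 0} = {[]}"
    by auto
  then show ?thesis using True by (simp add: exp_coeff_def)
next
  case False
  have "foldr A js w = 0" if "sum_list js = k" for js
    using that False assms by (cases js) auto
  then show ?thesis using False by (simp add: exp_coeff_def)
qed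

lemma heis_zero_left [simp]: "heis 0 n w = 0"
proof -
  have "heis 0 n w = lin_ext (\<lambda>_. 0) w"
    unfolding heis_def by (rule arg_cong[where f = "\<lambda>f. lin_ext f w"]) (auto simp: fun_eq_iff hyp_form_def)
  then show ?thesis by (simp add: lin_ext_def)
qed

lemma hyp_ru_0 [simp]: "hyp_ru 0 = 0"
  by (simp add: hyp_ru_def)

lemma lin_ext_id [simp]: "lin_ext (\<lambda>k. Poly_Mapping.single k 1) w = w"
  by (simp add: lin_ext_def cscale_single flip: basis_expansion)

lemma exp_field_0:
  fixes w :: "'a::finite fock"
  shows "exp_field 0 n w = (if n = - 1 then w else 0)"
proof -
  have e: "exp_mult 0 v = v" for v :: "'a fock"
    by (simp add: exp_mult_def case_prod_unfold)
  have z: "zpow_coeff 0 s v = (if s = 0 then v else 0)" for s and v :: "'a fock"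
    using hyp_form_ru_ru[of 0 "snd k" for k :: "'a osc multiset \<times> (int ^ 'a)"]
    by (auto simp: zpow_coeff_def case_prod_unfold lin_ext_def[of "\<lambda>_. 0"])
  have "exp_field 0 n w = Sum_any (\<lambda>t :: nat \<times> nat \<times> int. if t = (0, 0, 0) then if n = - 1 then w else 0 else 0)"
    unfolding exp_field_def by (rule arg_cong[where f = Sum_any]) (auto simp: fun_eq_iff exp_coeff_zero e z)
  then show ?thesis by simp
qed

lemma nop_exp_field_0:
  assumes "\<And>n. A n 0 = 0"
  shows "nop A (exp_field 0) = A"
proof (intro ext)
  fix m w
  have "nop A (exp_field 0) m w = Sum_any (\<lambda>n. if n = m then A n w else 0)"
    unfolding nop_def by (intro Sum_any.cong) (auto simp: exp_field_0 assms)
  then show "nop A (exp_field 0) m w = A m w" by simp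
qed

lemma osc_field_0: "osc_field (b, 0) = heis (axis b 1)"
  by (simp add: osc_field_def fscale_def)

lemma monomial_field_osc: "monomial_field ({#(b, 0)#}, 0) = heis (axis b 1)"
  by (simp add: monomial_field_def osc_field_0 nop_exp_field_0)

lemma heis_axis: "heis (axis b 1) (-1) (Poly_Mapping.single (M, r) c) = Poly_Mapping.single (add_mset (b, 0) M, r) c"
proof -
  have "heis (axis b 1) (-1) (Poly_Mapping.single (M, r) c) =
      (\<Sum>b'\<in>UNIV. if b' = b then Poly_Mapping.single (add_mset (b, 0) M, r) c else 0)"
    by (subst heis_neg, simp, rule sum.cong) (auto simp: axis_def)
  then show ?thesis by simp
qed

theorem vertex_op_uv:
  "vertex_op (heis (hyp_u p) (-1) vacuum) = heis (hyp_u p)"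
  "vertex_op (heis (hyp_v p) (-1) vacuum) = heis (hyp_v p)"
  by (auto simp: fun_eq_iff hyp_u_def hyp_v_def vacuum_def exp_vec_def heis_axis vertex_op_single
      monomial_field_osc)

lemma nop_heis_commute: "nop (heis x) (heis y) = nop (heis y) (heis x)"
proof (intro ext)
  fix m w
  have "Sum_any (\<lambda>n. if n < 0 then heis x n (heis y (m - n - 1) w) else heis y (m - n - 1) (heis x n w))
      = Sum_any (\<lambda>n. if n < 0 then heis y n (heis x (m - n - 1) w) else heis x (m - n - 1) (heis y n w))"
  proof (rule Sum_any.reindex_cong[of "\<lambda>n. m - n - 1"])
    show "bij (\<lambda>n. m - n - 1)" by (rule bij_betw_byWitness[of _ "\<lambda>n. m - n - 1"]) auto
    show "(\<lambda>n. if n < 0 then heis x n (heis y (m - n - 1) w) else heis y (m - n - 1) (heis x n w))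
      \<circ> (\<lambda>n. m - n - 1)
      = (\<lambda>n. if n < 0 then heis y n (heis x (m - n - 1) w) else heis x (m - n - 1) (heis y n w))"
    proof (intro ext)
      fix n
      have "heis x (m - n - 1) (heis y n w) = heis y n (heis x (m - n - 1) w)"
        if "n \<noteq> 1 - m + n \<or> n = 0"
        using heis_commutator[of x "m - n - 1" y n w] that by (auto split: if_splits)
      then show "((\<lambda>n. if n < 0 then heis x n (heis y (m - n - 1) w) else heis y (m - n - 1) (heis x n w))
      \<circ> (\<lambda>n. m - n - 1)) n
      = (if n < 0 then heis y n (heis x (m - n - 1) w) else heis x (m - n - 1) (heis y n w))"
        by (cases "m = 1") auto
    qed
  qed
  then show "nop (heis x) (heis y) m w = nop (heis y) (heis x) m w"
    by (simp add: nop_def)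
qed

lemma fold_mset_two:
  assumes "x \<noteq> y" "f x (f y s) = f y (f x s)"
  shows "fold_mset f s {#x, y#} = f x (f y s)"
proof -
  let ?g = "\<lambda>z. f z ^^ count {#x, y#} z"
  have g: "?g x = f x" "?g y = f y" using assms(1) by auto
  have 1: "v = s" if "fold_graph ?g s {} v" for v
    using that by (rule fold_graph.cases) auto
  have two: "v = ?g z s" if z: "fold_graph ?g s {z} v" for v z
    using z
  proof (rule fold_graph.cases)
    fix z' A v'
    assume *: "{z} = insert z' A" "v = ?g z' v'" "z' \<notin> A" "fold_graph ?g s A v'"
    then have "z' = z" "A = {}" by auto
    then show ?thesis using * 1 by metis
  qed auto
  have 3: "v = f x (f y s)" if "fold_graph ?g s {x, y} v" for v
    using that
  proof (rule fold_graph.cases)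
    fix z A v'
    assume *: "{x, y} = insert z A" "v = ?g z v'" "z \<notin> A" "fold_graph ?g s A v'"
    from *(1,3) have A: "A = {x, y} - {z}" and z: "z = x \<or> z = y" by blast+
    from z consider "z = x" "A = {y}" | "z = y" "A = {x}"
      unfolding A using assms(1) by blast
    then show ?thesis
    proof cases
      case 1
      with *(4) have "v' = ?g y s" by (intro two) simp
      with 1 *(2) g show ?thesis by metis
    next
      case 2
      with *(4) have "v' = ?g x s" by (intro two) simp
      with 2 *(2) g assms(2) show ?thesis by metis
    qed
  qed auto
  have "fold_graph ?g s {x, y} (?g x (?g y s))"
    using assms(1) by (intro fold_graph.intros) auto
  then have "fold_graph ?g s {x, y} (f x (f y s))" unfolding g .
  then have "(THE v. fold_graph ?g s {x, y} v) = f x (f y s)"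
    using 3 by (rule the_equality)
  moreover have "finite {x, y}" by simp
  ultimately have "Finite_Set.fold ?g s {x, y} = f x (f y s)"
    unfolding Finite_Set.fold_def by (simp only: if_True)
  then show ?thesis by (simp add: fold_mset_def)
qed

theorem vertex_op_omega:
  fixes w :: "'a::finite fock"
  shows "vertex_op omega n w = (\<Sum>p\<in>UNIV. nop (heis (hyp_u p)) (heis (hyp_v p)) n w)"
proof -
  have "monomial_field ({#(Inl p, 0), (Inr p, 0)#}, 0) = nop (heis (hyp_u p)) (heis (hyp_v p))" for p :: 'a
    unfolding monomial_field_def prod.case
    by (subst fold_mset_two)
      (simp_all add: osc_field_0 nop_exp_field_0 hyp_u_def hyp_v_def nop_heis_commute)
  note m = this
  have o: "omega = (\<Sum>p\<in>UNIV. Poly_Mapping.single ({#(Inl p, 0), (Inr p, 0)#}, 0 :: int ^ 'a) 1)"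
    by (simp add: omega_def vacuum_def exp_vec_def hyp_u_def hyp_v_def heis_axis)
  show ?thesis
    unfolding o vertex_op_sum vertex_op_single m by simp
qed

end

theory Submission
  imports Defs
begin

text \<open>
  The fields \<open>u\<^sub>p(z)\<close> and \<open>Y(e\<^sup>r\<^sup>u, z)\<close> commute with one another, and all
  other fields in the statement are of first order in the \<open>v\<^sub>p(z)\<close>, which act on the former by derivations.  For
  \<open>:\<omega>(z) Y(e\<^sup>r\<^sup>u, z):\<close> this becomes visible only after the two normally ordered products have been
  rearranged, which produces a term with \<open>\<partial>u\<^sub>p(z)\<close> (\<open>nop_virasoro_exp_field\<close>).  The prescribed formulas
  are met by operators for \<open>t\<^sub>0\<^sup>j t\<^sup>r d\<^sub>a\<close> and \<open>t\<^sub>0\<^sup>j t\<^sup>r d\<^sub>0\<close> separately, hence for all of \<open>\<D>\<close>, namely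
  the modes \<open>j\<close> of \<open>:v\<^sub>a(z) Y(e\<^sup>r\<^sup>u, z):\<close> and
  \<open>(j + 1) Y(e\<^sup>r\<^sup>u)\<^sub>(\<^sub>j\<^sub>-\<^sub>1\<^sub>) - (:\<omega> Y(e\<^sup>r\<^sup>u):)\<^sub>(\<^sub>j\<^sub>+\<^sub>1\<^sub>)\<close>; their linear extension is the
  representation \<open>rho\<close>.  Exact forms act by zero because \<open>\<partial>Y(e\<^sup>r\<^sup>u, z) = (ru)(z) Y(e\<^sup>r\<^sup>u, z)\<close>, and the
  brackets of \<open>\<D>\<close> with \<open>\<K>\<close> are those of derivations acting on a commutative algebra of fields.

  Identities between operators are reduced to the vacuum by one principle (\<open>operators_vanish\<close>): if a
  graded family of operators commutes with all \<open>u\<^sub>p(n)\<close>, and its commutators with the \<open>v\<^sub>p(n)\<close> stay in the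
  family, then annihilation operators push \<open>X e\<^sup>q\<^sup>u\<close> down to weight 0, and creation operators
  carry \<open>X = 0\<close> from the vectors \<open>e\<^sup>q\<^sup>u\<close> to the whole Fock space.  It yields the products of
  the fields (\<open>nop_exp_exp\<close>, \<open>nop_u_u_swap\<close> and so on).  It also yields the bracket of two vector
  fields: by the Jacobi identity, the differences \<open>[\<rho>(x), \<rho>(y)] - \<rho>([x, y])\<close> for divergence-free
  \<open>x\<close> and \<open>y\<close> form such a family (\<open>heis_v_defect\<close>), because \<open>v\<^sub>p(n)\<close> is the action of \<open>t\<^sub>0\<^sup>n d\<^sub>p\<close> and
  because the differences commute with \<open>\<K>\<close>.  What remains is the component of weight 0 of the difference
  applied to the vacuum, for \<open>x\<close> of degree \<open>i > 0\<close> and \<open>y\<close> of degree \<open>-i\<close> in \<open>t\<^sub>0\<close>, which is a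
  finite sum (\<open>defect_vacuum_pos\<close>).  The trace over the \<open>N\<close> pairs \<open>u\<^sub>p, v\<^sub>p\<close> contributes
  \<open>N (i\<^sup>3 - i) / 6\<close> times the product of the \<open>d\<^sub>0\<close>-coefficients, and the other terms, among them the
  cocycle of \<open>\<D>\<K>(1)\<close>, balance it if the factor is \<open>2 (i\<^sup>3 - i)\<close>; this is where \<open>N = 12\<close> is used.

  For irreducibility, annihilation operators bring a nonzero vector of a submodule down to a nonzero combination
  of the \<open>e\<^sup>q\<^sup>u\<close>, the zero modes \<open>v\<^sub>p(0)\<close> isolate one of them, the coefficients of
  \<open>Y(e\<^sup>r\<^sup>u, z)\<close> move it to every \<open>e\<^sup>q\<^sup>u\<close>, and the creation operators generate the rest.  All these
  operators come from elements of \<open>\<D>\<K>(1)\<close>.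
\<close>

section \<open>Linear operators and the weight grading of the Fock space\<close>

definition linop :: "('a fock \<Rightarrow> 'a fock) \<Rightarrow> bool" where
  "linop f \<longleftrightarrow> (\<forall>v w. f (v + w) = f v + f w) \<and> (\<forall>c v. f (cscale c v) = cscale c (f v))"

lemma linopI:
  "(\<And>v w. f (v + w) = f v + f w) \<Longrightarrow> (\<And>c v. f (cscale c v) = cscale c (f v)) \<Longrightarrow> linop f"
  by (simp add: linop_def)

lemma linop_add: "linop f \<Longrightarrow> f (v + w) = f v + f w"
  and linop_cscale: "linop f \<Longrightarrow> f (cscale c v) = cscale c (f v)"
  by (simp_all add: linop_def)

lemma linop_0: "linop f \<Longrightarrow> f 0 = 0"
  using linop_cscale[of f 0 0] by simp

lemma linop_minus: "linop f \<Longrightarrow> f (- v) = - f v"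
  using linop_cscale[of f "- 1" v] by simp

lemma linop_diff: "linop f \<Longrightarrow> f (v - w) = f v - f w"
  using linop_add[of f v "- w"] by (simp add: linop_minus)

lemma linop_sum: "linop f \<Longrightarrow> f (\<Sum>i\<in>I. g i) = (\<Sum>i\<in>I. f (g i))"
  by (induction I rule: infinite_finite_induct) (auto simp: linop_0 linop_add)

lemma linop_Sum_any:
  assumes "linop f" "finite {a. g a \<noteq> 0}"
  shows "f (Sum_any g) = Sum_any (\<lambda>a. f (g a))"
proof -
  have "Sum_any (\<lambda>a. f (g a)) = (\<Sum>a\<in>{a. g a \<noteq> 0}. f (g a))"
    using assms by (intro Sum_any.expand_superset) (auto simp: linop_0)
  then show ?thesis using assms by (simp add: Sum_any.expand_set linop_sum)
qed

lemma linear_iff_linop: "Vector_Spaces.linear cscale cscale f \<longleftrightarrow> linop f"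
proof
  assume "Vector_Spaces.linear cscale cscale f"
  then interpret Vector_Spaces.linear cscale cscale f .
  show "linop f" by (rule linopI) (rule add, rule scale)
qed (auto intro: linearI_cscale simp: linop_def)

lemma linop_heis: "linop (heis x n)"
  by (simp add: linop_def heis_add heis_cscale)

lemma linop_zero: "linop (\<lambda>w. 0)"
  and linop_ident: "linop (\<lambda>w. w)"
  and linop_plus: "linop f \<Longrightarrow> linop g \<Longrightarrow> linop (\<lambda>w. f w + g w)"
  and linop_minus2: "linop f \<Longrightarrow> linop g \<Longrightarrow> linop (\<lambda>w. f w - g w)"
  and linop_scale: "linop f \<Longrightarrow> linop (\<lambda>w. cscale c (f w))"
  and linop_comp: "linop f \<Longrightarrow> linop g \<Longrightarrow> linop (\<lambda>w. f (g w))"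
  by (auto simp: linop_def fvec.scale_right_distrib fvec.scale_right_diff_distrib fvec.scale_left_commute
       mult.commute)

lemma linop_sum_op: "(\<And>i. i \<in> I \<Longrightarrow> linop (f i)) \<Longrightarrow> linop (\<lambda>w. \<Sum>i\<in>I. f i w)"
  by (rule linopI) (auto simp: linop_add linop_cscale sum.distrib fvec.scale_sum_right)

lemma linop_eqI:
  assumes "linop f" "linop g" "\<And>M r. f (Poly_Mapping.single (M, r) 1) = g (Poly_Mapping.single (M, r) 1)"
  shows "f w = g w"
  by (rule linear_ext_eq[of f g]) (use assms in \<open>auto simp: linear_iff_linop\<close>)

text \<open>The weight of a monomial, where the oscillator \<open>b(-k-1)\<close> has weight \<open>k + 1\<close>\<close>

definition wt :: "'a osc multiset \<Rightarrow> int" where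
  "wt M = (\<Sum>x\<in>#M. int (snd x) + 1)"

lemma wt_empty [simp]: "wt {#} = 0"
  and wt_add_mset [simp]: "wt (add_mset x M) = int (snd x) + 1 + wt M"
  by (simp_all add: wt_def)

lemma wt_nonneg: "wt M \<ge> 0"
  by (induction M) auto

lemma wt_eq_0: "wt M = 0 \<longleftrightarrow> M = {#}"
proof (cases M)
  case (add x N)
  then show ?thesis using wt_nonneg[of N] by simp
qed simp

lemma wt_remove: "x \<in># M \<Longrightarrow> wt (M - {#x#}) = wt M - int (snd x) - 1"
  by (metis add_diff_cancel_left' diff_diff_eq insert_DiffM wt_add_mset)

text \<open>The vectors all of whose monomials have weight \<open>k\<close>; for negative \<open>k\<close> only 0\<close>

definition wspace :: "int \<Rightarrow> 'a fock set" where
  "wspace k = {w. \<forall>M r. Poly_Mapping.lookup w (M, r) \<noteq> 0 \<longrightarrow> wt M = k}"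

lemma wspace_0: "0 \<in> wspace k"
  and wspace_add: "v \<in> wspace k \<Longrightarrow> w \<in> wspace k \<Longrightarrow> v + w \<in> wspace k"
  and wspace_minus: "w \<in> wspace k \<Longrightarrow> - w \<in> wspace k"
  and wspace_cscale: "w \<in> wspace k \<Longrightarrow> cscale c w \<in> wspace k"
  and wspace_single: "Poly_Mapping.single (M, r) c \<in> wspace (wt M)"
  by (auto simp: wspace_def lookup_add lookup_single when_def split: if_splits)
     (metis add.right_neutral)+

lemma wspace_diff: "v \<in> wspace k \<Longrightarrow> w \<in> wspace k \<Longrightarrow> v - w \<in> wspace k"
  using wspace_add[of v k "- w"] wspace_minus[of w k] by simp

lemma wspace_sum: "(\<And>i. i \<in> I \<Longrightarrow> f i \<in> wspace k) \<Longrightarrow> (\<Sum>i\<in>I. f i) \<in> wspace k"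
  by (induction I rule: infinite_finite_induct) (auto simp: wspace_0 wspace_add)

lemma wspace_Sum_any: "(\<And>i. f i \<in> wspace k) \<Longrightarrow> Sum_any f \<in> wspace k"
  unfolding Sum_any.expand_set by (rule wspace_sum)

lemma wspace_neg: "w \<in> wspace k \<Longrightarrow> k < 0 \<Longrightarrow> w = 0"
proof (rule poly_mapping_eqI)
  fix x assume "w \<in> wspace k" "k < 0"
  then show "Poly_Mapping.lookup w x = Poly_Mapping.lookup 0 x"
    using wt_nonneg[of "fst x"] by (cases x) (auto simp: wspace_def)
qed

lemma exp_vec_wspace: "exp_vec r \<in> wspace 0"
  unfolding exp_vec_def using wspace_single[of "{#}"] by simp

text \<open>Degree \<open>d\<close> is the degree in \<open>t\<^sub>0\<close>: such an operator lowers the weight by \<open>d\<close>.\<close>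

definition homog :: "int \<Rightarrow> ('a fock \<Rightarrow> 'a fock) \<Rightarrow> bool" where
  "homog d f \<longleftrightarrow> (\<forall>k. \<forall>w\<in>wspace k. f w \<in> wspace (k - d))"

lemma homogD: "homog d f \<Longrightarrow> w \<in> wspace k \<Longrightarrow> f w \<in> wspace (k - d)"
  by (simp add: homog_def)

lemma homog_zero: "homog d (\<lambda>w. 0)"
  and homog_plus: "homog d f \<Longrightarrow> homog d g \<Longrightarrow> homog d (\<lambda>w. f w + g w)"
  and homog_minus2: "homog d f \<Longrightarrow> homog d g \<Longrightarrow> homog d (\<lambda>w. f w - g w)"
  and homog_scale: "homog d f \<Longrightarrow> homog d (\<lambda>w. cscale c (f w))"
  by (auto simp: homog_def wspace_0 wspace_add wspace_minus wspace_cscale wspace_diff)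

lemma homog_sum: "(\<And>i. i \<in> I \<Longrightarrow> homog d (f i)) \<Longrightarrow> homog d (\<lambda>w. \<Sum>i\<in>I. f i w)"
  by (auto simp: homog_def intro!: wspace_sum)

lemma homog_comp: "homog d f \<Longrightarrow> homog e g \<Longrightarrow> d + e = k \<Longrightarrow> homog k (\<lambda>w. f (g w))"
  unfolding homog_def
proof (intro allI ballI)
  fix l and w :: "'a fock"
  assume *: "\<forall>k. \<forall>w\<in>wspace k. f w \<in> wspace (k - d)" "\<forall>k. \<forall>w\<in>wspace k. g w \<in> wspace (k - e)"
    "d + e = k" "w \<in> wspace l"
  then have "f (g w) \<in> wspace (l - e - d)" by blast
  moreover have "l - e - d = l - k" using *(3) by simp
  ultimately show "f (g w) \<in> wspace (l - k)" by simp
qed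

lemma homog_basisI:
  assumes "linop f" "\<And>M r. f (Poly_Mapping.single (M, r) 1) \<in> wspace (wt M - d)"
  shows "homog d f"
  unfolding homog_def
proof (intro allI ballI)
  fix k and w :: "'a fock" assume w: "w \<in> wspace k"
  have "f (Poly_Mapping.single (M, r) (Poly_Mapping.lookup w (M, r))) \<in> wspace (k - d)" for M r
  proof (cases "Poly_Mapping.lookup w (M, r) = 0")
    case True
    then show ?thesis using assms(1) by (simp add: linop_0 wspace_0)
  next
    case False
    then have "wt M = k" using w by (auto simp: wspace_def)
    moreover have "Poly_Mapping.single (M, r) (Poly_Mapping.lookup w (M, r)) = cscale (Poly_Mapping.lookup w (M, r)) (Poly_Mapping.single (M, r) 1)"
      by (simp add: cscale_single)
    ultimately show ?thesis using assms by (auto simp: linop_cscale intro: wspace_cscale)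
  qed
  then have "(\<Sum>k\<in>Poly_Mapping.keys w. f (Poly_Mapping.single k (Poly_Mapping.lookup w k))) \<in> wspace (k - d)"
    by (intro wspace_sum) (metis surj_pair)
  then show "f w \<in> wspace (k - d)"
    by (subst basis_expansion[of w]) (simp add: linop_sum assms(1))
qed

lemma homog_heis: "homog n (heis x n)"
proof (rule homog_basisI[OF linop_heis])
  fix M and r :: "int ^ 'a"
  show "heis x n (Poly_Mapping.single (M, r) 1) \<in> wspace (wt M - n)"
  proof -
    consider "n < 0" | "n = 0" | "n > 0" by linarith
    then show ?thesis
    proof cases
      case 1
      then have "Poly_Mapping.single (add_mset (b, nat (- n - 1)) M, r) c \<in> wspace (wt M - n)" for b and c :: complex
        using wspace_single[of "add_mset (b, nat (- n - 1)) M" r c] by simp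
      then show ?thesis using 1 by (auto simp: heis_neg intro!: wspace_sum)
    next
      case 2
      then show ?thesis by (simp add: heis_0 wspace_single)
    next
      case 3
      have "Poly_Mapping.single (M - {#(b, nat (n - 1))#}, r) (c * of_nat (count M (b, nat (n - 1)))) \<in> wspace (wt M - n)"
        for b and c :: complex
      proof (cases "(b, nat (n - 1)) \<in># M")
        case True
        then have "wt (M - {#(b, nat (n - 1))#}) = wt M - n" using 3 by (simp add: wt_remove)
        then show ?thesis by (metis wspace_single)
      next
        case False
        then show ?thesis by (simp add: not_in_iff wspace_0)
      qed
      then show ?thesis using 3 by (auto simp: heis_pos mult.assoc[symmetric] simp del: mult_1 of_int_mult intro!: wspace_sum)
    qed
  qed
qed

section \<open>Fields and normally ordered products\<close>

text \<open>A field is a family of linear modes of which, on each vector, those of large index vanish.\<close>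

definition is_field :: "'a field \<Rightarrow> bool" where
  "is_field A \<longleftrightarrow> (\<forall>n. linop (A n)) \<and> (\<forall>w. \<exists>k. \<forall>n\<ge>k. A n w = 0)"

text \<open>
  Homogeneous fields: the mode \<open>n\<close> has degree \<open>n + c\<close>, so \<open>1 - c\<close> is the conformal weight of the field.
\<close>

definition hfield :: "int \<Rightarrow> 'a field \<Rightarrow> bool" where
  "hfield c A \<longleftrightarrow> (\<forall>n. linop (A n) \<and> homog (n + c) (A n))"

lemma is_field_linop: "is_field A \<Longrightarrow> linop (A n)"
  by (simp add: is_field_def)

lemma is_field_add: "is_field A \<Longrightarrow> A n (v + w) = A n v + A n w"
  and is_field_cscale: "is_field A \<Longrightarrow> A n (cscale c w) = cscale c (A n w)"
  and is_field_0: "is_field A \<Longrightarrow> A n 0 = 0"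
  by (simp_all add: linop_add linop_cscale linop_0 is_field_linop)

lemma hfield_linop: "hfield c A \<Longrightarrow> linop (A n)"
  and hfield_homog: "hfield c A \<Longrightarrow> homog (n + c) (A n)"
  by (simp_all add: hfield_def)

lemma hfield_exp_vec: "hfield c A \<Longrightarrow> n + c > 0 \<Longrightarrow> A n (exp_vec r) = 0"
  using homogD[OF hfield_homog exp_vec_wspace] by (intro wspace_neg) auto

lemma hfield_is_field:
  assumes "hfield c A"
  shows "is_field A"
  unfolding is_field_def
proof (intro conjI allI)
  fix w :: "'a fock"
  define k where "k = 1 - c + (\<Sum>x\<in>Poly_Mapping.keys w. wt (fst x))"
  have "A n w = 0" if "n \<ge> k" for n
  proof -
    have "A n (Poly_Mapping.single (M, r) c') = 0" if M: "(M, r) \<in> Poly_Mapping.keys w" for M r c'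
    proof -
      have "wt M \<le> (\<Sum>x\<in>Poly_Mapping.keys w. wt (fst x))"
        using member_le_sum[OF M, of "\<lambda>x. wt (fst x)"] by (simp add: wt_nonneg)
      then have "wt M - (n + c) < 0" using \<open>n \<ge> k\<close> by (simp add: k_def)
      then show ?thesis
        using homogD[OF hfield_homog[OF assms] wspace_single[of M r c']] wspace_neg by blast
    qed
    then have "(\<Sum>x\<in>Poly_Mapping.keys w. A n (Poly_Mapping.single x (Poly_Mapping.lookup w x))) = 0"
      by (intro sum.neutral) auto
    then show ?thesis
      by (subst basis_expansion[of w]) (simp add: linop_sum hfield_linop[OF assms])
  qed
  then show "\<exists>k. \<forall>n\<ge>k. A n w = 0" by blast
qed (use assms in \<open>auto simp: hfield_def\<close>)

lemma hfield_heis: "hfield 0 (heis x)"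
  by (simp add: hfield_def linop_heis homog_heis)

lemma is_field_heis: "is_field (heis x)"
  by (rule hfield_is_field[OF hfield_heis])

lemma is_field_zero: "is_field (\<lambda>n w. 0)"
  by (simp add: is_field_def linop_zero)

lemma is_field_delta: "is_field (\<lambda>n w. if n = k then cscale c w else 0)"
proof -
  have "linop (\<lambda>w. if n = k then cscale c w else 0)" for n
    by (cases "n = k") (simp_all add: linop_zero linop_scale linop_ident)
  moreover have "\<forall>n\<ge>k + 1. (if n = k then cscale c w else 0) = 0" for w :: "'a fock" by auto
  ultimately show ?thesis unfolding is_field_def by blast
qed

lemma is_field_shift: 
  assumes "is_field A"
  shows "is_field (\<lambda>n. A (n + k))"
  unfolding is_field_def
proof (intro conjI allI)
  fix w
  obtain l where l: "A n w = 0" if "n \<ge> l" for n using assms unfolding is_field_def by blast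
  have "\<forall>n\<ge>l - k. A (n + k) w = 0" by (auto intro: l)
  then show "\<exists>l. \<forall>n\<ge>l. A (n + k) w = 0" by blast
qed (use assms in \<open>auto simp: is_field_def\<close>)

lemma is_field_scale: "is_field A \<Longrightarrow> is_field (\<lambda>n w. cscale (c n) (A n w))"
  unfolding is_field_def by (fastforce intro: linop_scale)

lemma is_field_plus:
  assumes "is_field A" "is_field B"
  shows "is_field (\<lambda>n w. A n w + B n w)"
  unfolding is_field_def
proof (intro conjI allI)
  fix w
  obtain k l where "\<forall>n\<ge>k. A n w = 0" "\<forall>n\<ge>l. B n w = 0"
    using assms unfolding is_field_def by blast
  then have "\<forall>n\<ge>max k l. A n w + B n w = 0" by simp
  then show "\<exists>l. \<forall>n\<ge>l. A n w + B n w = 0" by blast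
qed (use assms in \<open>auto simp: is_field_def intro: linop_plus\<close>)

lemma is_field_sum: "(\<And>i. i \<in> I \<Longrightarrow> is_field (A i)) \<Longrightarrow> is_field (\<lambda>n w. \<Sum>i\<in>I. A i n w)"
  by (induction I rule: infinite_finite_induct) (auto simp: is_field_zero is_field_plus)

lemma is_field_fderiv: "is_field A \<Longrightarrow> is_field (fderiv A)"
  unfolding fderiv_def using is_field_scale[OF is_field_shift[of A "-1"], of "\<lambda>n. - of_int n"] by simp

lemma hfield_fderiv: "hfield c A \<Longrightarrow> hfield (c - 1) (fderiv A)"
proof -
  assume A: "hfield c A"
  have "homog (n + (c - 1)) (A (n - 1))" for n
    using hfield_homog[OF A, of "n - 1"] by (simp add: algebra_simps)
  then show ?thesis
    using A unfolding fderiv_def hfield_def by (intro allI conjI homog_scale linop_scale) auto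
qed

text \<open>The summands of the normally ordered product\<close>

definition nterm :: "'a field \<Rightarrow> 'a field \<Rightarrow> int \<Rightarrow> 'a fock \<Rightarrow> int \<Rightarrow> 'a fock" where
  "nterm A B m w n = (if n < 0 then A n (B (m - n - 1) w) else B (m - n - 1) (A n w))"

lemma nop_nterm: "nop A B m w = Sum_any (nterm A B m w)"
  by (simp add: nop_def nterm_def[abs_def])

text \<open>
  The threshold \<open>T\<close> between the two orders is 0 in a normally ordered product; it is a parameter because a
  shift of the modes of the left factor moves it.
\<close>

lemma finite_threshold:
  assumes "is_field A" "is_field B"
  shows "finite {n::int. (if n < T then A n (B (m - n - 1) w) else B (m - n - 1) (A n w)) \<noteq> 0}"
proof -
  obtain k l where "\<forall>n\<ge>k. A n w = 0" "\<forall>n\<ge>l. B n w = 0"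
    using assms unfolding is_field_def by blast
  moreover have "A n 0 = 0" "B n 0 = 0" for n
    using assms by (simp_all add: linop_0 is_field_linop)
  ultimately have "(if n < T then A n (B (m - n - 1) w) else B (m - n - 1) (A n w)) = 0"
    if "n \<notin> {min T (m - l) .. max T k}" for n
    using that by (cases "n < T") auto
  then have "{n::int. (if n < T then A n (B (m - n - 1) w) else B (m - n - 1) (A n w)) \<noteq> 0}
      \<subseteq> {min T (m - l) .. max T k}" by blast
  then show ?thesis by (rule finite_subset) simp
qed

lemma finite_nterm: "is_field A \<Longrightarrow> is_field B \<Longrightarrow> finite {n. nterm A B m w n \<noteq> 0}"
  unfolding nterm_def by (rule finite_threshold)

lemma linop_nop:
  assumes "is_field A" "is_field B"
  shows "linop (nop A B m)"
proof (rule linopI)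
  fix v w :: "'a fock" and c
  have "nop A B m (v + w) = Sum_any (\<lambda>n. nterm A B m v n + nterm A B m w n)"
    unfolding nop_nterm by (rule Sum_any.cong) (simp add: nterm_def is_field_add assms)
  then show "nop A B m (v + w) = nop A B m v + nop A B m w"
    by (simp add: nop_nterm Sum_any.distrib finite_nterm assms)
  have "nop A B m (cscale c v) = Sum_any (\<lambda>n. cscale c (nterm A B m v n))"
    unfolding nop_nterm by (rule Sum_any.cong) (simp add: nterm_def is_field_cscale assms)
  then show "nop A B m (cscale c v) = cscale c (nop A B m v)"
    unfolding nop_nterm
    by (simp add: linop_Sum_any[OF linop_scale[OF linop_ident]] finite_nterm assms)
qed

lemma hfield_nop:
  assumes "hfield a A" "hfield b B" "c = a + b - 1"
  shows "hfield c (nop A B)"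
  unfolding hfield_def
proof (intro conjI allI)
  fix n
  show "linop (nop A B n)"
    using assms by (intro linop_nop hfield_is_field)
  show "homog (n + c) (nop A B n)"
    unfolding homog_def
  proof (intro allI ballI)
    fix k and w :: "'a fock" assume w: "w \<in> wspace k"
    have "nterm A B n w l \<in> wspace (k - (n + c))" for l
    proof -
      have "homog (n + c) (\<lambda>w. A l (B (n - l - 1) w))"
        by (rule homog_comp[OF hfield_homog[OF assms(1)] hfield_homog[OF assms(2)]]) (simp add: assms)
      moreover have "homog (n + c) (\<lambda>w. B (n - l - 1) (A l w))"
        by (rule homog_comp[OF hfield_homog[OF assms(2)] hfield_homog[OF assms(1)]]) (simp add: assms)
      ultimately show ?thesis using w by (simp add: nterm_def homog_def)
    qed
    then show "nop A B n w \<in> wspace (k - (n + c))"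
      unfolding nop_nterm by (rule wspace_Sum_any)
  qed
qed

lemma nop_plus_left:
  assumes "is_field A" "is_field A'" "is_field B"
  shows "nop (\<lambda>n w. A n w + A' n w) B m w = nop A B m w + nop A' B m w"
proof -
  have "nop (\<lambda>n w. A n w + A' n w) B m w = Sum_any (\<lambda>n. nterm A B m w n + nterm A' B m w n)"
    unfolding nop_nterm by (rule Sum_any.cong) (simp add: nterm_def is_field_add assms)
  then show ?thesis by (simp add: nop_nterm Sum_any.distrib finite_nterm assms)
qed

lemma nop_plus_right:
  assumes "is_field A" "is_field B" "is_field B'"
  shows "nop A (\<lambda>n w. B n w + B' n w) m w = nop A B m w + nop A B' m w"
proof -
  have "nop A (\<lambda>n w. B n w + B' n w) m w = Sum_any (\<lambda>n. nterm A B m w n + nterm A B' m w n)"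
    unfolding nop_nterm by (rule Sum_any.cong) (simp add: nterm_def is_field_add assms)
  then show ?thesis by (simp add: nop_nterm Sum_any.distrib finite_nterm assms)
qed

lemma nop_scale_left:
  assumes "is_field A" "is_field B"
  shows "nop (\<lambda>n w. cscale c (A n w)) B m w = cscale c (nop A B m w)"
proof -
  have "nop (\<lambda>n w. cscale c (A n w)) B m w = Sum_any (\<lambda>n. cscale c (nterm A B m w n))"
    unfolding nop_nterm by (rule Sum_any.cong) (simp add: nterm_def is_field_cscale assms)
  then show ?thesis
    by (simp add: nop_nterm linop_Sum_any[OF linop_scale[OF linop_ident]] finite_nterm assms)
qed

lemma nop_scale_right:
  assumes "is_field A" "is_field B"
  shows "nop A (\<lambda>n w. cscale c (B n w)) m w = cscale c (nop A B m w)"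
proof -
  have "nop A (\<lambda>n w. cscale c (B n w)) m w = Sum_any (\<lambda>n. cscale c (nterm A B m w n))"
    unfolding nop_nterm by (rule Sum_any.cong) (simp add: nterm_def is_field_cscale assms)
  then show ?thesis
    by (simp add: nop_nterm linop_Sum_any[OF linop_scale[OF linop_ident]] finite_nterm assms)
qed

lemma nop_zero_left: "is_field B \<Longrightarrow> nop (\<lambda>n w. 0) B m w = 0"
  and nop_zero_right: "is_field A \<Longrightarrow> nop A (\<lambda>n w. 0) m w = 0"
  unfolding nop_nterm by (simp_all add: nterm_def[abs_def] linop_0 is_field_linop cong: if_cong)

lemma nop_sum_left:
  assumes "\<And>i. i \<in> I \<Longrightarrow> is_field (A i)" "is_field B"
  shows "nop (\<lambda>n w. \<Sum>i\<in>I. A i n w) B m w = (\<Sum>i\<in>I. nop (A i) B m w)"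
  using assms(1)
proof (induction I rule: infinite_finite_induct)
  case (insert i I)
  then show ?case by (simp add: nop_plus_left is_field_sum assms(2))
qed (simp_all add: nop_zero_left assms)

lemma nop_sum_right:
  assumes "\<And>i. i \<in> I \<Longrightarrow> is_field (B i)" "is_field A"
  shows "nop A (\<lambda>n w. \<Sum>i\<in>I. B i n w) m w = (\<Sum>i\<in>I. nop A (B i) m w)"
  using assms(1)
proof (induction I rule: infinite_finite_induct)
  case (insert i I)
  then show ?case by (simp add: nop_plus_right is_field_sum assms(2))
qed (simp_all add: nop_zero_right assms)

lemma nop_delta_left:
  assumes "is_field B"
  shows "nop (\<lambda>n w. if n = k then cscale c w else 0) B m w = cscale c (B (m - k - 1) w)"
proof -
  have "nop (\<lambda>n w. if n = k then cscale c w else 0) B m w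
      = Sum_any (\<lambda>n. if n = k then cscale c (B (m - k - 1) w) else 0)"
    unfolding nop_nterm
    by (rule Sum_any.cong) (auto simp: nterm_def is_field_0[OF assms] is_field_cscale[OF assms])
  then show ?thesis by simp
qed

lemma nop_shift_right: "nop A (\<lambda>n. B (n + k)) m = nop A B (m + k)"
proof -
  have "m - n - 1 + k = m + k - n - 1" for n by simp
  then show ?thesis by (simp only: nop_def)
qed

text \<open>
  Shifting the modes of the left factor moves the threshold of the normal ordering, which costs one
  commutator for each mode passed.
\<close>

lemma nop_shift_left:
  assumes "is_field A" "is_field B"
    and comm: "\<And>n l w. A n (B l w) = B l (A n w) + cscale c (C (n + l) w)"
  shows "nop (\<lambda>n. A (n + k)) B m w = nop A B (m + k) w + cscale (of_int k * c) (C (m + k - 1) w)"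
proof -
  define t where "t T n = (if n < T then A n (B (m + k - n - 1) w) else B (m + k - n - 1) (A n w))" for T n
  have fin: "finite {n. t T n \<noteq> 0}" for T
    unfolding t_def using assms(1,2) by (rule finite_threshold)
  have step: "Sum_any (t (T + 1)) = Sum_any (t T) + cscale c (C (m + k - 1) w)" for T
  proof -
    have "Sum_any (t (T + 1)) = Sum_any (\<lambda>n. t T n + (if n = T then cscale c (C (m + k - 1) w) else 0))"
      by (rule Sum_any.cong) (auto simp: t_def comm add_diff_eq)
    also have "\<dots> = Sum_any (t T) + Sum_any (\<lambda>n. if n = T then cscale c (C (m + k - 1) w) else 0)"
      by (rule Sum_any.distrib[OF fin]) (rule finite_subset[of _ "{T}"], auto)
    finally show ?thesis by simp
  qed
  have "Sum_any (t T) = Sum_any (t 0) + cscale (of_int T * c) (C (m + k - 1) w)" for T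
  proof (induction T rule: int_induct[of _ 0])
    case (step1 i)
    then show ?case
      unfolding step by (simp add: ring_distribs fvec.scale_left_distrib add.assoc)
  next
    case (step2 i)
    have "Sum_any (t (i - 1)) = Sum_any (t i) - cscale c (C (m + k - 1) w)"
      using step[of "i - 1"] by (simp add: algebra_simps)
    then show ?case
      using step2 by (simp add: ring_distribs fvec.scale_left_diff_distrib)
  qed simp
  from this[of k] have "Sum_any (t k) = Sum_any (t 0) + cscale (of_int k * c) (C (m + k - 1) w)" .
  moreover have "nop (\<lambda>n. A (n + k)) B m w = Sum_any (t k)"
    unfolding nop_nterm
    by (rule Sum_any.reindex_cong[of "\<lambda>n. n - k"])
       (auto simp: t_def nterm_def fun_eq_iff algebra_simps intro!: bij_betw_byWitness[of _ "\<lambda>n. n + k"])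
  moreover have "nop A B (m + k) w = Sum_any (t 0)"
    by (simp add: nop_def t_def)
  ultimately show ?thesis by simp
qed

lemma nop_shift_left_commuting:
  assumes "is_field A" "is_field B" "\<And>n l w. A n (B l w) = B l (A n w)"
  shows "nop (\<lambda>n. A (n + k)) B m w = nop A B (m + k) w"
  using nop_shift_left[of A B 0 "\<lambda>_ _. 0" k m w] assms by simp

text \<open>An operator acts on a normally ordered product by the Leibniz rule.\<close>

lemma nop_commutator:
  assumes "is_field A" "is_field B" "is_field A'" "is_field B'" "linop h"
    and A: "\<And>n w. h (A n w) = A n (h w) + A' n w" and B: "\<And>n w. h (B n w) = B n (h w) + B' n w"
  shows "h (nop A B m w) = nop A B m (h w) + nop A' B m w + nop A B' m w"
proof -
  have "h (nop A B m w) = Sum_any (\<lambda>n. nterm A B m (h w) n + (nterm A' B m w n + nterm A B' m w n))"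
    unfolding nop_nterm linop_Sum_any[OF assms(5) finite_nterm[OF assms(1,2)]]
    by (rule Sum_any.cong) (auto simp: nterm_def A B is_field_add[OF assms(1)] is_field_add[OF assms(2)] add_ac)
  also have "\<dots> = nop A B m (h w) + (nop A' B m w + nop A B' m w)"
    unfolding nop_nterm
  proof (subst Sum_any.distrib)
    show "finite {a. nterm A' B m w a + nterm A B' m w a \<noteq> 0}"
      by (rule finite_subset[of _ "{a. nterm A' B m w a \<noteq> 0} \<union> {a. nterm A B' m w a \<noteq> 0}"])
        (auto simp: finite_nterm assms)
  qed (simp_all add: Sum_any.distrib finite_nterm assms)
  finally show ?thesis by (simp add: add_ac)
qed

lemma nop_commutes:
  assumes "is_field A" "is_field B" "linop h"
    and "\<And>n w. h (A n w) = A n (h w)" and "\<And>n w. h (B n w) = B n (h w)"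
  shows "h (nop A B m w) = nop A B m (h w)"
  using nop_commutator[of A B "\<lambda>_ _. 0" "\<lambda>_ _. 0" h m w] assms
  by (simp add: is_field_zero nop_zero_left nop_zero_right)

lemma fprod_nop_commuting:
  assumes "\<And>n l w. A n (B l w) = B l (A n w)"
  shows "fprod A B = nop A B"
  by (simp only: fprod_def nop_def assms if_cancel)

text \<open>Only finitely many explicit terms of a normally ordered product survive on a vector killed by the nonnegative modes of the left factor.\<close>

lemma nop_creation:
  assumes "\<And>n. linop (A n)" "\<And>n. linop (B n)" "\<And>n. n \<ge> 0 \<Longrightarrow> A n w = 0" "\<And>n. n \<ge> m + int K \<Longrightarrow> B n w = 0"
  shows "nop A B m w = (\<Sum>k=1..K. A (- int k) (B (m + int k - 1) w))"
proof -
  have "nop A B m w = (\<Sum>n\<in>{- int K..-1}. nterm A B m w n)"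
    unfolding nop_nterm
  proof (rule Sum_any.expand_superset)
    show "{a. nterm A B m w a \<noteq> 0} \<subseteq> {- int K..-1}"
    proof
      fix n assume n: "n \<in> {a. nterm A B m w a \<noteq> 0}"
      have z: "A n 0 = 0" "B (m - n - 1) 0 = 0" using assms(1,2) by (simp_all add: linop_0)
      have "n < 0"
      proof (rule ccontr)
        assume "\<not> n < 0"
        then show False using n z assms(3)[of n] by (simp add: nterm_def)
      qed
      moreover have "\<not> m - n - 1 \<ge> m + int K"
        using n z assms(4)[of "m - n - 1"] \<open>n < 0\<close> by (auto simp: nterm_def)
      ultimately show "n \<in> {- int K..-1}" by auto
    qed
  qed simp
  also have "\<dots> = (\<Sum>k=1..K. A (- int k) (B (m + int k - 1) w))"
    by (rule sum.reindex_bij_witness[of _ "\<lambda>k. - int k" "\<lambda>n. nat (- n)"]) (auto simp: nterm_def)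
  finally show ?thesis .
qed

lemma nop_exp_vec_zero:
  assumes "\<And>n. linop (A n)" "\<And>n. linop (B n)"
    "\<And>n. n \<ge> 0 \<Longrightarrow> A n w = 0" "\<And>n. n \<ge> 0 \<Longrightarrow> B n w = 0" "m \<ge> 0"
  shows "nop A B m w = 0"
  using nop_creation[of A B w m 0] assms by simp

section \<open>A uniqueness principle for families of operators\<close>

lemma is_field_shift_scale: "is_field A \<Longrightarrow> is_field (\<lambda>n w. cscale c (A (n + k) w))"
  using is_field_scale[OF is_field_shift[of A k], of "\<lambda>_. c"] by simp

lemma heis_axis_neg:
  "heis (axis b 1) (- int k - 1) (Poly_Mapping.single (M, r) c) = Poly_Mapping.single (add_mset (b, k) M, r) c"
proof -
  have "heis (axis b 1) (- int k - 1) (Poly_Mapping.single (M, r) c) =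
      (\<Sum>b'\<in>UNIV. if b' = b then Poly_Mapping.single (add_mset (b, k) M, r) c else 0)"
    by (subst heis_neg, simp, rule sum.cong) (auto simp: axis_def)
  then show ?thesis by simp
qed

text \<open>The oscillators belong to the basis vectors \<open>u\<^sub>p\<close> and \<open>v\<^sub>p\<close>.\<close>

lemma axis_cases: "(\<And>p. b = Inl p \<Longrightarrow> P (hyp_u p)) \<Longrightarrow> (\<And>p. b = Inr p \<Longrightarrow> P (hyp_v p)) \<Longrightarrow> P (axis b 1)"
  by (cases b) (auto simp: hyp_u_def hyp_v_def)

lemma linop_single:
  "(\<And>v w. g (v + w) = g v + g w) \<Longrightarrow> (\<And>c v. g (cscale c v) = c * g v) \<Longrightarrow> linop (\<lambda>w. Poly_Mapping.single k (g w))"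
  by (simp add: linop_def single_add cscale_single)

lemma lookup_heis_neg:
  fixes w :: "'a::finite fock"
  assumes n: "n < 0"
  shows "Poly_Mapping.lookup (heis x n w) ({#}, q) = 0"
proof -
  have "(Poly_Mapping.single ({#}, q) (Poly_Mapping.lookup (heis x n w) ({#}, q)) :: 'a fock) = 0"
  proof (rule linop_eqI[where f = "\<lambda>w. Poly_Mapping.single ({#}, q) (Poly_Mapping.lookup (heis x n w) ({#}, q))"
        and g = "\<lambda>w. 0"])
    show "linop (\<lambda>w. Poly_Mapping.single ({#}, q) (Poly_Mapping.lookup (heis x n w) ({#}, q)) :: 'a fock)"
      by (rule linop_single) (simp_all add: heis_add heis_cscale lookup_add)
  qed (simp_all add: linop_zero heis_neg n lookup_sum lookup_single)
  then have "Poly_Mapping.lookup (Poly_Mapping.single ({#}, q) (Poly_Mapping.lookup (heis x n w) ({#}, q)) :: 'a fock) ({#}, q) = 0"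
    by simp
  then show ?thesis by simp
qed

text \<open>The annihilation operators are derivations of the polynomial algebra in the oscillators.\<close>

lemma lookup_heis_pos:
  fixes w :: "'a::finite fock"
  assumes n: "n > 0"
  shows "Poly_Mapping.lookup (heis x n w) (M, r) = (\<Sum>b\<in>UNIV. of_int (n * hyp_form x (axis b 1))
     * of_nat (count M (b, nat (n - 1)) + 1) * Poly_Mapping.lookup w (add_mset (b, nat (n - 1)) M, r))"
    (is "_ = ?R w")
proof -
  have "Poly_Mapping.single (M, r) (Poly_Mapping.lookup (heis x n w) (M, r)) = Poly_Mapping.single (M, r) (?R w)"
  proof (rule linop_eqI[where f = "\<lambda>w. Poly_Mapping.single (M, r) (Poly_Mapping.lookup (heis x n w) (M, r))"
        and g = "\<lambda>w. Poly_Mapping.single (M, r) (?R w)"])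
    show "linop (\<lambda>w. Poly_Mapping.single (M, r) (Poly_Mapping.lookup (heis x n w) (M, r)))"
      by (rule linop_single) (simp_all add: heis_add heis_cscale lookup_add)
    show "linop (\<lambda>w. Poly_Mapping.single (M, r) (?R w))"
    proof (rule linop_single)
      show "?R (v + v') = ?R v + ?R v'" for v v'
        by (simp only: lookup_add distrib_left sum.distrib)
      show "?R (cscale c v) = c * ?R v" for c v
        unfolding lookup_cscale sum_distrib_left by (rule sum.cong[OF refl]) (simp only: mult_ac)
    qed
    fix N s
    have "Poly_Mapping.lookup (heis x n (Poly_Mapping.single (N, s) 1)) (M, r) = ?R (Poly_Mapping.single (N, s) 1)"
      unfolding heis_pos[OF n] lookup_sum
    proof (rule sum.cong[OF refl])
      fix b :: "'a + 'a"
      let ?o = "(b, nat (n - 1))"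
      show "Poly_Mapping.lookup (Poly_Mapping.single (N - {#?o#}, s)
            (1 * (of_int (n * hyp_form x (axis b 1)) * of_nat (count N ?o)))) (M, r)
          = of_int (n * hyp_form x (axis b 1)) * of_nat (count M ?o + 1) *
            Poly_Mapping.lookup (Poly_Mapping.single (N, s) (1 :: complex)) (add_mset ?o M, r)"
      proof (cases "?o \<in># N")
        case True
        then obtain N' where "N = add_mset ?o N'" by (metis insert_DiffM)
        then show ?thesis by (auto simp: lookup_single when_def)
      next
        case False
        then have "count N ?o = 0" "N \<noteq> add_mset ?o M" by (auto simp: not_in_iff)
        then show ?thesis by (simp add: lookup_single when_def)
      qed
    qed
    then show "Poly_Mapping.single (M, r) (Poly_Mapping.lookup (heis x n (Poly_Mapping.single (N, s) 1)) (M, r))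
        = Poly_Mapping.single (M, r) (?R (Poly_Mapping.single (N, s) 1))" by simp
  qed
  from arg_cong[OF this, of "\<lambda>v. Poly_Mapping.lookup v (M, r)"] show ?thesis
    unfolding lookup_single_eq .
qed

lemma hyp_form_u_axis: "hyp_form (hyp_u p) (axis b 1) = (if b = Inr p then 1 else 0)"
  and hyp_form_v_axis: "hyp_form (hyp_v p) (axis b 1) = (if b = Inl p then 1 else 0)"
  by (cases b; simp add: hyp_form_axis, simp add: hyp_u_def hyp_v_def axis_def)+

text \<open>A vector killed by all annihilation operators is a combination of the vectors \<open>e\<^sup>r\<^sup>u\<close>.\<close>

lemma singular_vector:
  fixes w :: "'a::finite fock"
  assumes u: "\<And>p n. n > 0 \<Longrightarrow> heis (hyp_u p) n w = 0" and v: "\<And>p n. n > 0 \<Longrightarrow> heis (hyp_v p) n w = 0"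
    and M: "Poly_Mapping.lookup w (M, r) \<noteq> 0"
  shows "M = {#}"
proof (rule ccontr)
  assume "M \<noteq> {#}"
  then obtain b k N where N: "M = add_mset (b, k) N" by (metis multiset_cases surj_pair)
  obtain x where x: "\<And>n. n > 0 \<Longrightarrow> heis x n w = 0" and xb: "\<And>b'. hyp_form x (axis b' 1) = (if b' = b then 1 else 0)"
  proof (cases b)
    case (Inl p)
    show thesis
      by (rule that[of "hyp_v p"]) (simp_all add: v hyp_form_v_axis Inl)
  next
    case (Inr p)
    show thesis
      by (rule that[of "hyp_u p"]) (simp_all add: u hyp_form_u_axis Inr)
  qed
  define c where "c = (of_nat k + 1 :: complex) * (of_nat (count N (b, k)) + 1)"
  \<comment> \<open>\<open>x(k + 1)\<close> is a multiple of the derivative with respect to the oscillator \<open>(b, k)\<close>\<close>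
  have "c = complex_of_nat ((k + 1) * (count N (b, k) + 1))"
    by (simp add: c_def algebra_simps)
  then have "c \<noteq> 0" by (metis of_nat_eq_0_iff mult_is_0 add_is_0 zero_neq_one)
  have "0 = Poly_Mapping.lookup (heis x (int k + 1) w) (N, r)"
    by (simp add: x)
  also have "\<dots> = (\<Sum>b'\<in>UNIV. if b' = b then c * Poly_Mapping.lookup w (add_mset (b, k) N, r) else 0)"
  proof (subst lookup_heis_pos, simp, rule sum.cong[OF refl])
    fix b'
    show "of_int ((int k + 1) * hyp_form x (axis b' 1)) * of_nat (count N (b', nat (int k + 1 - 1)) + 1) *
        Poly_Mapping.lookup w (add_mset (b', nat (int k + 1 - 1)) N, r)
      = (if b' = b then c * Poly_Mapping.lookup w (add_mset (b, k) N, r) else 0)"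
      by (cases "b' = b") (simp_all add: xb c_def algebra_simps)
  qed
  finally show False using M \<open>c \<noteq> 0\<close> by (simp add: N)
qed

text \<open>
  The principle by which all identities between operators below are verified.  The commutators with the
  annihilation operators reduce the vanishing of \<open>X e\<^sup>r\<^sup>u\<close> to that of its component of weight 0,
  and the commutators with the creation operators carry it to the whole space.
\<close>

theorem operators_vanish:
  fixes \<X> :: "int \<Rightarrow> ('a::finite fock \<Rightarrow> 'a fock) set"
  assumes lin: "\<And>d X. X \<in> \<X> d \<Longrightarrow> linop X"
    and hom: "\<And>d X. X \<in> \<X> d \<Longrightarrow> homog d X"
    and u: "\<And>d X p n w. X \<in> \<X> d \<Longrightarrow> heis (hyp_u p) n (X w) = X (heis (hyp_u p) n w)"
    and v: "\<And>d X p n. X \<in> \<X> d \<Longrightarrow> \<exists>Y\<in>\<X> (d + n). \<exists>Z\<in>\<X> (d + n). \<forall>w.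
              heis (hyp_v p) n (X w) = X (heis (hyp_v p) n w) + (Y w + Z w)"
    and base: "\<And>X q q'. X \<in> \<X> 0 \<Longrightarrow> Poly_Mapping.lookup (X (exp_vec q)) ({#}, q') = 0"
    and X: "X \<in> \<X> d"
  shows "X w = 0"
proof -
  have exp: "X (exp_vec q) = 0" if "X \<in> \<X> d" for X d q
    using that
  proof (induction "nat (1 - d)" arbitrary: X d rule: less_induct)
    case less
    have ws: "X (exp_vec q) \<in> wspace (- d)"
      using homogD[OF hom[OF less.prems] exp_vec_wspace] by simp
    show ?case
    proof (cases "d > 0")
      case True
      then show ?thesis using wspace_neg[OF ws] by simp
    next
      case False
      have *: "M = {#}" if "Poly_Mapping.lookup (X (exp_vec q)) (M, r) \<noteq> 0" for M r
      proof (rule singular_vector[OF _ _ that])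
        fix p and n :: int assume n: "n > 0"
        show "heis (hyp_u p) n (X (exp_vec q)) = 0"
          by (simp add: u[OF less.prems] heis_exp_vec n linop_0[OF lin[OF less.prems]])
        obtain Y Z where YZ: "Y \<in> \<X> (d + n)" "Z \<in> \<X> (d + n)"
          "heis (hyp_v p) n (X (exp_vec q)) = X (heis (hyp_v p) n (exp_vec q)) + (Y (exp_vec q) + Z (exp_vec q))"
          using v[OF less.prems] by metis
        have "nat (1 - (d + n)) < nat (1 - d)" using n False by simp
        then have "Y (exp_vec q) = 0" "Z (exp_vec q) = 0" using less.hyps YZ by blast+
        then show "heis (hyp_v p) n (X (exp_vec q)) = 0"
          by (simp add: YZ heis_exp_vec n linop_0[OF lin[OF less.prems]])
      qed
      have "Poly_Mapping.lookup (X (exp_vec q)) (M, r) = 0" for M r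
      proof (rule ccontr)
        assume nz: "Poly_Mapping.lookup (X (exp_vec q)) (M, r) \<noteq> 0"
        then have "M = {#}" by (rule *)
        moreover have "wt M = - d" using ws nz by (auto simp: wspace_def)
        ultimately show False using base[of X q r] less.prems nz by simp
      qed
      then show ?thesis by (intro poly_mapping_eqI) (metis surj_pair lookup_zero)
    qed
  qed
  have "X (Poly_Mapping.single (M, r) 1) = 0" if "X \<in> \<X> d" for X d M r
    using that
  proof (induction M arbitrary: X d)
    case empty
    then show ?case using exp by (simp add: exp_vec_def)
  next
    case (add x M)
    obtain b k where x: "x = (b, k)" by fastforce
    let ?w = "Poly_Mapping.single (M, r) (1 :: complex)" and ?n = "- int k - 1"
    have "X (heis (axis b 1) ?n ?w) = 0"
    proof (rule axis_cases)
      fix p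
      show "X (heis (hyp_u p) ?n ?w) = 0"
        using u[OF add.prems, of p ?n ?w] add.IH[OF add.prems] by simp
      obtain Y Z where Y: "Y \<in> \<X> (d + ?n)" and Z: "Z \<in> \<X> (d + ?n)"
        and "heis (hyp_v p) ?n (X ?w) = X (heis (hyp_v p) ?n ?w) + (Y ?w + Z ?w)"
        using v[OF add.prems] by metis
      then show "X (heis (hyp_v p) ?n ?w) = 0"
        using add.IH[OF add.prems] add.IH[OF Y] add.IH[OF Z] by simp
    qed
    then show ?case by (simp add: heis_axis_neg x)
  qed
  then show ?thesis
    using linop_eqI[of X "\<lambda>_. 0"] X lin linop_zero by blast
qed

text \<open>Two fields of charge \<open>s\<close> with the same commutators with \<open>u\<^sub>p(z)\<close> and \<open>v\<^sub>p(z)\<close> agree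
  if their modes of degree 0 agree on all \<open>e\<^sup>q\<^sup>u\<close>.\<close>

lemma field_eqI:
  fixes A B :: "'a::finite field" and s :: "int ^ 'a"
  assumes A: "hfield c A" and B: "hfield c B"
    and Au: "\<And>p n m w. heis (hyp_u p) n (A m w) = A m (heis (hyp_u p) n w) + C p n m w"
    and Bu: "\<And>p n m w. heis (hyp_u p) n (B m w) = B m (heis (hyp_u p) n w) + C p n m w"
    and Av: "\<And>p n m w. heis (hyp_v p) n (A m w)
       = A m (heis (hyp_v p) n w) + cscale (of_int (s $ p)) (A (m + n) w) + D p n m w"
    and Bv: "\<And>p n m w. heis (hyp_v p) n (B m w)
       = B m (heis (hyp_v p) n w) + cscale (of_int (s $ p)) (B (m + n) w) + D p n m w"
    and base: "\<And>q. A (- c) (exp_vec q) = B (- c) (exp_vec q)"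
  shows "A m w = B m w"
proof -
  define Y where "Y m w = A m w - B m w" for m w
  define \<X> where "\<X> d = {X. \<exists>a. X = (\<lambda>w. cscale a (Y (d - c) w))}" for d
  have Ylin: "linop (Y m)" for m
    unfolding Y_def by (intro linop_minus2 hfield_linop[OF A] hfield_linop[OF B])
  have Yhom: "homog (m + c) (Y m)" for m
    unfolding Y_def by (intro homog_minus2 hfield_homog[OF A] hfield_homog[OF B])
  have Yu: "heis (hyp_u p) n (Y m w) = Y m (heis (hyp_u p) n w)" for p n m w
    by (simp add: Y_def Au Bu linop_diff[OF linop_heis])
  have Yv: "heis (hyp_v p) n (Y m w) = Y m (heis (hyp_v p) n w) + cscale (of_int (s $ p)) (Y (m + n) w)" for p n m w
    by (simp add: Y_def Av Bv linop_diff[OF linop_heis] fvec.scale_right_diff_distrib)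
  have "cscale 1 (Y m w) = 0"
  proof (rule operators_vanish[where \<X> = \<X> and X = "\<lambda>w. cscale 1 (Y m w)" and d = "m + c"])
    show "(\<lambda>w. cscale 1 (Y m w)) \<in> \<X> (m + c)" unfolding \<X>_def by (intro CollectI exI[of _ 1]) simp
  next
    fix d X assume X: "X \<in> \<X> d"
    then obtain a where a: "X = (\<lambda>w. cscale a (Y (d - c) w))" by (auto simp: \<X>_def)
    show "linop X" unfolding a by (intro linop_scale Ylin)
    show "homog d X" unfolding a using Yhom[of "d - c"] by (intro homog_scale) simp
    show "heis (hyp_u p) n (X w) = X (heis (hyp_u p) n w)" for p n w
      by (simp add: a heis_cscale Yu)
    fix p n
    have *: "heis (hyp_v p) n (X w) = X (heis (hyp_v p) n w)
        + (cscale (a * of_int (s $ p)) (Y (d + n - c) w) + cscale 0 (Y (d + n - c) w))" for w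
      by (simp add: a heis_cscale Yv fvec.scale_right_distrib algebra_simps)
    have m: "(\<lambda>w. cscale b (Y (d + n - c) w)) \<in> \<X> (d + n)" for b
      unfolding \<X>_def by blast
    show "\<exists>Y\<in>\<X> (d + n). \<exists>Z\<in>\<X> (d + n). \<forall>w. heis (hyp_v p) n (X w) = X (heis (hyp_v p) n w) + (Y w + Z w)"
      by (rule bexI[where x = "\<lambda>w. cscale (a * of_int (s $ p)) (Y (d + n - c) w)"],
          rule bexI[where x = "\<lambda>w. cscale 0 (Y (d + n - c) w)"], rule allI, rule *) (rule m)+
  next
    fix X q q' assume "X \<in> \<X> 0"
    then show "Poly_Mapping.lookup (X (exp_vec q)) ({#}, q') = 0"
      by (auto simp: \<X>_def Y_def base)
  qed
  then show ?thesis by (simp add: Y_def)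
qed

section \<open>The exponential fields\<close>

text \<open>The sum of \<open>A j\<^sub>1 \<circ> \<dots> \<circ> A j\<^sub>l\<close> over the compositions of \<open>k\<close> into \<open>l\<close> positive parts\<close>

primrec comp_sum :: "(nat \<Rightarrow> 'a fock \<Rightarrow> 'a fock) \<Rightarrow> nat \<Rightarrow> nat \<Rightarrow> 'a fock \<Rightarrow> 'a fock" where
  "comp_sum A 0 k w = (if k = 0 then w else 0)"
| "comp_sum A (Suc l) k w = (\<Sum>j=1..k. A j (comp_sum A l (k - j) w))"

lemma finite_compositions: "finite {js :: nat list. 0 \<notin> set js \<and> sum_list js = k}"
proof -
  have "length js \<le> sum_list js" if "0 \<notin> set js" for js :: "nat list"
    using that by (induction js) auto
  then have "{js :: nat list. 0 \<notin> set js \<and> sum_list js = k} \<subseteq> {js. set js \<subseteq> {..k} \<and> length js \<le> k}"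
    using member_le_sum_list by fastforce
  then show ?thesis by (rule finite_subset) (simp add: finite_lists_length_le)
qed

lemma comp_sum_lists:
  assumes "\<And>j. linop (A j)"
  shows "comp_sum A l k w = (\<Sum>js | 0 \<notin> set js \<and> sum_list js = k \<and> length js = l. foldr A js w)"
proof (induction l arbitrary: k)
  case 0
  have "{js :: nat list. 0 \<notin> set js \<and> sum_list js = k \<and> length js = 0} = (if k = 0 then {[]} else {})"
    by auto
  then show ?case by simp
next
  case (Suc l)
  let ?S = "\<lambda>l k. {js :: nat list. 0 \<notin> set js \<and> sum_list js = k \<and> length js = l}"
  have fin: "finite (?S l k)" for l k
    by (rule finite_subset[OF _ finite_compositions[of k]]) auto
  have "comp_sum A (Suc l) k w = (\<Sum>j=1..k. \<Sum>js\<in>?S l (k - j). A j (foldr A js w))"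
    by (simp add: Suc linop_sum[OF assms])
  also have "\<dots> = (\<Sum>(j, js)\<in>Sigma {1..k} (\<lambda>j. ?S l (k - j)). A j (foldr A js w))"
    by (rule sum.Sigma) (auto intro: fin)
  also have "\<dots> = (\<Sum>js\<in>?S (Suc l) k. foldr A js w)"
    by (rule sum.reindex_bij_witness[of _ "\<lambda>js. (hd js, tl js)" "\<lambda>(j, js). j # js"])
      (auto simp: length_Suc_conv)
  finally show ?case .
qed

lemma exp_coeff_comp_sum:
  assumes "\<And>j. linop (A j)" "k \<le> L"
  shows "exp_coeff A k w = (\<Sum>l\<le>L. cscale (1 / fact l) (comp_sum A l k w))"
proof -
  have le: "length js \<le> sum_list js" if "0 \<notin> set js" for js :: "nat list"
    using that by (induction js) auto
  let ?S = "{js :: nat list. 0 \<notin> set js \<and> sum_list js = k}"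
  have "exp_coeff A k w = (\<Sum>l\<in>{..L}. \<Sum>js\<in>{js\<in>?S. length js = l}. cscale (1 / fact (length js)) (foldr A js w))"
    unfolding exp_coeff_def
    by (rule sum.group[symmetric]) (use le \<open>k \<le> L\<close> finite_compositions in \<open>fastforce+\<close>)
  also have "\<dots> = (\<Sum>l\<le>L. cscale (1 / fact l) (comp_sum A l k w))"
    unfolding comp_sum_lists[of A, OF assms(1)] fvec.scale_sum_right
    by (intro sum.cong) auto
  finally show ?thesis .
qed

lemma linop_comp_sum: "(\<And>j. linop (A j)) \<Longrightarrow> linop (comp_sum A l k)"
proof (induction l arbitrary: k)
  case (Suc l)
  have "linop (\<lambda>w. \<Sum>j=1..k. A j (comp_sum A l (k - j) w))"
    by (rule linop_sum_op) (rule linop_comp[OF Suc.prems Suc.IH[OF Suc.prems]])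
  moreover have "comp_sum A (Suc l) k = (\<lambda>w. \<Sum>j=1..k. A j (comp_sum A l (k - j) w))"
    by (rule ext) simp
  ultimately show ?case by (simp only:)
qed (auto simp: linop_def)

lemma linop_exp_coeff:
  assumes "\<And>j. linop (A j)"
  shows "linop (exp_coeff A k)"
proof -
  have "linop (\<lambda>w. \<Sum>l\<le>k. cscale (1 / fact l) (comp_sum A l k w))"
    by (intro linop_sum_op linop_scale linop_comp_sum assms)
  moreover have "exp_coeff A k = (\<lambda>w. \<Sum>l\<le>k. cscale (1 / fact l) (comp_sum A l k w))"
    by (rule ext) (rule exp_coeff_comp_sum[OF assms order_refl])
  ultimately show ?thesis by (simp only:)
qed

lemma homog_comp_sum: "(\<And>j. homog (d * int j) (A j)) \<Longrightarrow> homog (d * int k) (comp_sum A l k)"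
proof (induction l arbitrary: k)
  case 0
  then show ?case by (auto simp: homog_def wspace_0)
next
  case (Suc l)
  have "homog (d * int k) (\<lambda>w. A j (comp_sum A l (k - j) w))" if "j \<in> {1..k}" for j
    by (rule homog_comp[OF Suc.prems Suc.IH]) (use Suc.prems that in \<open>auto simp: of_nat_diff algebra_simps\<close>)
  then have "homog (d * int k) (\<lambda>w. \<Sum>j=1..k. A j (comp_sum A l (k - j) w))"
    by (rule homog_sum)
  then show ?case by (simp add: homog_def)
qed

lemma homog_exp_coeff:
  assumes "\<And>j. linop (A j)" "\<And>j. homog (d * int j) (A j)"
  shows "homog (d * int k) (exp_coeff A k)"
proof -
  have "homog (d * int k) (\<lambda>w. \<Sum>l\<le>k. cscale (1 / fact l) (comp_sum A l k w))"
    by (intro homog_sum homog_scale homog_comp_sum assms)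
  then show ?thesis by (simp add: exp_coeff_comp_sum[OF assms(1) order_refl] homog_def)
qed

lemma exp_coeff_0: "(\<And>j. linop (A j)) \<Longrightarrow> exp_coeff A 0 w = w"
  by (simp add: exp_coeff_comp_sum[of A 0 0])

lemma comp_sum_derivation:
  assumes A: "\<And>j. linop (A j)" and h: "linop h" and j0: "j0 > 0"
    and comm: "\<And>j w. j > 0 \<Longrightarrow> h (A j w) = A j (h w) + (if j = j0 then cscale c w else 0)"
  shows "h (comp_sum A l k w) = comp_sum A l k (h w)
    + (if j0 \<le> k then cscale (of_nat l * c) (comp_sum A (l - 1) (k - j0) w) else 0)"
proof (induction l arbitrary: k)
  case 0
  then show ?case using linop_0[OF h] by simp
next
  case (Suc l)
  let ?T = "comp_sum A"
  have "h (?T (Suc l) k w) = (\<Sum>j=1..k. A j (?T l (k - j) (h w))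
      + ((if j0 \<le> k - j then cscale (of_nat l * c) (A j (?T (l - 1) (k - j - j0) w)) else 0)
      + (if j = j0 then cscale c (?T l (k - j0) w) else 0)))"
    unfolding comp_sum.simps linop_sum[OF h]
    by (rule sum.cong) (auto simp: comm Suc linop_add[OF A] linop_cscale[OF A] linop_0[OF A] add_ac)
  also have "\<dots> = ?T (Suc l) k (h w)
      + ((\<Sum>j=1..k. if j0 \<le> k - j then cscale (of_nat l * c) (A j (?T (l - 1) (k - j - j0) w)) else 0)
      + (\<Sum>j=1..k. if j = j0 then cscale c (?T l (k - j0) w) else 0))"
    by (simp add: sum.distrib)
  also have "(\<Sum>j=1..k. if j = j0 then cscale c (?T l (k - j0) w) else 0)
      = (if j0 \<le> k then cscale c (?T l (k - j0) w) else 0)"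
    using j0 by simp
  also have "(\<Sum>j=1..k. if j0 \<le> k - j then cscale (of_nat l * c) (A j (?T (l - 1) (k - j - j0) w)) else 0)
      = (if j0 \<le> k then cscale (of_nat l * c) (?T l (k - j0) w) else 0)"
  proof (cases "l = 0 \<or> \<not> j0 \<le> k")
    case False
    then obtain l' where l': "l = Suc l'" by (cases l) auto
    have "(\<Sum>j=1..k. if j0 \<le> k - j then cscale (of_nat l * c) (A j (?T (l - 1) (k - j - j0) w)) else 0)
        = (\<Sum>j=1..k - j0. cscale (of_nat l * c) (A j (?T l' (k - j0 - j) w)))"
      using j0 by (intro sum.mono_neutral_cong_right) (auto simp: l' add.commute)
    then show ?thesis using False by (simp add: l' fvec.scale_sum_right)
  next
    case True
    then show ?thesis by (intro trans[OF sum.neutral]) auto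
  qed
  finally show ?case
    by (auto simp: ring_distribs fvec.scale_left_distrib add_ac)
qed

text \<open>
  If the commutator with \<open>A j\<close> is a scalar for \<open>j = j0\<close> and zero otherwise, then the commutator with the
  exponential is that scalar times \<open>z\<^sup>j\<^sup>0\<close> times the exponential.
\<close>

lemma exp_coeff_derivation:
  assumes A: "\<And>j. linop (A j)" and h: "linop h" and j0: "j0 > 0"
    and comm: "\<And>j w. j > 0 \<Longrightarrow> h (A j w) = A j (h w) + (if j = j0 then cscale c w else 0)"
  shows "h (exp_coeff A k w) = exp_coeff A k (h w) + (if j0 \<le> k then cscale c (exp_coeff A (k - j0) w) else 0)"
proof -
  have "h (exp_coeff A k w) = (\<Sum>l\<le>k. cscale (1 / fact l) (comp_sum A l k (h w))
      + (if j0 \<le> k then cscale (1 / fact l) (cscale (of_nat l * c) (comp_sum A (l - 1) (k - j0) w)) else 0))"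
    unfolding exp_coeff_comp_sum[OF A order_refl] linop_sum[OF h]
    by (rule sum.cong) (auto simp: linop_cscale[OF h] comp_sum_derivation[OF assms] fvec.scale_right_distrib)
  also have "\<dots> = exp_coeff A k (h w)
      + (\<Sum>l\<le>k. if j0 \<le> k then cscale (1 / fact l) (cscale (of_nat l * c) (comp_sum A (l - 1) (k - j0) w)) else 0)"
    unfolding sum.distrib exp_coeff_comp_sum[OF A order_refl] ..
  also have "(\<Sum>l\<le>k. if j0 \<le> k then cscale (1 / fact l) (cscale (of_nat l * c) (comp_sum A (l - 1) (k - j0) w)) else 0)
      = (if j0 \<le> k then cscale c (exp_coeff A (k - j0) w) else 0)"
  proof (cases "j0 \<le> k")
    case True
    then obtain k' where k': "k = Suc k'" using j0 by (cases k) auto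
    have "(\<Sum>l\<le>k. cscale (1 / fact l) (cscale (of_nat l * c) (comp_sum A (l - 1) (k - j0) w)))
        = (\<Sum>l\<le>k'. cscale (1 / fact (Suc l) * (of_nat (Suc l) * c)) (comp_sum A l (k - j0) w))"
      unfolding k' sum.atMost_Suc_shift by simp
    also have "\<dots> = (\<Sum>l\<le>k'. cscale c (cscale (1 / fact l) (comp_sum A l (k - j0) w)))"
    proof (rule sum.cong)
      fix l
      have "1 / fact (Suc l) * (of_nat (Suc l) * c) = c * (1 / fact l)"
        by (simp add: field_simps del: of_nat_Suc)
      then show "cscale (1 / fact (Suc l) * (of_nat (Suc l) * c)) (comp_sum A l (k - j0) w)
          = cscale c (cscale (1 / fact l) (comp_sum A l (k - j0) w))"
        by (simp only: fvec.scale_scale)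
    qed simp
    also have "\<dots> = cscale c (exp_coeff A (k - j0) w)"
      using exp_coeff_comp_sum[of A "k - j0" k' w, OF A] j0 k' by (simp add: fvec.scale_sum_right)
    finally show ?thesis using True by simp
  qed simp
  finally show ?thesis .
qed

lemma exp_coeff_commutes:
  assumes "\<And>j. linop (A j)" "linop h" "\<And>j w. j > 0 \<Longrightarrow> h (A j w) = A j (h w)"
  shows "h (exp_coeff A k w) = exp_coeff A k (h w)"
  using exp_coeff_derivation[of A h 1 0 k w] assms by simp

text \<open>The two exponential factors of \<open>Y(e\<^sup>r\<^sup>u, z)\<close>, as fields whose modes are of degree \<open>n + 1\<close>\<close>

text \<open>
  The exponents of the two exponentials in \<open>Y(e\<^sup>r\<^sup>u, z)\<close>; at the irrelevant index \<open>j = 0\<close> they vanish, since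
  \<open>1 / 0 = 0\<close>.
\<close>

definition creation_part :: "int ^ 'a::finite \<Rightarrow> nat \<Rightarrow> 'a fock \<Rightarrow> 'a fock" where
  "creation_part r j w = cscale (1 / of_nat j) (heis (hyp_ru r) (- int j) w)"

definition annihilation_part :: "int ^ 'a::finite \<Rightarrow> nat \<Rightarrow> 'a fock \<Rightarrow> 'a fock" where
  "annihilation_part r j w = cscale (- 1 / of_nat j) (heis (hyp_ru r) (int j) w)"

definition exp_creation :: "int ^ 'a::finite \<Rightarrow> 'a field" where
  "exp_creation r n = (if n < 0
     then exp_coeff (creation_part r) (nat (- n - 1)) else (\<lambda>w. 0))"

definition exp_annihilation :: "int ^ 'a::finite \<Rightarrow> 'a field" where
  "exp_annihilation r n = (if n \<ge> - 1
     then exp_coeff (annihilation_part r) (nat (n + 1)) else (\<lambda>w. 0))"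

lemma linop_creation_part: "linop (creation_part r j)"
  and linop_annihilation_part: "linop (annihilation_part r j)"
  by (simp_all add: linop_def creation_part_def annihilation_part_def heis_add heis_cscale
      fvec.scale_right_distrib mult.commute)

lemmas linop_parts = linop_creation_part linop_annihilation_part

lemma hfield_exp_creation: "hfield 1 (exp_creation r)"
proof -
  have "homog (- 1 * int j) (creation_part r j)" for j
    using homog_scale[OF homog_heis[of "- int j" "hyp_ru r"], of "1 / of_nat j"]
    by (simp add: creation_part_def[abs_def])
  note h = homog_exp_coeff[of "creation_part r" "- 1", OF linop_creation_part this]
  have "homog (n + 1) (exp_coeff (creation_part r) (nat (- n - 1)))" if "n < 0" for n
    using h[of "nat (- n - 1)"] that by (simp add: add.commute)
  then show ?thesis
    unfolding hfield_def exp_creation_def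
    by (auto intro: linop_exp_coeff linop_parts linop_zero homog_zero)
qed

lemma hfield_exp_annihilation: "hfield 1 (exp_annihilation r)"
proof -
  have "homog (1 * int j) (annihilation_part r j)" for j
    using homog_scale[OF homog_heis[of "int j" "hyp_ru r"], of "- 1 / of_nat j"]
    by (simp add: annihilation_part_def[abs_def])
  note h = homog_exp_coeff[of "annihilation_part r" 1, OF linop_annihilation_part this]
  have "homog (n + 1) (exp_coeff (annihilation_part r) (nat (n + 1)))" if "n \<ge> - 1" for n
    using h[of "nat (n + 1)"] that by (simp add: add.commute)
  then show ?thesis
    unfolding hfield_def exp_annihilation_def
    by (auto intro: linop_exp_coeff linop_parts linop_zero homog_zero)
qed

lemma exp_mult_single: "exp_mult r (Poly_Mapping.single (M, q) c) = Poly_Mapping.single (M, r + q) c"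
  by (simp add: exp_mult_def lin_ext_single cscale_single)

lemma linop_exp_mult: "linop (exp_mult r)"
  by (simp add: linop_def exp_mult_def lin_ext_add lin_ext_cscale)

lemma homog_exp_mult: "homog 0 (exp_mult r)"
  by (rule homog_basisI[OF linop_exp_mult]) (simp add: exp_mult_single wspace_single)

lemma exp_mult_exp_vec: "exp_mult r (exp_vec q) = exp_vec (r + q)"
  by (simp add: exp_vec_def exp_mult_single)

lemma hyp_ru_add: "hyp_ru (r + s) = hyp_ru r + hyp_ru s"
proof (rule vec_eq_iff[THEN iffD2], rule allI)
  show "hyp_ru (r + s) $ i = (hyp_ru r + hyp_ru s) $ i" for i by (cases i) simp_all
qed

lemma hyp_form_v_ru: "hyp_form (hyp_v p) (hyp_ru r) = r $ p"
  by (subst hyp_form_commute) (simp add: hyp_v_def hyp_form_axis)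

lemma hyp_form_add_right: "hyp_form x (y + z) = hyp_form x y + hyp_form x z"
  by (simp add: hyp_form_def algebra_simps sum.distrib)

lemma heis_exp_mult:
  "heis x n (exp_mult r w) = exp_mult r (heis x n w)
     + (if n = 0 then cscale (of_int (hyp_form x (hyp_ru r))) (exp_mult r w) else 0)"
proof (rule linop_eqI[where f = "\<lambda>w. heis x n (exp_mult r w)" and g = "\<lambda>w. exp_mult r (heis x n w)
     + (if n = 0 then cscale (of_int (hyp_form x (hyp_ru r))) (exp_mult r w) else 0)"])
  show "linop (\<lambda>w. heis x n (exp_mult r w))" by (rule linop_comp[OF linop_heis linop_exp_mult])
  have "linop (\<lambda>w. if n = 0 then cscale (of_int (hyp_form x (hyp_ru r))) (exp_mult r w) else 0)"
    by (cases "n = 0") (auto intro: linop_scale linop_exp_mult linop_zero)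
  then show "linop (\<lambda>w. exp_mult r (heis x n w)
     + (if n = 0 then cscale (of_int (hyp_form x (hyp_ru r))) (exp_mult r w) else 0))"
    by (rule linop_plus[OF linop_comp[OF linop_exp_mult linop_heis]])
  fix M q
  consider "n < 0" | "n = 0" | "n > 0" by linarith
  then show "heis x n (exp_mult r (Poly_Mapping.single (M, q) 1)) = exp_mult r (heis x n (Poly_Mapping.single (M, q) 1))
     + (if n = 0 then cscale (of_int (hyp_form x (hyp_ru r))) (exp_mult r (Poly_Mapping.single (M, q) 1)) else 0)"
    by cases (simp_all add: exp_mult_single heis_neg heis_pos heis_0 linop_sum[OF linop_exp_mult] hyp_ru_add
        hyp_form_add_right cscale_single add.commute flip: single_add)
qed

text \<open>
  \<open>z\<^sup>r\<^sup>u\<close> acts as the identity because the \<open>u\<^sub>p\<close> are isotropic, and the product of the two exponentials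
  is normally ordered as it stands.
\<close>

lemma exp_field_nop:
  fixes w :: "'a::finite fock"
  shows "exp_field r n w = nop (exp_creation r) (exp_annihilation r) n (exp_mult r w)"
proof -
  have z: "zpow_coeff r s v = (if s = 0 then v else 0)" for s and v :: "'a fock"
    by (auto simp: zpow_coeff_def case_prod_unfold lin_ext_def[of "\<lambda>_. 0"])
  have e0: "exp_mult r 0 = 0" by (rule linop_0[OF linop_exp_mult])
  let ?c = "creation_part r" and ?a = "annihilation_part r"
  have c0: "exp_coeff ?c i 0 = 0" and a0: "exp_coeff ?a i 0 = 0" for i
    by (auto intro!: linop_0 linop_exp_coeff linop_parts)
  let ?F = "\<lambda>(i, l, s). if int i - int l + s = - n - 1
     then exp_coeff ?c i (exp_coeff ?a l (exp_mult r (zpow_coeff r s w))) else 0"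
  let ?G = "nterm (exp_creation r) (exp_annihilation r) n (exp_mult r w)"
  have G: "?G m = (if m < 0 \<and> m \<le> n
      then exp_coeff ?c (nat (- m - 1)) (exp_coeff ?a (nat (n - m)) (exp_mult r w)) else 0)" for m
    by (auto simp: nterm_def exp_creation_def exp_annihilation_def c0 a0)
  have "exp_field r n w = (\<Sum>t | ?F t \<noteq> 0. ?F t)"
    unfolding exp_field_def creation_part_def[abs_def] annihilation_part_def[abs_def] Sum_any.expand_set ..
  also have "\<dots> = (\<Sum>m | ?G m \<noteq> 0. ?G m)"
  proof (rule sum.reindex_bij_witness[of _ "\<lambda>m. (nat (- m - 1), nat (n - m), 0)" "\<lambda>(i, l, s). - int i - 1"])
    fix t assume "t \<in> {t. ?F t \<noteq> 0}"
    moreover obtain i l s where t: "t = (i, l, s)" by (metis surj_pair)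
    ultimately have s: "s = 0" and il: "int i - int l = - n - 1"
      by (auto simp: z e0 c0 a0 split: if_splits)
    define m where "m = - int i - 1"
    have m: "m < 0" "m \<le> n" "nat (- m - 1) = i" "nat (n - m) = l" using il by (auto simp: m_def)
    show "(case case t of (i, l, s) \<Rightarrow> - int i - 1 of m \<Rightarrow> (nat (- m - 1), nat (n - m), 0)) = t"
      using m by (simp add: t s m_def)
    have "?G (case t of (i, l, s) \<Rightarrow> - int i - 1) = ?F t"
      unfolding G t s using m by (simp add: m_def[symmetric] z il)
    then show "?G (case t of (i, l, s) \<Rightarrow> - int i - 1) = ?F t"
      "(case t of (i, l, s) \<Rightarrow> - int i - 1) \<in> {m. ?G m \<noteq> 0}"
      using \<open>t \<in> {t. ?F t \<noteq> 0}\<close> by simp_all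
  next
    fix m assume m: "m \<in> {m. ?G m \<noteq> 0}"
    then have *: "m < 0" "m \<le> n" by (auto simp: G split: if_splits)
    then show "(case (nat (- m - 1), nat (n - m), 0 :: int) of (i, l, s) \<Rightarrow> - int i - 1) = m" by simp
    have "?F (nat (- m - 1), nat (n - m), 0) = ?G m" using * by (simp add: z G)
    then show "(nat (- m - 1), nat (n - m), 0) \<in> {t. ?F t \<noteq> 0}" using m by simp
  qed
  finally show ?thesis by (simp add: nop_nterm Sum_any.expand_set)
qed

lemma hfield_exp_field: "hfield 1 (exp_field r)"
proof -
  have "hfield 1 (nop (exp_creation r) (exp_annihilation r))"
    by (rule hfield_nop[OF hfield_exp_creation hfield_exp_annihilation]) simp
  then have "linop (\<lambda>w. nop (exp_creation r) (exp_annihilation r) n (exp_mult r w))"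
    "homog (n + 1) (\<lambda>w. nop (exp_creation r) (exp_annihilation r) n (exp_mult r w))" for n
    by (auto intro: linop_comp[OF _ linop_exp_mult] homog_comp[OF _ homog_exp_mult] hfield_linop hfield_homog)
  then show ?thesis unfolding hfield_def exp_field_nop[abs_def] by blast
qed

lemmas is_field_exp_creation = hfield_is_field[OF hfield_exp_creation]
  and is_field_exp_annihilation = hfield_is_field[OF hfield_exp_annihilation]
  and is_field_exp_field = hfield_is_field[OF hfield_exp_field]

lemma exp_field_commutes:
  assumes h: "linop h" and ru: "\<And>n w. n \<noteq> 0 \<Longrightarrow> h (heis (hyp_ru r) n w) = heis (hyp_ru r) n (h w)"
    and e: "\<And>w. h (exp_mult r w) = exp_mult r (h w)"
  shows "h (exp_field r m w) = exp_field r m (h w)"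
proof -
  have "h (creation_part r j w) = creation_part r j (h w)"
    "h (annihilation_part r j w) = annihilation_part r j (h w)" if "j > 0" for j w
    using that unfolding creation_part_def annihilation_part_def linop_cscale[OF h] by (simp_all add: ru)
  then have "h (exp_creation r n w) = exp_creation r n (h w)"
    "h (exp_annihilation r n w) = exp_annihilation r n (h w)" for n w
    unfolding exp_creation_def exp_annihilation_def using linop_0[OF h]
    by (auto intro!: exp_coeff_commutes linop_parts h)
  then show ?thesis
    unfolding exp_field_nop e[symmetric]
    by (intro nop_commutes is_field_exp_creation is_field_exp_annihilation h)
qed

lemma heis_ru_commute: "heis (hyp_ru t) n (heis (hyp_ru s) m w) = heis (hyp_ru s) m (heis (hyp_ru t) n w)"
  by (rule eq_iff_diff_eq_0[THEN iffD2]) (simp add: heis_commutator)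

lemma heis_ru_parts:
  "heis (hyp_ru t) n (creation_part r j w) = creation_part r j (heis (hyp_ru t) n w)"
  "heis (hyp_ru t) n (annihilation_part r j w) = annihilation_part r j (heis (hyp_ru t) n w)"
  unfolding creation_part_def annihilation_part_def heis_cscale heis_ru_commute[of t n r] by simp_all

lemma heis_ru_exp_mult: "heis (hyp_ru t) n (exp_mult r w) = exp_mult r (heis (hyp_ru t) n w)"
  by (simp add: heis_exp_mult)

lemma heis_ru_exp_field: "heis (hyp_ru t) n (exp_field r m w) = exp_field r m (heis (hyp_ru t) n w)"
  by (rule exp_field_commutes) (simp_all add: linop_heis heis_ru_commute heis_ru_exp_mult)

lemma exp_mult_exp_field: "exp_mult s (exp_field r m w) = exp_field r m (exp_mult s w)"
proof (rule exp_field_commutes[OF linop_exp_mult])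
  show "exp_mult s (exp_mult r w) = exp_mult r (exp_mult s w)" for w
    by (rule linop_eqI[of "\<lambda>w. exp_mult s (exp_mult r w)" "\<lambda>w. exp_mult r (exp_mult s w)"])
      (simp_all add: linop_comp[OF linop_exp_mult linop_exp_mult] exp_mult_single add_ac)
qed (simp add: heis_ru_exp_mult)

lemma exp_field_commute: "exp_field r m (exp_field s n w) = exp_field s n (exp_field r m w)"
  by (rule exp_field_commutes)
    (simp_all add: hfield_linop[OF hfield_exp_field] heis_ru_exp_field exp_mult_exp_field)

lemma heis_v_ru: "heis (hyp_v p) n (heis (hyp_ru t) m w) = heis (hyp_ru t) m (heis (hyp_v p) n w)
    + (if m = - n then cscale (of_int (n * t $ p)) w else 0)"
  using heis_commutator[of "hyp_v p" n "hyp_ru t" m w] by (simp add: hyp_form_v_ru algebra_simps split: if_splits)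

lemma heis_v_creation_part:
  assumes "j > 0"
  shows "heis (hyp_v p) n (creation_part r j w) = creation_part r j (heis (hyp_v p) n w)
    + (if n = int j then cscale (of_int (r $ p)) w else 0)"
  using assms by (auto simp: creation_part_def heis_cscale heis_v_ru fvec.scale_right_distrib)

lemma heis_v_annihilation_part:
  assumes "j > 0"
  shows "heis (hyp_v p) n (annihilation_part r j w) = annihilation_part r j (heis (hyp_v p) n w)
    + (if n = - int j then cscale (of_int (r $ p)) w else 0)"
  unfolding annihilation_part_def heis_cscale heis_v_ru fvec.scale_right_distrib using assms by auto

text \<open>
  \<open>[v\<^sub>p(n), Y(e\<^sup>r\<^sup>u, z)] = r\<^sub>p z\<^sup>n Y(e\<^sup>r\<^sup>u, z)\<close>: for \<open>n > 0\<close> the contribution comes from the creation part, for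
  \<open>n < 0\<close> from the annihilation part, and for \<open>n = 0\<close> from multiplication by \<open>e\<^sup>r\<^sup>u\<close>.
\<close>

lemma heis_v_exp_field:
  "heis (hyp_v p) n (exp_field r m w) = exp_field r m (heis (hyp_v p) n w) + cscale (of_int (r $ p)) (exp_field r (m + n) w)"
proof -
  let ?C = "exp_creation r" and ?A = "exp_annihilation r" and ?e = "exp_mult r w" and ?c = "complex_of_int (r $ p)"
  let ?h = "heis (hyp_v p) n"
  have C: "?h (?C l v) = ?C l (?h v) + (if n > 0 then cscale ?c (?C (l + n) v) else 0)" for l v
  proof (cases "l < 0")
    case l: True
    show ?thesis
    proof (cases "n > 0")
      case True
      have "?h (exp_coeff (creation_part r) (nat (- l - 1)) v)
          = exp_coeff (creation_part r) (nat (- l - 1)) (?h v)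
          + (if nat n \<le> nat (- l - 1) then cscale ?c
              (exp_coeff (creation_part r) (nat (- l - 1) - nat n) v) else 0)"
        by (rule exp_coeff_derivation[OF linop_creation_part linop_heis])
          (use True in \<open>auto simp: heis_v_creation_part\<close>)
      moreover have "nat (- l - 1) - nat n = nat (- (l + n) - 1)" using True l by simp
      moreover have "nat n \<le> nat (- l - 1) \<longleftrightarrow> l + n < 0" using True l by auto
      ultimately show ?thesis using l True by (simp add: exp_creation_def)
    next
      case False
      have "?h (exp_coeff (creation_part r) (nat (- l - 1)) v)
          = exp_coeff (creation_part r) (nat (- l - 1)) (?h v)"
        by (rule exp_coeff_commutes[OF linop_creation_part linop_heis])
          (use False in \<open>auto simp: heis_v_creation_part\<close>)
      then show ?thesis using l False by (simp add: exp_creation_def)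
    qed
  qed (simp add: exp_creation_def)
  have A: "?h (?A l v) = ?A l (?h v) + (if n < 0 then cscale ?c (?A (l + n) v) else 0)" for l v
  proof (cases "l \<ge> - 1")
    case l: True
    show ?thesis
    proof (cases "n < 0")
      case True
      have "?h (exp_coeff (annihilation_part r) (nat (l + 1)) v)
          = exp_coeff (annihilation_part r) (nat (l + 1)) (?h v)
          + (if nat (- n) \<le> nat (l + 1) then cscale ?c
              (exp_coeff (annihilation_part r) (nat (l + 1) - nat (- n)) v) else 0)"
        by (rule exp_coeff_derivation[OF linop_annihilation_part linop_heis])
          (use True in \<open>auto simp: heis_v_annihilation_part\<close>)
      moreover have "nat (l + 1) - nat (- n) = nat (l + n + 1)" using True l by simp
      moreover have "nat (- n) \<le> nat (l + 1) \<longleftrightarrow> l + n \<ge> - 1" using True l by auto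
      ultimately show ?thesis using l True by (simp add: exp_annihilation_def)
    next
      case False
      have "?h (exp_coeff (annihilation_part r) (nat (l + 1)) v)
          = exp_coeff (annihilation_part r) (nat (l + 1)) (?h v)"
        by (rule exp_coeff_commutes[OF linop_annihilation_part linop_heis])
          (use False in \<open>auto simp: heis_v_annihilation_part\<close>)
      then show ?thesis using l False by (simp add: exp_annihilation_def)
    qed
  qed (auto simp: exp_annihilation_def)
  have CA: "?C l (?A k v) = ?A k (?C l v)" for l k v
  proof -
    have lA: "linop (?A k)" by (rule hfield_linop[OF hfield_exp_annihilation])
    have "heis (hyp_ru r) j (?A k v) = ?A k (heis (hyp_ru r) j v)" for j v
      unfolding exp_annihilation_def by (auto intro!: exp_coeff_commutes linop_parts linop_heis heis_ru_parts)
    then have "?A k (creation_part r j v) = creation_part r j (?A k v)" for j v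
      unfolding creation_part_def linop_cscale[OF lA] by simp
    then show ?thesis
      unfolding exp_creation_def using linop_0[OF lA]
      by (auto intro!: exp_coeff_commutes[symmetric] linop_parts lA)
  qed
  note f = is_field_exp_creation[of r] is_field_exp_annihilation[of r]
  consider "n < 0" | "n = 0" | "n > 0" by linarith
  then show ?thesis
  proof cases
    case 1
    have "?h (nop ?C ?A m ?e) = nop ?C ?A m (?h ?e) + nop (\<lambda>_ _. 0) ?A m ?e + nop ?C (\<lambda>l v. cscale ?c (?A (l + n) v)) m ?e"
      by (rule nop_commutator) (use 1 in \<open>auto intro: f is_field_zero is_field_shift_scale linop_heis simp: C A\<close>)
    also have "nop ?C (\<lambda>l v. cscale ?c (?A (l + n) v)) m ?e = cscale ?c (nop ?C ?A (m + n) ?e)"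
      using nop_scale_right[OF f(1) is_field_shift[OF f(2)], of ?c n m ?e] by (simp add: nop_shift_right)
    finally show ?thesis
      using 1 by (simp add: exp_field_nop heis_exp_mult nop_zero_left f)
  next
    case 2
    have "?h (?C l v) = ?C l (?h v)" "?h (?A l v) = ?A l (?h v)" for l v
      using C[of l v] A[of l v] 2 by simp_all
    then have "?h (nop ?C ?A m ?e) = nop ?C ?A m (?h ?e)"
      by (intro nop_commutes f linop_heis)
    then show ?thesis
      using 2 by (simp add: exp_field_nop heis_exp_mult hyp_form_v_ru linop_add[OF linop_nop[OF f]] linop_cscale[OF linop_nop[OF f]])
  next
    case 3
    have "?h (nop ?C ?A m ?e) = nop ?C ?A m (?h ?e) + nop (\<lambda>l v. cscale ?c (?C (l + n) v)) ?A m ?e + nop ?C (\<lambda>_ _. 0) m ?e"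
      by (rule nop_commutator) (use 3 in \<open>auto intro: f is_field_zero is_field_shift_scale linop_heis simp: C A\<close>)
    also have "nop (\<lambda>l v. cscale ?c (?C (l + n) v)) ?A m ?e = cscale ?c (nop ?C ?A (m + n) ?e)"
      using nop_scale_left[OF is_field_shift[OF f(1)] f(2), of ?c n m ?e]
      by (simp add: nop_shift_left_commuting[OF f CA])
    finally show ?thesis
      using 3 by (simp add: exp_field_nop heis_exp_mult nop_zero_right f)
  qed
qed

lemma exp_field_exp_vec:
  "n \<ge> 0 \<Longrightarrow> exp_field r n (exp_vec q) = 0"
  "exp_field r (- 1) (exp_vec q) = exp_vec (r + q)"
proof -
  show "n \<ge> 0 \<Longrightarrow> exp_field r n (exp_vec q) = 0"
    by (rule hfield_exp_vec[OF hfield_exp_field]) simp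
  let ?e = "exp_vec (r + q) :: 'a fock"
  have "exp_annihilation r n ?e = 0" if "n \<ge> 0" for n
    by (rule hfield_exp_vec[OF hfield_exp_annihilation]) (use that in simp)
  moreover have "exp_creation r n ?e = 0" if "n \<ge> 0" for n
    using that by (simp add: exp_creation_def)
  ultimately have "nop (exp_creation r) (exp_annihilation r) (- 1) ?e
      = exp_creation r (- 1) (exp_annihilation r (- 1) ?e)"
    using nop_creation[of "exp_creation r" "exp_annihilation r" ?e "- 1" 1]
    by (simp add: hfield_linop[OF hfield_exp_creation] hfield_linop[OF hfield_exp_annihilation])
  then show "exp_field r (- 1) (exp_vec q) = ?e"
    by (simp add: exp_field_nop exp_mult_exp_vec exp_creation_def exp_annihilation_def exp_coeff_0 linop_parts)
qed

section \<open>Currents\<close>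

text \<open>
  \<open>u_current t r\<close> is \<open>(tu)(z) Y(e\<^sup>r\<^sup>u, z)\<close> for the vector \<open>tu = \<Sum>\<^sub>p t\<^sub>p u\<^sub>p\<close>, and \<open>v_current a r\<close> is
  the normally ordered product of \<open>v\<^sub>a(z)\<close> and \<open>Y(e\<^sup>r\<^sup>u, z)\<close>.
\<close>

definition u_current :: "int ^ 'a::finite \<Rightarrow> int ^ 'a \<Rightarrow> 'a field" where
  "u_current t r = nop (heis (hyp_ru t)) (exp_field r)"

definition v_current :: "'a::finite \<Rightarrow> int ^ 'a \<Rightarrow> 'a field" where
  "v_current a r = nop (heis (hyp_v a)) (exp_field r)"

lemma hyp_u_ru: "hyp_u p = hyp_ru (axis p 1)"
proof (rule vec_eq_iff[THEN iffD2], rule allI)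
  show "hyp_u p $ i = hyp_ru (axis p 1) $ i" for i
    by (cases i) (auto simp: hyp_u_def axis_def)
qed

lemma hfield_u_current: "hfield 0 (u_current t r)"
  and hfield_v_current: "hfield 0 (v_current a r)"
  unfolding u_current_def v_current_def by (rule hfield_nop[OF hfield_heis hfield_exp_field], simp)+

lemmas is_field_u_current = hfield_is_field[OF hfield_u_current]
  and is_field_v_current = hfield_is_field[OF hfield_v_current]

lemmas is_field_basic = is_field_heis is_field_exp_field is_field_u_current is_field_v_current

lemma linop_exp_field: "linop (exp_field r n)"
  and linop_u_current: "linop (u_current t r n)"
  and linop_v_current: "linop (v_current a r n)"
  by (simp_all add: is_field_linop is_field_basic)

lemmas linop_basic = linop_heis linop_exp_field linop_u_current linop_v_current

lemma u_current_0: "u_current t 0 = heis (hyp_ru t)"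
  and v_current_0: "v_current a 0 = heis (hyp_v a)"
  by (simp_all add: u_current_def v_current_def nop_exp_field_0)

lemma heis_ru_exp_vec: "n \<ge> 0 \<Longrightarrow> heis (hyp_ru t) n (exp_vec q) = 0"
  using heis_exp_vec(1)[of n "hyp_ru t" q] heis_exp_vec(2)[of "hyp_ru t" q] by (cases "n = 0") auto

lemma u_current_exp_vec: "n \<ge> 0 \<Longrightarrow> u_current t r n (exp_vec q) = 0"
  unfolding u_current_def
  by (rule nop_exp_vec_zero) (simp_all add: linop_basic heis_ru_exp_vec exp_field_exp_vec)

lemma heis_ru_u_current: "heis (hyp_ru a) n (u_current t r m w) = u_current t r m (heis (hyp_ru a) n w)"
  unfolding u_current_def
  by (intro nop_commutes is_field_basic linop_heis heis_ru_commute heis_ru_exp_field)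

lemma exp_field_u_current: "exp_field s n (u_current t r m w) = u_current t r m (exp_field s n w)"
  unfolding u_current_def
  by (intro nop_commutes is_field_basic linop_basic exp_field_commute heis_ru_exp_field[symmetric])

lemma u_current_commute: "u_current a s n (u_current t r m w) = u_current t r m (u_current a s n w)"
  unfolding u_current_def[of t]
  by (intro nop_commutes is_field_basic linop_basic exp_field_u_current[symmetric] heis_ru_u_current[symmetric])

lemma nop_scale_shift_right:
  "is_field A \<Longrightarrow> is_field B \<Longrightarrow> nop A (\<lambda>l w. cscale c (B (l + n) w)) m w = cscale c (nop A B (m + n) w)"
  using nop_scale_right[of A "\<lambda>l. B (l + n)" c m w] by (simp add: is_field_shift nop_shift_right)

lemma nop_scale_shift_left:
  "is_field A \<Longrightarrow> is_field B \<Longrightarrow> (\<And>k l w. A k (B l w) = B l (A k w)) \<Longrightarrow>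
    nop (\<lambda>l w. cscale c (A (l + n) w)) B m w = cscale c (nop A B (m + n) w)"
  using nop_scale_left[of "\<lambda>l. A (l + n)" B c m w] by (simp add: is_field_shift nop_shift_left_commuting)

lemma heis_v_u_current:
  "heis (hyp_v p) n (u_current t r m w) = u_current t r m (heis (hyp_v p) n w)
     + cscale (of_int (r $ p)) (u_current t r (m + n) w) + cscale (of_int (n * t $ p)) (exp_field r (m + n - 1) w)"
proof -
  have "heis (hyp_v p) n (u_current t r m w) = u_current t r m (heis (hyp_v p) n w)
     + nop (\<lambda>l w. if l = - n then cscale (of_int (n * t $ p)) w else 0) (exp_field r) m w
     + nop (heis (hyp_ru t)) (\<lambda>l w. cscale (of_int (r $ p)) (exp_field r (l + n) w)) m w"
    unfolding u_current_def
    by (rule nop_commutator) (simp_all only: is_field_basic is_field_delta is_field_shift_scale linop_heis heis_v_ru heis_v_exp_field)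
  also have "nop (heis (hyp_ru t)) (\<lambda>l w. cscale (of_int (r $ p)) (exp_field r (l + n) w)) m w
      = cscale (of_int (r $ p)) (u_current t r (m + n) w)"
    by (simp add: nop_scale_shift_right is_field_heis is_field_basic u_current_def)
  also have "nop (\<lambda>l w. if l = - n then cscale (of_int (n * t $ p)) w else 0) (exp_field r) m w
      = cscale (of_int (n * t $ p)) (exp_field r (m + n - 1) w)"
    by (subst nop_delta_left[OF is_field_exp_field]) simp
  finally show ?thesis by (simp only: add_ac)
qed

lemma heis_v_v: "heis (hyp_v p) n (heis (hyp_v q) m w) = heis (hyp_v q) m (heis (hyp_v p) n w)"
  by (rule eq_iff_diff_eq_0[THEN iffD2]) (simp add: heis_commutator hyp_form_vv)

lemma heis_v_v_current:
  "heis (hyp_v p) n (v_current a r m w) = v_current a r m (heis (hyp_v p) n w)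
     + cscale (of_int (r $ p)) (v_current a r (m + n) w)"
proof -
  have "heis (hyp_v p) n (v_current a r m w) = v_current a r m (heis (hyp_v p) n w)
     + nop (\<lambda>l w. 0) (exp_field r) m w
     + nop (heis (hyp_v a)) (\<lambda>l w. cscale (of_int (r $ p)) (exp_field r (l + n) w)) m w"
    unfolding v_current_def
    by (rule nop_commutator) (simp_all add: is_field_basic is_field_zero is_field_shift_scale linop_heis heis_v_v heis_v_exp_field)
  also have "nop (heis (hyp_v a)) (\<lambda>l w. cscale (of_int (r $ p)) (exp_field r (l + n) w)) m w
      = cscale (of_int (r $ p)) (v_current a r (m + n) w)"
    by (simp add: nop_scale_shift_right is_field_heis is_field_basic v_current_def)
  finally show ?thesis by (simp add: nop_zero_left is_field_basic)
qed

section \<open>The commutative algebra of the fields in the \<open>u\<^sub>p\<close> and \<open>e\<^sup>r\<^sup>u\<close>\<close>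

text \<open>
  To be applied with \<open>h = v\<^sub>p(n)\<close> and commuting fields of charges \<open>a\<close> and \<open>b\<close>, where the
  terms with \<open>A1\<close> and \<open>B1\<close> come from the contractions of \<open>v\<^sub>p\<close> with \<open>u\<^sub>p\<close>
\<close>

lemma nop_charged:
  assumes f: "is_field A" "is_field B" "is_field A1" "is_field B1" and h: "linop h"
    and AB: "\<And>k l w. A k (B l w) = B l (A k w)" and A1B: "\<And>k l w. A1 k (B l w) = B l (A1 k w)"
    and A: "\<And>l w. h (A l w) = A l (h w) + cscale a (A (l + n) w) + cscale \<alpha> (A1 (l + n - 1) w)"
    and B: "\<And>l w. h (B l w) = B l (h w) + cscale b (B (l + n) w) + cscale \<beta> (B1 (l + n - 1) w)"
  shows "h (nop A B m w) = nop A B m (h w) + cscale (a + b) (nop A B (m + n) w)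
    + (cscale \<alpha> (nop A1 B (m + n - 1) w) + cscale \<beta> (nop A B1 (m + n - 1) w))"
proof -
  have s: "is_field (\<lambda>l w. cscale c (F (l + k) w))" if "is_field F" for F :: "'a field" and c k
    using that by (rule is_field_shift_scale)
  have "h (nop A B m w) = nop A B m (h w)
      + nop (\<lambda>l w. cscale a (A (l + n) w) + cscale \<alpha> (A1 (l + (n - 1)) w)) B m w
      + nop A (\<lambda>l w. cscale b (B (l + n) w) + cscale \<beta> (B1 (l + (n - 1)) w)) m w"
    by (rule nop_commutator[OF f(1,2) is_field_plus[OF s[OF f(1)] s[OF f(3)]] is_field_plus[OF s[OF f(2)] s[OF f(4)]] h])
      (simp_all add: A B add_ac add_diff_eq)
  also have "nop (\<lambda>l w. cscale a (A (l + n) w) + cscale \<alpha> (A1 (l + (n - 1)) w)) B m w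
      = cscale a (nop A B (m + n) w) + cscale \<alpha> (nop A1 B (m + (n - 1)) w)"
    unfolding nop_plus_left[OF s[OF f(1)] s[OF f(3)] f(2)]
      nop_scale_shift_left[OF f(1,2) AB] nop_scale_shift_left[OF f(3,2) A1B] ..
  also have "nop A (\<lambda>l w. cscale b (B (l + n) w) + cscale \<beta> (B1 (l + (n - 1)) w)) m w
      = cscale b (nop A B (m + n) w) + cscale \<beta> (nop A B1 (m + (n - 1)) w)"
    unfolding nop_plus_right[OF f(1) s[OF f(2)] s[OF f(4)]]
      nop_scale_shift_right[OF f(1,2)] nop_scale_shift_right[OF f(1,4)] ..
  finally show ?thesis
    by (simp add: fvec.scale_left_distrib add_ac add_diff_eq)
qed

text \<open>\<open>\<partial>Y(e\<^sup>r\<^sup>u, z) = (ru)(z) Y(e\<^sup>r\<^sup>u, z)\<close>\<close>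

lemma exp_field_deriv: "u_current r r m w = cscale (- of_int m) (exp_field r (m - 1) w)"
proof -
  have "u_current r r m w = fderiv (exp_field r) m w"
  proof (rule field_eqI[where A = "u_current r r" and B = "fderiv (exp_field r)" and c = 0 and s = r and C = "\<lambda>_ _ _ _. 0"
        and D = "\<lambda>p n m w. cscale (of_int (n * r $ p)) (exp_field r (m + n - 1) w)"])
    show "hfield 0 (fderiv (exp_field r))"
      using hfield_fderiv[OF hfield_exp_field, of r] by simp
    fix p n m w
    show "heis (hyp_v p) n (fderiv (exp_field r) m w) = fderiv (exp_field r) m (heis (hyp_v p) n w)
        + cscale (of_int (r $ p)) (fderiv (exp_field r) (m + n) w)
        + cscale (of_int (n * r $ p)) (exp_field r (m + n - 1) w)"
      unfolding fderiv_def heis_cscale heis_v_exp_field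
      by (rule poly_mapping_eqI) (simp add: lookup_add algebra_simps)
  qed (simp_all add: hfield_u_current hyp_u_ru heis_ru_u_current heis_v_u_current fderiv_def
      heis_cscale heis_ru_exp_field u_current_exp_vec linop_minus[OF linop_heis])
  then show ?thesis by (simp add: fderiv_def)
qed

lemma nop_exp_exp: "nop (exp_field r) (exp_field s) m w = exp_field (r + s) m w"
proof (rule field_eqI[where A = "nop (exp_field r) (exp_field s)" and B = "exp_field (r + s)" and c = 1 and s = "r + s" and C = "\<lambda>_ _ _ _. 0" and D = "\<lambda>_ _ _ _. 0"])
  show "hfield 1 (nop (exp_field r) (exp_field s))"
    by (rule hfield_nop[OF hfield_exp_field hfield_exp_field]) simp
  fix p n m w
  show "heis (hyp_u p) n (nop (exp_field r) (exp_field s) m w)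
      = nop (exp_field r) (exp_field s) m (heis (hyp_u p) n w) + 0"
    by (simp add: hyp_u_ru) (intro nop_commutes is_field_basic linop_heis heis_ru_exp_field)
  show "heis (hyp_v p) n (nop (exp_field r) (exp_field s) m w)
      = nop (exp_field r) (exp_field s) m (heis (hyp_v p) n w)
       + cscale (of_int ((r + s) $ p)) (nop (exp_field r) (exp_field s) (m + n) w) + 0"
    using nop_charged[of "exp_field r" "exp_field s" "\<lambda>_ _. 0" "\<lambda>_ _. 0" "heis (hyp_v p) n"
        "of_int (r $ p)" n 0 "of_int (s $ p)" 0 m w]
    by (simp add: is_field_basic is_field_zero linop_heis exp_field_commute[of r _ s] heis_v_exp_field linop_0 linop_basic)
next
  fix q :: "int ^ 'a"
  show "nop (exp_field r) (exp_field s) (- 1) (exp_vec q) = exp_field (r + s) (- 1) (exp_vec q)"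
    using nop_creation[of "exp_field r" "exp_field s" "exp_vec q" "- 1" 1]
    by (simp add: linop_basic exp_field_exp_vec add_ac)
qed (simp_all add: hfield_exp_field hyp_u_ru heis_ru_exp_field heis_v_exp_field)

lemma nop_exp_u: "nop (exp_field r) (u_current t s) m w = u_current t (r + s) m w"
proof (rule field_eqI[where A = "nop (exp_field r) (u_current t s)" and B = "u_current t (r + s)" and c = 0 and s = "r + s" and C = "\<lambda>_ _ _ _. 0"
      and D = "\<lambda>p n m w. cscale (of_int (n * t $ p)) (exp_field (r + s) (m + n - 1) w)"])
  show "hfield 0 (nop (exp_field r) (u_current t s))"
    by (rule hfield_nop[OF hfield_exp_field hfield_u_current]) simp
  fix p n m w
  show "heis (hyp_u p) n (nop (exp_field r) (u_current t s) m w)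
      = nop (exp_field r) (u_current t s) m (heis (hyp_u p) n w) + 0"
    by (simp add: hyp_u_ru) (intro nop_commutes is_field_basic linop_heis heis_ru_exp_field heis_ru_u_current)
  show "heis (hyp_v p) n (nop (exp_field r) (u_current t s) m w)
      = nop (exp_field r) (u_current t s) m (heis (hyp_v p) n w)
       + cscale (of_int ((r + s) $ p)) (nop (exp_field r) (u_current t s) (m + n) w)
       + cscale (of_int (n * t $ p)) (exp_field (r + s) (m + n - 1) w)"
    using nop_charged[of "exp_field r" "u_current t s" "\<lambda>_ _. 0" "exp_field s" "heis (hyp_v p) n"
        "of_int (r $ p)" n 0 "of_int (s $ p)" "of_int (n * t $ p)" m w]
    by (simp add: is_field_basic is_field_zero linop_heis exp_field_u_current heis_v_exp_field heis_v_u_current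
        nop_exp_exp linop_0 linop_basic)
next
  fix q :: "int ^ 'a"
  have "nop (exp_field r) (u_current t s) 0 (exp_vec q) = 0"
    by (rule nop_exp_vec_zero) (simp_all add: linop_basic exp_field_exp_vec u_current_exp_vec)
  then show "nop (exp_field r) (u_current t s) (- 0) (exp_vec q) = u_current t (r + s) (- 0) (exp_vec q)"
    by (simp add: u_current_exp_vec)
qed (simp_all add: hfield_u_current hyp_u_ru heis_ru_u_current heis_v_u_current)

lemma nop_u_exp: "nop (u_current t r) (exp_field s) m w = u_current t (r + s) m w"
proof (rule field_eqI[where A = "nop (u_current t r) (exp_field s)" and B = "u_current t (r + s)" and c = 0 and s = "r + s" and C = "\<lambda>_ _ _ _. 0"
      and D = "\<lambda>p n m w. cscale (of_int (n * t $ p)) (exp_field (r + s) (m + n - 1) w)"])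
  show "hfield 0 (nop (u_current t r) (exp_field s))"
    by (rule hfield_nop[OF hfield_u_current hfield_exp_field]) simp
  fix p n m w
  show "heis (hyp_u p) n (nop (u_current t r) (exp_field s) m w)
      = nop (u_current t r) (exp_field s) m (heis (hyp_u p) n w) + 0"
    by (simp add: hyp_u_ru) (intro nop_commutes is_field_basic linop_heis heis_ru_exp_field heis_ru_u_current)
  show "heis (hyp_v p) n (nop (u_current t r) (exp_field s) m w)
      = nop (u_current t r) (exp_field s) m (heis (hyp_v p) n w)
       + cscale (of_int ((r + s) $ p)) (nop (u_current t r) (exp_field s) (m + n) w)
       + cscale (of_int (n * t $ p)) (exp_field (r + s) (m + n - 1) w)"
    using nop_charged[of "u_current t r" "exp_field s" "exp_field r" "\<lambda>_ _. 0" "heis (hyp_v p) n"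
        "of_int (r $ p)" n "of_int (n * t $ p)" "of_int (s $ p)" 0 m w]
    by (simp add: is_field_basic is_field_zero linop_heis exp_field_u_current exp_field_commute[of r _ s]
        heis_v_exp_field heis_v_u_current nop_exp_exp)
next
  fix q :: "int ^ 'a"
  have "nop (u_current t r) (exp_field s) 0 (exp_vec q) = 0"
    by (rule nop_exp_vec_zero) (simp_all add: linop_basic exp_field_exp_vec u_current_exp_vec)
  then show "nop (u_current t r) (exp_field s) (- 0) (exp_vec q) = u_current t (r + s) (- 0) (exp_vec q)"
    by (simp add: u_current_exp_vec)
qed (simp_all add: hfield_u_current hyp_u_ru heis_ru_u_current heis_v_u_current)

text \<open>Both sides are the product of \<open>(au)(z)\<close>, \<open>(bu)(z)\<close> and \<open>Y(e\<^sup>(\<^sup>r\<^sup>+\<^sup>s\<^sup>)\<^sup>u, z)\<close>.\<close>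

lemma nop_u_u_swap: "nop (u_current a r) (u_current b s) m w = nop (u_current b r) (u_current a s) m w"
proof -
  have u: "heis (hyp_u p) n (nop (u_current a r) (u_current b s) m w)
      = nop (u_current a r) (u_current b s) m (heis (hyp_u p) n w) + 0" for p n m w a b
    by (simp add: hyp_u_ru) (intro nop_commutes is_field_basic linop_heis heis_ru_u_current)
  have v: "heis (hyp_v p) n (nop (u_current a r) (u_current b s) m w)
      = nop (u_current a r) (u_current b s) m (heis (hyp_v p) n w)
       + cscale (of_int ((r + s) $ p)) (nop (u_current a r) (u_current b s) (m + n) w)
       + (cscale (of_int (n * a $ p)) (u_current b (r + s) (m + n - 1) w)
        + cscale (of_int (n * b $ p)) (u_current a (r + s) (m + n - 1) w))" for p n m w a b
    using nop_charged[of "u_current a r" "u_current b s" "exp_field r" "exp_field s" "heis (hyp_v p) n"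
        "of_int (r $ p)" n "of_int (n * a $ p)" "of_int (s $ p)" "of_int (n * b $ p)" m w]
    by (simp add: is_field_basic linop_heis exp_field_u_current u_current_commute[of a r _ b]
        heis_v_u_current nop_exp_u nop_u_exp)
  have h: "hfield (- 1) (nop (u_current a r) (u_current b s))" for a b
    by (rule hfield_nop[OF hfield_u_current hfield_u_current]) simp
  have e: "nop (u_current a r) (u_current b s) (- (- 1)) (exp_vec q) = 0" for q a b
    by (rule nop_exp_vec_zero) (simp_all add: linop_basic u_current_exp_vec)
  show ?thesis
    by (rule field_eqI[OF h h u u v], subst v, simp only: add_ac) (simp only: e)
qed

lemma heis_ru_expand: "heis (hyp_ru t) n w = (\<Sum>p\<in>UNIV. cscale (of_int (t $ p)) (heis (hyp_u p) n w))"
proof (rule linop_eqI[where f = "heis (hyp_ru t) n" and g = "\<lambda>w. \<Sum>p\<in>UNIV. cscale (of_int (t $ p)) (heis (hyp_u p) n w)"])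
  show "linop (\<lambda>w. \<Sum>p\<in>UNIV. cscale (of_int (t $ p)) (heis (hyp_u p) n w))"
    by (intro linop_sum_op linop_scale linop_heis)
  fix M and r :: "int ^ 'a"
  have c: "hyp_ru t $ b = (\<Sum>p\<in>UNIV. t $ p * hyp_u p $ b)" for b
    by (simp add: hyp_ru_def)
  have f: "hyp_form (hyp_ru t) y = (\<Sum>p\<in>UNIV. t $ p * hyp_form (hyp_u p) y)" for y
  proof -
    have "(\<Sum>p\<in>UNIV. t $ p * hyp_form (hyp_u p) y)
        = (\<Sum>p\<in>UNIV. \<Sum>b\<in>UNIV. t $ p * hyp_u p $ b * hyp_form y (axis b 1))"
      unfolding hyp_form_expand[of "hyp_u p" y for p] sum_distrib_left mult.assoc ..
    also have "\<dots> = (\<Sum>b\<in>UNIV. \<Sum>p\<in>UNIV. t $ p * hyp_u p $ b * hyp_form y (axis b 1))"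
      by (rule sum.swap)
    finally show ?thesis
      unfolding hyp_form_expand[of "hyp_ru t" y] c sum_distrib_right by (rule sym)
  qed
  have sd: "Poly_Mapping.single k (\<Sum>p\<in>I. g p) = (\<Sum>p\<in>I. Poly_Mapping.single k (g p :: complex))" for k :: "'a osc multiset \<times> (int ^ 'a)" and I :: "'a set" and g
    by (rule poly_mapping_eqI) (auto simp: lookup_sum lookup_single when_def)
  consider "n < 0" | "n = 0" | "n > 0" by linarith
  then show "heis (hyp_ru t) n (Poly_Mapping.single (M, r) 1)
      = (\<Sum>p\<in>UNIV. cscale (of_int (t $ p)) (heis (hyp_u p) n (Poly_Mapping.single (M, r) 1)))"
  proof cases
    case 1
    show ?thesis
      unfolding heis_neg[OF 1] c fvec.scale_sum_right cscale_single
      by (subst sum.swap) (simp add: sd)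
  next
    case 2
    show ?thesis unfolding 2 heis_0 f cscale_single by (simp add: sd)
  next
    case 3
    show ?thesis
      unfolding heis_pos[OF 3] f fvec.scale_sum_right cscale_single
      by (subst sum.swap, rule sum.cong[OF refl])
        (simp add: sd[symmetric] sum_distrib_left sum_distrib_right mult_ac)
  qed
qed (rule linop_heis)

lemma u_current_expand: "u_current t r n w = (\<Sum>p\<in>UNIV. cscale (of_int (t $ p)) (u_current (axis p 1) r n w))"
proof -
  have f: "is_field (\<lambda>n w. cscale c (heis x n w))" for c and x :: "'a hyp"
    using is_field_scale[OF is_field_heis, of "\<lambda>_. c" x] .
  have "u_current t r n w = nop (\<lambda>n w. \<Sum>p\<in>UNIV. cscale (of_int (t $ p)) (heis (hyp_u p) n w)) (exp_field r) n w"
    unfolding u_current_def using heis_ru_expand by (metis (no_types, lifting) ext)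
  also have "\<dots> = (\<Sum>p\<in>UNIV. cscale (of_int (t $ p)) (u_current (axis p 1) r n w))"
    by (simp add: nop_sum_left f is_field_basic nop_scale_left u_current_def hyp_u_ru)
  finally show ?thesis .
qed

section \<open>The Virasoro field\<close>

text \<open>The modes \<open>\<omega>\<^sub>(\<^sub>n\<^sub>)\<close>, of degree \<open>n - 1\<close>\<close>

definition virasoro :: "'a::finite field" where
  "virasoro n w = (\<Sum>p\<in>UNIV. nop (heis (hyp_u p)) (heis (hyp_v p)) n w)"

lemma vertex_op_virasoro: "vertex_op omega = virasoro"
  by (intro ext) (simp add: vertex_op_omega virasoro_def)

lemma hfield_virasoro: "hfield (- 1) virasoro"
proof -
  have "hfield (- 1) (nop (heis (hyp_u p)) (heis (hyp_v p)))" for p :: 'a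
    by (rule hfield_nop[OF hfield_heis hfield_heis]) simp
  then show ?thesis
    unfolding hfield_def virasoro_def[abs_def] by (simp add: linop_sum_op homog_sum)
qed

lemmas is_field_virasoro = hfield_is_field[OF hfield_virasoro]

lemma nop_delta_right:
  assumes "is_field A"
  shows "nop A (\<lambda>n w. if n = k then cscale c w else 0) m w = cscale c (A (m - k - 1) w)"
proof -
  have "nop A (\<lambda>n w. if n = k then cscale c w else 0) m w
      = Sum_any (\<lambda>n. if n = m - k - 1 then cscale c (A (m - k - 1) w) else 0)"
    unfolding nop_nterm
    by (rule Sum_any.cong) (auto simp: nterm_def is_field_0[OF assms] is_field_cscale[OF assms])
  then show ?thesis by simp
qed

lemma heis_v_virasoro:
  "heis (hyp_v q) n (virasoro m w) = virasoro m (heis (hyp_v q) n w) + cscale (of_int n) (heis (hyp_v q) (m + n - 1) w)"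
proof -
  have "heis (hyp_v q) n (nop (heis (hyp_u p)) (heis (hyp_v p)) m w)
      = nop (heis (hyp_u p)) (heis (hyp_v p)) m (heis (hyp_v q) n w)
        + (if p = q then cscale (of_int n) (heis (hyp_v q) (m + n - 1) w) else 0)" for p
  proof -
    have "heis (hyp_v q) n (nop (heis (hyp_u p)) (heis (hyp_v p)) m w)
      = nop (heis (hyp_u p)) (heis (hyp_v p)) m (heis (hyp_v q) n w)
        + nop (\<lambda>l w. if l = - n then cscale (of_int (n * axis p 1 $ q)) w else 0) (heis (hyp_v p)) m w
        + nop (heis (hyp_u p)) (\<lambda>l w. 0) m w"
      by (rule nop_commutator)
        (simp_all only: is_field_heis is_field_delta is_field_zero linop_heis heis_v_ru hyp_u_ru heis_v_v add_0_right)
    then show ?thesis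
      by (simp add: nop_delta_left nop_zero_right is_field_heis axis_def)
  qed
  then show ?thesis
    by (simp add: virasoro_def heis_sum sum.distrib)
qed

lemma heis_ru_v: "heis (hyp_ru t) n (heis (hyp_v p) m w) = heis (hyp_v p) m (heis (hyp_ru t) n w)
    + (if m = - n then cscale (of_int (n * t $ p)) w else 0)"
  using heis_commutator[of "hyp_ru t" n "hyp_v p" m w]
  by (simp add: hyp_form_commute[of "hyp_ru t"] hyp_form_v_ru algebra_simps split: if_splits)

lemma heis_u_virasoro:
  "heis (hyp_u q) n (virasoro m w) = virasoro m (heis (hyp_u q) n w) + cscale (of_int n) (heis (hyp_u q) (m + n - 1) w)"
proof -
  have "heis (hyp_u q) n (nop (heis (hyp_u p)) (heis (hyp_v p)) m w)
      = nop (heis (hyp_u p)) (heis (hyp_v p)) m (heis (hyp_u q) n w)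
        + (if p = q then cscale (of_int n) (heis (hyp_u q) (m + n - 1) w) else 0)" for p
  proof -
    have "heis (hyp_u q) n (nop (heis (hyp_u p)) (heis (hyp_v p)) m w)
      = nop (heis (hyp_u p)) (heis (hyp_v p)) m (heis (hyp_u q) n w)
        + nop (\<lambda>l w. 0) (heis (hyp_v p)) m w
        + nop (heis (hyp_u p)) (\<lambda>l w. if l = - n then cscale (of_int (n * axis q 1 $ p)) w else 0) m w"
      by (rule nop_commutator)
        (simp_all only: is_field_heis is_field_delta is_field_zero linop_heis heis_ru_v hyp_u_ru heis_ru_commute[of "axis q 1" n "axis p 1"] add_0_right)
    then show ?thesis
      by (simp add: nop_delta_right nop_zero_left is_field_heis axis_def)
  qed
  then show ?thesis
    by (simp add: virasoro_def heis_sum sum.distrib)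
qed

text \<open>The correction that arises when the two normally ordered products in \<open>:\<omega>(z) Y(e\<^sup>s\<^sup>u, z):\<close> are rearranged\<close>

definition u_deriv_field :: "int ^ 'a::finite \<Rightarrow> 'a field" where
  "u_deriv_field s = nop (fderiv (heis (hyp_ru s))) (exp_field s)"

lemma is_field_fderiv_heis: "is_field (fderiv (heis x))"
  by (rule is_field_fderiv[OF is_field_heis])

lemma hfield_u_deriv: "hfield (- 1) (u_deriv_field s)"
  unfolding u_deriv_field_def by (rule hfield_nop[OF hfield_fderiv[OF hfield_heis] hfield_exp_field]) simp

lemma u_deriv_commutes:
  assumes "linop h" "\<And>n w. h (heis (hyp_ru s) n w) = heis (hyp_ru s) n (h w)" "\<And>n w. h (exp_field s n w) = exp_field s n (h w)"
  shows "h (u_deriv_field s m w) = u_deriv_field s m (h w)"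
  unfolding u_deriv_field_def
proof (rule nop_commutes[OF is_field_fderiv_heis is_field_exp_field assms(1)])
  show "h (fderiv (heis (hyp_ru s)) n w) = fderiv (heis (hyp_ru s)) n (h w)" for n w
    unfolding fderiv_def linop_cscale[OF assms(1)] by (rule arg_cong[OF assms(2)])
qed (rule assms(3))

lemma heis_v_u_deriv:
  "heis (hyp_v q) n (u_deriv_field s m w) = u_deriv_field s m (heis (hyp_v q) n w)
     + cscale (of_int (s $ q)) (u_deriv_field s (m + n) w)
     + cscale (of_int (n * (n - 1) * s $ q)) (exp_field s (m + n - 2) w)"
proof -
  have d: "heis (hyp_v q) n (fderiv (heis (hyp_ru s)) l w) = fderiv (heis (hyp_ru s)) l (heis (hyp_v q) n w)
      + (if l = 1 - n then cscale (of_int (n * (n - 1) * s $ q)) w else 0)" for l w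
  proof -
    have "l - 1 = - n \<longleftrightarrow> l = 1 - n" by auto
    moreover have "- of_int (1 - n) * of_int (n * s $ q) = (of_int (n * (n - 1) * s $ q) :: complex)"
      by (simp add: algebra_simps)
    ultimately show ?thesis
      unfolding fderiv_def heis_cscale heis_v_ru fvec.scale_right_distrib
      by (cases "l = 1 - n") (simp_all only: simp_thms if_True if_False fvec.scale_scale fvec.scale_zero_right)
  qed
  have "heis (hyp_v q) n (u_deriv_field s m w) = u_deriv_field s m (heis (hyp_v q) n w)
     + nop (\<lambda>l w. if l = 1 - n then cscale (of_int (n * (n - 1) * s $ q)) w else 0) (exp_field s) m w
     + nop (fderiv (heis (hyp_ru s))) (\<lambda>l w. cscale (of_int (s $ q)) (exp_field s (l + n) w)) m w"
    unfolding u_deriv_field_def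
    by (rule nop_commutator)
      (simp_all only: is_field_basic is_field_fderiv_heis is_field_delta is_field_shift_scale linop_heis d heis_v_exp_field)
  also have "nop (fderiv (heis (hyp_ru s))) (\<lambda>l w. cscale (of_int (s $ q)) (exp_field s (l + n) w)) m w
      = cscale (of_int (s $ q)) (u_deriv_field s (m + n) w)"
    by (simp add: nop_scale_shift_right is_field_fderiv_heis is_field_basic u_deriv_field_def)
  also have "nop (\<lambda>l w. if l = 1 - n then cscale (of_int (n * (n - 1) * s $ q)) w else 0) (exp_field s) m w
      = cscale (of_int (n * (n - 1) * s $ q)) (exp_field s (m + n - 2) w)"
    by (subst nop_delta_left[OF is_field_exp_field]) (simp add: algebra_simps)
  finally show ?thesis by (simp only: add_ac)
qed

lemma heis_v_nop_virasoro:
  "heis (hyp_v q) n (nop virasoro (exp_field s) m w) = nop virasoro (exp_field s) m (heis (hyp_v q) n w)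
     + cscale (of_int (s $ q)) (nop virasoro (exp_field s) (m + n) w)
     + (cscale (of_int n) (v_current q s (m + n - 1) w)
      + cscale (of_int (n * (n - 1) * s $ q)) (exp_field s (m + n - 2) w))"
proof -
  have "heis (hyp_v q) n (nop virasoro (exp_field s) m w) = nop virasoro (exp_field s) m (heis (hyp_v q) n w)
     + nop (\<lambda>l w. cscale (of_int n) (heis (hyp_v q) (l + (n - 1)) w)) (exp_field s) m w
     + nop virasoro (\<lambda>l w. cscale (of_int (s $ q)) (exp_field s (l + n) w)) m w"
    by (rule nop_commutator[OF is_field_virasoro is_field_exp_field is_field_shift_scale[OF is_field_heis]
          is_field_shift_scale[OF is_field_exp_field] linop_heis])
      (simp_all only: heis_v_virasoro heis_v_exp_field add_diff_eq)
  also have "nop virasoro (\<lambda>l w. cscale (of_int (s $ q)) (exp_field s (l + n) w)) m w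
      = cscale (of_int (s $ q)) (nop virasoro (exp_field s) (m + n) w)"
    by (simp add: nop_scale_shift_right is_field_virasoro is_field_basic)
  also have "nop (\<lambda>l w. cscale (of_int n) (heis (hyp_v q) (l + (n - 1)) w)) (exp_field s) m w
      = cscale (of_int n) (nop (\<lambda>l. heis (hyp_v q) (l + (n - 1))) (exp_field s) m w)"
    by (rule nop_scale_left[OF is_field_shift[OF is_field_heis] is_field_exp_field])
  also have "nop (\<lambda>l. heis (hyp_v q) (l + (n - 1))) (exp_field s) m w
      = v_current q s (m + n - 1) w + cscale (of_int (n - 1) * of_int (s $ q)) (exp_field s (m + n - 2) w)"
  proof -
    have "m + (n - 1) - 1 = m + n - 2" "m + (n - 1) = m + n - 1" by simp_all
    then show ?thesis
      using nop_shift_left[OF is_field_heis is_field_exp_field, of "hyp_v q" s "of_int (s $ q)" "exp_field s" "n - 1" m w]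
      by (simp only: heis_v_exp_field add.commute v_current_def simp_thms)
  qed
  finally show ?thesis
    by (simp only: fvec.scale_right_distrib fvec.scale_scale of_int_mult mult.assoc add_ac)
qed

lemma virasoro_exp_vec: "virasoro 0 (exp_vec q) = (\<Sum>p\<in>UNIV. cscale (of_int (q $ p)) (heis (hyp_u p) (- 1) (exp_vec q)))"
  "n \<ge> 1 \<Longrightarrow> virasoro n (exp_vec q) = 0"
proof -
  have v: "n \<ge> 1 \<Longrightarrow> heis (hyp_v p) n (exp_vec q) = 0" for p n by (simp add: heis_exp_vec)
  have u: "n \<ge> 0 \<Longrightarrow> heis (hyp_u p) n (exp_vec q) = 0" for p n by (simp add: hyp_u_ru heis_ru_exp_vec)
  show "virasoro 0 (exp_vec q) = (\<Sum>p\<in>UNIV. cscale (of_int (q $ p)) (heis (hyp_u p) (- 1) (exp_vec q)))"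
    unfolding virasoro_def
  proof (rule sum.cong[OF refl])
    fix p
    show "nop (heis (hyp_u p)) (heis (hyp_v p)) 0 (exp_vec q)
        = cscale (of_int (q $ p)) (heis (hyp_u p) (- 1) (exp_vec q))"
      using nop_creation[of "heis (hyp_u p)" "heis (hyp_v p)" "exp_vec q" 0 1]
      by (simp add: linop_heis u v heis_exp_vec(2) heis_cscale hyp_form_v_ru)
  qed
  show "virasoro n (exp_vec q) = 0" if "n \<ge> 1"
    unfolding virasoro_def
  proof (rule sum.neutral, rule ballI)
    fix p
    show "nop (heis (hyp_u p)) (heis (hyp_v p)) n (exp_vec q) = 0"
      using nop_creation[of "heis (hyp_u p)" "heis (hyp_v p)" "exp_vec q" n 0] that
      by (simp add: linop_heis u v)
  qed
qed

text \<open>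
  In this form the field is of first order in the \<open>v\<^sub>p\<close>, with coefficients in the commutative algebra of the
  fields above.
\<close>

theorem nop_virasoro_exp_field:
  fixes w :: "'a::finite fock"
  shows "nop virasoro (exp_field s) m w
    = (\<Sum>p\<in>UNIV. nop (heis (hyp_v p)) (u_current (axis p 1) s) m w) + u_deriv_field s m w"
proof (rule field_eqI[where A = "nop virasoro (exp_field s)"
      and B = "\<lambda>m w. (\<Sum>p\<in>UNIV. nop (heis (hyp_v p)) (u_current (axis p 1) s) m w) + u_deriv_field s m w"
      and c = "- 1" and s = s
      and C = "\<lambda>q n m w. cscale (of_int n) (u_current (axis q 1) s (m + n - 1) w)"
      and D = "\<lambda>q n m w. cscale (of_int n) (v_current q s (m + n - 1) w)
        + cscale (of_int (n * (n - 1) * s $ q)) (exp_field s (m + n - 2) w)"])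
  show "hfield (- 1) (nop virasoro (exp_field s) :: 'a field)"
    by (rule hfield_nop[OF hfield_virasoro hfield_exp_field]) simp
  have h: "hfield (- 1) (nop (heis (hyp_v p)) (u_current (axis p 1) s))" for p :: 'a
    by (rule hfield_nop[OF hfield_heis hfield_u_current]) simp
  show "hfield (- 1) (\<lambda>m w :: 'a fock. (\<Sum>p\<in>UNIV. nop (heis (hyp_v p)) (u_current (axis p 1) s) m w) + u_deriv_field s m w)"
    unfolding hfield_def
    by (intro allI conjI linop_plus linop_sum_op homog_plus homog_sum hfield_linop[OF h] hfield_linop[OF hfield_u_deriv]
       hfield_homog[OF h] hfield_homog[OF hfield_u_deriv])
next
  fix q :: 'a and n m and w :: "'a fock"
  have "heis (hyp_u q) n (nop virasoro (exp_field s) m w) = nop virasoro (exp_field s) m (heis (hyp_u q) n w)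
     + nop (\<lambda>l w. cscale (of_int n) (heis (hyp_u q) (l + (n - 1)) w)) (exp_field s) m w
     + nop virasoro (\<lambda>l w. 0) m w"
    by (rule nop_commutator[OF is_field_virasoro is_field_exp_field is_field_shift_scale[OF is_field_heis]
          is_field_zero linop_heis])
      (simp_all only: heis_u_virasoro heis_ru_exp_field[of "axis q 1", folded hyp_u_ru] add_diff_eq add_0_right)
  also have "nop (\<lambda>l w. cscale (of_int n) (heis (hyp_u q) (l + (n - 1)) w)) (exp_field s) m w
      = cscale (of_int n) (nop (\<lambda>l. heis (hyp_u q) (l + (n - 1))) (exp_field s) m w)"
    by (rule nop_scale_left[OF is_field_shift[OF is_field_heis] is_field_exp_field])
  also have "nop (\<lambda>l. heis (hyp_u q) (l + (n - 1))) (exp_field s) m w = u_current (axis q 1) s (m + n - 1) w"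
    unfolding hyp_u_ru nop_shift_left_commuting[OF is_field_heis is_field_exp_field heis_ru_exp_field] u_current_def
    by (simp add: add_diff_eq)
  finally show "heis (hyp_u q) n (nop virasoro (exp_field s) m w) = nop virasoro (exp_field s) m (heis (hyp_u q) n w)
      + cscale (of_int n) (u_current (axis q 1) s (m + n - 1) w)"
    by (simp add: nop_zero_right is_field_virasoro)
  have "heis (hyp_u q) n (nop (heis (hyp_v p)) (u_current (axis p 1) s) m w)
      = nop (heis (hyp_v p)) (u_current (axis p 1) s) m (heis (hyp_u q) n w)
        + (if p = q then cscale (of_int n) (u_current (axis q 1) s (m + n - 1) w) else 0)" for p
  proof -
    have "heis (hyp_u q) n (nop (heis (hyp_v p)) (u_current (axis p 1) s) m w)
      = nop (heis (hyp_v p)) (u_current (axis p 1) s) m (heis (hyp_u q) n w)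
      + nop (\<lambda>l w. if l = - n then cscale (of_int (n * axis q 1 $ p)) w else 0) (u_current (axis p 1) s) m w
      + nop (heis (hyp_v p)) (\<lambda>l w. 0) m w"
      by (rule nop_commutator)
        (simp_all only: is_field_basic is_field_delta is_field_zero linop_heis heis_ru_v hyp_u_ru[of q] heis_ru_u_current add_0_right)
    then show ?thesis
      by (simp add: nop_delta_left nop_zero_right is_field_basic axis_def)
  qed
  moreover have "heis (hyp_u q) n (u_deriv_field s m w) = u_deriv_field s m (heis (hyp_u q) n w)"
    by (rule u_deriv_commutes) (simp_all only: hyp_u_ru linop_heis heis_ru_commute[of "axis q 1" n s] heis_ru_exp_field)
  ultimately show "heis (hyp_u q) n ((\<Sum>p\<in>UNIV. nop (heis (hyp_v p)) (u_current (axis p 1) s) m w) + u_deriv_field s m w)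
      = (\<Sum>p\<in>UNIV. nop (heis (hyp_v p)) (u_current (axis p 1) s) m (heis (hyp_u q) n w))
        + u_deriv_field s m (heis (hyp_u q) n w) + cscale (of_int n) (u_current (axis q 1) s (m + n - 1) w)"
    by (simp add: heis_add heis_sum sum.distrib)
  show "heis (hyp_v q) n (nop virasoro (exp_field s) m w) = nop virasoro (exp_field s) m (heis (hyp_v q) n w)
     + cscale (of_int (s $ q)) (nop virasoro (exp_field s) (m + n) w)
     + (cscale (of_int n) (v_current q s (m + n - 1) w)
      + cscale (of_int (n * (n - 1) * s $ q)) (exp_field s (m + n - 2) w))"
    by (rule heis_v_nop_virasoro)
  have "heis (hyp_v q) n (nop (heis (hyp_v p)) (u_current (axis p 1) s) m w)
      = nop (heis (hyp_v p)) (u_current (axis p 1) s) m (heis (hyp_v q) n w)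
      + cscale (of_int (s $ q)) (nop (heis (hyp_v p)) (u_current (axis p 1) s) (m + n) w)
      + (if p = q then cscale (of_int n) (v_current q s (m + n - 1) w) else 0)" for p
  proof -
    have "heis (hyp_v q) n (nop (heis (hyp_v p)) (u_current (axis p 1) s) m w)
      = nop (heis (hyp_v p)) (u_current (axis p 1) s) m (heis (hyp_v q) n w)
      + nop (\<lambda>l w. 0) (u_current (axis p 1) s) m w
      + nop (heis (hyp_v p)) (\<lambda>l w. cscale (of_int (s $ q)) (u_current (axis p 1) s (l + n) w)
           + cscale (of_int (n * axis p 1 $ q)) (exp_field s (l + (n - 1)) w)) m w"
      by (rule nop_commutator[OF is_field_heis is_field_u_current is_field_zero
            is_field_plus[OF is_field_shift_scale[OF is_field_u_current] is_field_shift_scale[OF is_field_exp_field]] linop_heis])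
        (simp_all only: heis_v_v heis_v_u_current add_diff_eq add.assoc add_0_right)
    also have "nop (heis (hyp_v p)) (\<lambda>l w. cscale (of_int (s $ q)) (u_current (axis p 1) s (l + n) w)
           + cscale (of_int (n * axis p 1 $ q)) (exp_field s (l + (n - 1)) w)) m w
      = cscale (of_int (s $ q)) (nop (heis (hyp_v p)) (u_current (axis p 1) s) (m + n) w)
        + cscale (of_int (n * axis p 1 $ q)) (v_current p s (m + n - 1) w)"
      unfolding nop_plus_right[OF is_field_heis is_field_shift_scale[OF is_field_u_current] is_field_shift_scale[OF is_field_exp_field]]
        nop_scale_shift_right[OF is_field_heis is_field_u_current]
        nop_scale_shift_right[OF is_field_heis is_field_exp_field] v_current_def
      by (simp only: add_diff_eq)
    finally show ?thesis
      by (simp add: nop_zero_left is_field_basic axis_def)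
  qed
  then have "heis (hyp_v q) n (\<Sum>p\<in>UNIV. nop (heis (hyp_v p)) (u_current (axis p 1) s) m w)
     = (\<Sum>p\<in>UNIV. nop (heis (hyp_v p)) (u_current (axis p 1) s) m (heis (hyp_v q) n w))
      + cscale (of_int (s $ q)) (\<Sum>p\<in>UNIV. nop (heis (hyp_v p)) (u_current (axis p 1) s) (m + n) w)
      + cscale (of_int n) (v_current q s (m + n - 1) w)"
    by (simp add: heis_sum sum.distrib fvec.scale_sum_right)
  then show "heis (hyp_v q) n ((\<Sum>p\<in>UNIV. nop (heis (hyp_v p)) (u_current (axis p 1) s) m w) + u_deriv_field s m w)
     = (\<Sum>p\<in>UNIV. nop (heis (hyp_v p)) (u_current (axis p 1) s) m (heis (hyp_v q) n w))
        + u_deriv_field s m (heis (hyp_v q) n w)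
      + cscale (of_int (s $ q)) ((\<Sum>p\<in>UNIV. nop (heis (hyp_v p)) (u_current (axis p 1) s) (m + n) w) + u_deriv_field s (m + n) w)
      + (cscale (of_int n) (v_current q s (m + n - 1) w)
      + cscale (of_int (n * (n - 1) * s $ q)) (exp_field s (m + n - 2) w))"
    by (simp only: heis_add heis_v_u_deriv fvec.scale_right_distrib add_ac)
next
  fix q :: "int ^ 'a"
  have v: "n \<ge> 1 \<Longrightarrow> heis (hyp_v p) n (exp_vec q) = 0" for p and n :: int by (simp add: heis_exp_vec)
  \<comment> \<open>\<open>\<omega>\<^sub>(\<^sub>0\<^sub>) e\<^sup>q\<^sup>u\<close> is nonzero, but a combination of the \<open>u\<^sub>p(-1) e\<^sup>q\<^sup>u\<close>\<close>
  have "exp_field s 0 (virasoro 0 (exp_vec q)) = 0"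
    by (simp add: virasoro_exp_vec linop_sum[OF linop_exp_field] linop_cscale[OF linop_exp_field] hyp_u_ru
        heis_ru_exp_field[symmetric] exp_field_exp_vec)
  then have "nterm virasoro (exp_field s) 1 (exp_vec q) n = 0" for n
    by (cases "n = 0") (auto simp: nterm_def exp_field_exp_vec virasoro_exp_vec is_field_0[OF is_field_virasoro] linop_0[OF linop_exp_field])
  then have 1: "nop virasoro (exp_field s) 1 (exp_vec q) = 0" by (simp add: nop_nterm)
  have "nterm (heis (hyp_v p)) (u_current (axis p 1) s) 1 (exp_vec q) n = 0" for n p
    by (cases "n = 0") (auto simp: nterm_def u_current_exp_vec heis_exp_vec(2) v linop_cscale[OF linop_u_current] linop_0[OF linop_u_current])
  then have 2: "nop (heis (hyp_v p)) (u_current (axis p 1) s) 1 (exp_vec q) = 0" for p by (simp add: nop_nterm)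
  have "nterm (fderiv (heis (hyp_ru s))) (exp_field s) 1 (exp_vec q) n = 0" for n
    by (cases "n = 0") (auto simp: nterm_def fderiv_def exp_field_exp_vec heis_ru_exp_vec linop_0[OF linop_exp_field])
  then have 3: "u_deriv_field s 1 (exp_vec q) = 0" by (simp add: nop_nterm u_deriv_field_def)
  show "nop virasoro (exp_field s) (- (- 1)) (exp_vec q)
    = (\<Sum>p\<in>UNIV. nop (heis (hyp_v p)) (u_current (axis p 1) s) (- (- 1)) (exp_vec q)) + u_deriv_field s (- (- 1)) (exp_vec q)"
    by (simp add: 1 2 3)
qed

section \<open>Commutators of the fields of the generators\<close>

text \<open>
  The weight \<open>n\<close> is \<open>(n + i) - i\<close>, and multiplication of the modes by \<open>n + i\<close> is a derivative of
  \<open>Y(e\<^sup>r\<^sup>u, z)\<close>.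
\<close>

lemma nop_weighted:
  assumes B: "is_field B" and E: "\<And>n k w. exp_field r n (B k w) = B k (exp_field r n w)"
    and U: "\<And>n k w. u_current r r n (B k w) = B k (u_current r r n w)"
  shows "nop (\<lambda>n w. cscale (of_int n) (exp_field r (n + (i - 1)) w)) B j w
     = - nop (u_current r r) B (j + i) w - cscale (of_int i) (nop (exp_field r) B (j + (i - 1)) w)"
proof -
  have "(\<lambda>n w. cscale (of_int n) (exp_field r (n + (i - 1)) w))
      = (\<lambda>n w. cscale (- 1) (u_current r r (n + i) w) + cscale (- of_int i) (exp_field r (n + (i - 1)) w))"
    by (intro ext poly_mapping_eqI) (simp add: exp_field_deriv lookup_add algebra_simps)
  then show ?thesis
    by (simp only: nop_plus_left is_field_shift_scale is_field_basic B nop_scale_shift_left E U) simp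
qed

lemma exp_field_nop_v:
  assumes B: "is_field B" and E: "\<And>n k w. exp_field r n (B k w) = B k (exp_field r n w)"
  shows "exp_field r l (nop (heis (hyp_v a)) B j w) = nop (heis (hyp_v a)) B j (exp_field r l w)
     - cscale (of_int (r $ a)) (nop (exp_field r) B (j + l) w)"
proof -
  have "exp_field r l (nop (heis (hyp_v a)) B j w) = nop (heis (hyp_v a)) B j (exp_field r l w)
     + nop (\<lambda>n w. cscale (- of_int (r $ a)) (exp_field r (n + l) w)) B j w + nop (heis (hyp_v a)) (\<lambda>n w. 0) j w"
    by (rule nop_commutator[OF is_field_heis B is_field_shift_scale[OF is_field_exp_field] is_field_zero linop_exp_field])
      (simp_all add: heis_v_exp_field E add.commute)
  then show ?thesis
    by (simp only: nop_scale_shift_left is_field_basic B E nop_zero_right) simp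
qed

lemma u_current_nop_v:
  assumes B: "is_field B" and E: "\<And>n k w. exp_field r n (B k w) = B k (exp_field r n w)"
    and U: "\<And>t n k w. u_current t r n (B k w) = B k (u_current t r n w)"
  shows "u_current t r i (nop (heis (hyp_v a)) B j w) = nop (heis (hyp_v a)) B j (u_current t r i w)
     - cscale (of_int (r $ a)) (nop (u_current t r) B (j + i) w)
     + cscale (of_int (t $ a)) (nop (u_current r r) B (j + i) w + cscale (of_int i) (nop (exp_field r) B (j + (i - 1)) w))"
proof -
  let ?A1 = "\<lambda>n w. cscale (- of_int (r $ a)) (u_current t r (n + i) w)"
  let ?A2 = "\<lambda>n w. cscale (of_int n) (exp_field r (n + (i - 1)) w)"
  have f1: "is_field ?A1" by (rule is_field_shift_scale[OF is_field_u_current])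
  have f2: "is_field ?A2" by (rule is_field_scale[OF is_field_shift[OF is_field_exp_field]])
  have f3: "is_field (\<lambda>n w. cscale (- of_int (t $ a)) (?A2 n w))"
    using is_field_scale[OF f2, of "\<lambda>_. - of_int (t $ a)"] .
  have "u_current t r i (nop (heis (hyp_v a)) B j w) = nop (heis (hyp_v a)) B j (u_current t r i w)
     + nop (\<lambda>n w. ?A1 n w + cscale (- of_int (t $ a)) (?A2 n w)) B j w + nop (heis (hyp_v a)) (\<lambda>n w. 0) j w"
  proof (rule nop_commutator[OF is_field_heis B is_field_plus[OF f1 f3] is_field_zero linop_u_current])
    fix n w
    show "u_current t r i (heis (hyp_v a) n w) = heis (hyp_v a) n (u_current t r i w)
        + (?A1 n w + cscale (- of_int (t $ a)) (?A2 n w))"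
      unfolding heis_v_u_current
      by (rule poly_mapping_eqI) (simp add: lookup_add algebra_simps)
  qed (simp add: U)
  also have "nop (\<lambda>n w. ?A1 n w + cscale (- of_int (t $ a)) (?A2 n w)) B j w
      = nop ?A1 B j w + cscale (- of_int (t $ a)) (nop ?A2 B j w)"
    by (simp only: nop_plus_left[OF f1 f3 B] nop_scale_left[OF f2 B])
  also have "nop ?A2 B j w = - nop (u_current r r) B (j + i) w - cscale (of_int i) (nop (exp_field r) B (j + (i - 1)) w)"
    by (rule nop_weighted[OF B E U])
  also have "nop ?A1 B j w = cscale (- of_int (r $ a)) (nop (u_current t r) B (j + i) w)"
    by (rule nop_scale_shift_left[OF is_field_u_current B U])
  finally show ?thesis
    by (simp add: nop_zero_right is_field_heis fvec.scale_right_distrib fvec.scale_right_diff_distrib)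
qed

lemma u_current_add: "u_current (s + t) r n w = u_current s r n w + u_current t r n w"
  unfolding u_current_expand[of "s + t"] u_current_expand[of s] u_current_expand[of t]
  by (simp add: fvec.scale_left_distrib sum.distrib)

lemma nop_u_expand:
  assumes "is_field A"
  shows "nop A (u_current t s) m w = (\<Sum>p\<in>UNIV. cscale (of_int (t $ p)) (nop A (u_current (axis p 1) s) m w))"
proof -
  have f: "is_field (\<lambda>n w. cscale c (u_current x s n w))" for c and x
    using is_field_scale[OF is_field_u_current, of "\<lambda>_. c" x s] .
  have "u_current t s = (\<lambda>n w. \<Sum>p\<in>UNIV. cscale (of_int (t $ p)) (u_current (axis p 1) s n w))"
    by (intro ext) (rule u_current_expand)
  then have "nop A (u_current t s) m w
      = nop A (\<lambda>n w. \<Sum>p\<in>UNIV. cscale (of_int (t $ p)) (u_current (axis p 1) s n w)) m w" by simp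
  also have "\<dots> = (\<Sum>p\<in>UNIV. cscale (of_int (t $ p)) (nop A (u_current (axis p 1) s) m w))"
    by (simp add: nop_sum_right f assms nop_scale_right is_field_basic)
  finally show ?thesis .
qed

lemma v_current_exp_field:
  "v_current a s j (exp_field r l w) = exp_field r l (v_current a s j w) + cscale (of_int (r $ a)) (exp_field (r + s) (j + l) w)"
  using exp_field_nop_v[OF is_field_exp_field exp_field_commute, of r l a s j w]
  by (simp add: v_current_def nop_exp_exp)

lemma v_current_u_current:
  "v_current a s j (u_current t r i w) = u_current t r i (v_current a s j w)
    + cscale (of_int (r $ a)) (u_current t (r + s) (i + j) w)
    + cscale (of_int (t $ a)) (cscale (of_int j) (exp_field (r + s) (i + j - 1) w) + u_current s (r + s) (i + j) w)"
proof -
  let ?E = "exp_field (r + s) (i + j - 1) w"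
  have d: "u_current r (r + s) (i + j) w = cscale (- of_int (i + j)) ?E - u_current s (r + s) (i + j) w"
    using exp_field_deriv[of "r + s" "i + j" w] u_current_add[of r s "r + s" "i + j" w] by (simp add: algebra_simps)
  have "u_current t r i (v_current a s j w) = v_current a s j (u_current t r i w)
     - cscale (of_int (r $ a)) (u_current t (r + s) (j + i) w)
     + cscale (of_int (t $ a)) (u_current r (r + s) (j + i) w + cscale (of_int i) (exp_field (r + s) (j + (i - 1)) w))"
    using u_current_nop_v[of "exp_field s" r t i a j w]
    by (simp add: is_field_basic exp_field_commute[of r _ s] exp_field_u_current[symmetric] v_current_def nop_u_exp nop_exp_exp)
  moreover have "j + i = i + j" "j + (i - 1) = i + j - 1" by simp_all
  ultimately show ?thesis
    by (simp only: d) (rule poly_mapping_eqI, simp add: lookup_add lookup_minus algebra_simps)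
qed

text \<open>The operator by which \<open>t\<^sub>0\<^sup>j t\<^sup>s d\<^sub>0\<close> acts\<close>

definition time_op :: "int \<Rightarrow> int ^ 'a::finite \<Rightarrow> 'a fock \<Rightarrow> 'a fock" where
  "time_op j s w = cscale (of_int j + 1) (exp_field s (j - 1) w) - nop virasoro (exp_field s) (j + 1) w"

lemma linop_nop_virasoro: "linop (nop virasoro (exp_field s) m)"
  by (rule linop_nop[OF is_field_virasoro is_field_exp_field])

lemma linop_time_op: "linop (time_op j s)"
proof -
  have "linop (\<lambda>w. cscale (of_int j + 1) (exp_field s (j - 1) w) - nop virasoro (exp_field s) (j + 1) w)"
    by (intro linop_minus2 linop_scale linop_exp_field linop_nop_virasoro)
  then show ?thesis by (simp only: time_op_def[abs_def])
qed

lemma homog_time_op: "homog j (time_op j s)"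
proof -
  have "homog (j + 1 + - 1) (nop virasoro (exp_field s) (j + 1))"
    by (rule hfield_homog[OF hfield_nop[OF hfield_virasoro hfield_exp_field]]) simp
  moreover have "homog (j - 1 + 1) (exp_field s (j - 1))" by (rule hfield_homog[OF hfield_exp_field])
  ultimately have "homog j (\<lambda>w. cscale (of_int j + 1) (exp_field s (j - 1) w) - nop virasoro (exp_field s) (j + 1) w)"
    by (intro homog_minus2 homog_scale) simp_all
  then show ?thesis by (simp only: time_op_def[abs_def])
qed

lemma time_op_exp_field:
  "time_op j s (exp_field r l w) = exp_field r l (time_op j s w) - u_current r (r + s) (j + l + 1) w"
proof -
  have "exp_field r l (nop virasoro (exp_field s) (j + 1) w) = nop virasoro (exp_field s) (j + 1) (exp_field r l w)
      - u_current r (r + s) (j + 1 + l) w"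
  proof -
    have "exp_field r l (nop (heis (hyp_v p)) (u_current (axis p 1) s) (j + 1) w)
        = nop (heis (hyp_v p)) (u_current (axis p 1) s) (j + 1) (exp_field r l w)
          - cscale (of_int (r $ p)) (u_current (axis p 1) (r + s) (j + 1 + l) w)" for p
      using exp_field_nop_v[OF is_field_u_current exp_field_u_current, of r l p "axis p 1" s "j + 1" w]
      by (simp only: nop_exp_u)
    moreover have "exp_field r l (u_deriv_field s (j + 1) w) = u_deriv_field s (j + 1) (exp_field r l w)"
      by (rule u_deriv_commutes[OF linop_exp_field heis_ru_exp_field[symmetric] exp_field_commute])
    ultimately show ?thesis
      unfolding nop_virasoro_exp_field linop_add[OF linop_exp_field] linop_sum[OF linop_exp_field]
      by (simp add: sum_subtractf u_current_expand[of r])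
  qed
  moreover have "j + 1 + l = j + l + 1" by simp
  ultimately show ?thesis
    unfolding time_op_def linop_diff[OF linop_exp_field] linop_cscale[OF linop_exp_field] exp_field_commute[of s _ r]
    by simp
qed

lemma time_op_u_current:
  "time_op j s (u_current t r i w) = u_current t r i (time_op j s w) + cscale (of_int i) (u_current t (r + s) (i + j) w)"
proof -
  have "u_current t r i (nop virasoro (exp_field s) (j + 1) w) = nop virasoro (exp_field s) (j + 1) (u_current t r i w)
      + cscale (of_int i) (u_current t (r + s) (j + i) w)"
  proof -
    have "u_current t r i (nop (heis (hyp_v p)) (u_current (axis p 1) s) (j + 1) w)
        = nop (heis (hyp_v p)) (u_current (axis p 1) s) (j + 1) (u_current t r i w)
          - cscale (of_int (r $ p)) (nop (u_current t r) (u_current (axis p 1) s) (j + 1 + i) w)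
          + (cscale (of_int (t $ p)) (nop (u_current r r) (u_current (axis p 1) s) (j + 1 + i) w)
           + cscale (of_int i) (cscale (of_int (t $ p)) (u_current (axis p 1) (r + s) (j + 1 + (i - 1)) w)))" for p
      using u_current_nop_v[of "u_current (axis p 1) s" r t i p "j + 1" w]
      by (simp add: is_field_basic exp_field_u_current u_current_commute[of _ r _ "axis p 1"] nop_exp_u fvec.scale_right_distrib mult.commute)
    moreover have "u_current t r i (u_deriv_field s (j + 1) w) = u_deriv_field s (j + 1) (u_current t r i w)"
      by (rule u_deriv_commutes[OF linop_u_current heis_ru_u_current[symmetric] exp_field_u_current[symmetric]])
    ultimately have "u_current t r i (nop virasoro (exp_field s) (j + 1) w) = nop virasoro (exp_field s) (j + 1) (u_current t r i w)
        - nop (u_current t r) (u_current r s) (j + 1 + i) w + nop (u_current r r) (u_current t s) (j + 1 + i) w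
        + cscale (of_int i) (u_current t (r + s) (j + 1 + (i - 1)) w)"
      unfolding nop_virasoro_exp_field linop_add[OF linop_u_current] linop_sum[OF linop_u_current]
        nop_u_expand[OF is_field_u_current, of t r r] nop_u_expand[OF is_field_u_current, of r r t] u_current_expand[of t "r + s"]
      by (simp add: sum_subtractf sum.distrib fvec.scale_sum_right)
    then show ?thesis using nop_u_u_swap[of t r r s "j + 1 + i" w] by simp
  qed
  moreover have "j + i = i + j" by simp
  ultimately show ?thesis
    unfolding time_op_def linop_diff[OF linop_u_current] linop_cscale[OF linop_u_current] exp_field_u_current
    by simp
qed

lemma heis_v_time_op:
  "heis (hyp_v q) n (time_op j s w) = time_op j s (heis (hyp_v q) n w) + cscale (of_int (s $ q)) (time_op (j + n) s w)
    - cscale (of_int n) (v_current q s (j + n) w) - cscale (of_int (n * n * s $ q)) (exp_field s (j + n - 1) w)"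
proof -
  have e: "j + 1 + n = j + n + 1" "j + 1 + n - 1 = j + n" "j + 1 + n - 2 = j + n - 1" "j - 1 + n = j + n - 1"
    by simp_all
  show ?thesis
    unfolding time_op_def linop_diff[OF linop_heis] heis_cscale heis_v_nop_virasoro heis_v_exp_field e
    by (rule poly_mapping_eqI) (simp add: lookup_add lookup_minus algebra_simps)
qed

section \<open>The operators of the module and their commutators\<close>

lemma sum_option: "(\<Sum>a\<in>UNIV. F a) = F None + (\<Sum>p\<in>UNIV. F (Some p))" for F :: "'a::finite option \<Rightarrow> 'b::comm_monoid_add"
  by (simp add: UNIV_option_conv sum.reindex)

text \<open>The exponents of \<open>t\<^sub>1, \<dots>, t\<^sub>N\<close>\<close>

definition spatial :: "'a::finite expo \<Rightarrow> int ^ 'a" where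
  "spatial m = (\<chi> p. m $ Some p)"

lemma spatial_nth [simp]: "spatial m $ p = m $ Some p"
  by (simp add: spatial_def)

lemma spatial_add: "spatial (m + l) = spatial m + spatial l"
  by (simp add: vec_eq_iff)

lemma spatial_axis [simp]: "spatial (axis None n) = 0"
  by (simp add: vec_eq_iff axis_def)

lemma mk_expo_nth [simp]: "mk_expo j r $ None = j" "mk_expo j r $ Some p = r $ p"
  by (simp_all add: mk_expo_def)

lemma spatial_mk_expo [simp]: "spatial (mk_expo j r) = r"
  by (simp add: vec_eq_iff)

text \<open>
  The operators by which \<open>t\<^sup>m d\<^sub>a\<close> and \<open>t\<^sup>m k\<^sub>a\<close> act, where index \<^term>\<open>None\<close> stands for 0.
  The first one is defined for all of \<open>\<D>\<close>, although the relations of the Lie algebra hold on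
  \<open>\<D>\<^sub>d\<^sub>i\<^sub>v\<close> only.
\<close>

definition vf_op :: "'a::finite expo \<Rightarrow> 'a option \<Rightarrow> 'a fock \<Rightarrow> 'a fock" where
  "vf_op m a = (case a of None \<Rightarrow> time_op (m $ None) (spatial m) | Some p \<Rightarrow> v_current p (spatial m) (m $ None))"

definition form_op :: "'a::finite expo \<Rightarrow> 'a option \<Rightarrow> 'a fock \<Rightarrow> 'a fock" where
  "form_op m a = (case a of None \<Rightarrow> exp_field (spatial m) (m $ None - 1)
     | Some p \<Rightarrow> u_current (axis p 1) (spatial m) (m $ None))"

lemma vf_op_simps [simp]: "vf_op m None = time_op (m $ None) (spatial m)" "vf_op m (Some p) = v_current p (spatial m) (m $ None)"
  and form_op_simps [simp]: "form_op m None = exp_field (spatial m) (m $ None - 1)"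
    "form_op m (Some p) = u_current (axis p 1) (spatial m) (m $ None)"
  by (simp_all add: vf_op_def form_op_def)

lemma linop_vf_op: "linop (vf_op m a)" and linop_form_op: "linop (form_op m a)"
  by (cases a; simp add: linop_basic linop_time_op)+

lemma homog_vf_op: "homog (m $ None) (vf_op m a)"
  using hfield_homog[OF hfield_v_current, of "m $ None"] by (cases a) (simp_all add: homog_time_op)

lemma homog_form_op: "homog (m $ None) (form_op m a)"
  using hfield_homog[OF hfield_u_current, of "m $ None"] hfield_homog[OF hfield_exp_field, of "m $ None - 1"]
  by (cases a) simp_all

text \<open>The action of \<open>\<Sum>\<^sub>a f\<^sub>a t\<^sup>m d\<^sub>a\<close> and of \<open>\<Sum>\<^sub>a f\<^sub>a t\<^sup>m k\<^sub>a\<close>, and the pairing \<open>\<Sum>\<^sub>a m\<^sub>a f\<^sub>a\<close>\<close>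

definition vf_comb :: "'a::finite expo \<Rightarrow> ('a option \<Rightarrow> complex) \<Rightarrow> 'a fock \<Rightarrow> 'a fock" where
  "vf_comb m f w = (\<Sum>a\<in>UNIV. cscale (f a) (vf_op m a w))"

definition form_comb :: "'a::finite expo \<Rightarrow> ('a option \<Rightarrow> complex) \<Rightarrow> 'a fock \<Rightarrow> 'a fock" where
  "form_comb m f w = (\<Sum>a\<in>UNIV. cscale (f a) (form_op m a w))"

definition pairing :: "'a::finite expo \<Rightarrow> ('a option \<Rightarrow> complex) \<Rightarrow> complex" where
  "pairing m f = (\<Sum>a\<in>UNIV. of_int (m $ a) * f a)"

abbreviation coords :: "'a::finite expo \<Rightarrow> 'a option \<Rightarrow> complex" where
  "coords m \<equiv> \<lambda>a. of_int (m $ a)"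

lemma pairing_option: "pairing m f = of_int (m $ None) * f None + (\<Sum>p\<in>UNIV. of_int (m $ Some p) * f (Some p))"
  by (simp add: pairing_def sum_option)

lemma linop_vf_comb: "linop (vf_comb m f)" and linop_form_comb: "linop (form_comb m f)"
  unfolding vf_comb_def[abs_def] form_comb_def[abs_def]
  by (intro linop_sum_op linop_scale linop_vf_op linop_form_op)+

lemma homog_vf_comb: "homog (m $ None) (vf_comb m f)" and homog_form_comb: "homog (m $ None) (form_comb m f)"
  unfolding vf_comb_def[abs_def] form_comb_def[abs_def]
  by (intro homog_sum homog_scale homog_vf_op homog_form_op)+

lemma vf_comb_linear:
  "vf_comb m (\<lambda>a. f a + g a) w = vf_comb m f w + vf_comb m g w"
  "vf_comb m (\<lambda>a. f a - g a) w = vf_comb m f w - vf_comb m g w"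
  "vf_comb m (\<lambda>a. c * f a) w = cscale c (vf_comb m f w)"
  by (simp_all add: vf_comb_def fvec.scale_left_distrib fvec.scale_left_diff_distrib sum.distrib sum_subtractf
      fvec.scale_sum_right)

lemma form_comb_linear:
  "form_comb m (\<lambda>a. f a + g a) w = form_comb m f w + form_comb m g w"
  "form_comb m (\<lambda>a. f a - g a) w = form_comb m f w - form_comb m g w"
  "form_comb m (\<lambda>a. c * f a) w = cscale c (form_comb m f w)"
  by (simp_all add: form_comb_def fvec.scale_left_distrib fvec.scale_left_diff_distrib sum.distrib sum_subtractf
      fvec.scale_sum_right)

lemma vf_comb_delta: "vf_comb m (\<lambda>a. if a = b then c else 0) w = cscale c (vf_op m b w)"
  and form_comb_delta: "form_comb m (\<lambda>a. if a = b then c else 0) w = cscale c (form_op m b w)"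
proof -
  have "cscale (if a = b then c else 0) v = (if a = b then cscale c v else 0)" for a and v :: "'a fock" by simp
  then show "vf_comb m (\<lambda>a. if a = b then c else 0) w = cscale c (vf_op m b w)"
    "form_comb m (\<lambda>a. if a = b then c else 0) w = cscale c (form_op m b w)"
    unfolding vf_comb_def form_comb_def by simp_all
qed

text \<open>Exact forms act by zero.\<close>

lemma form_comb_exact: "form_comb m (coords m) w = 0"
proof -
  have "(\<Sum>p\<in>UNIV. cscale (of_int (m $ Some p)) (u_current (axis p 1) (spatial m) (m $ None) w))
      = u_current (spatial m) (spatial m) (m $ None) w"
    unfolding u_current_expand[of "spatial m"] by simp
  then show ?thesis
    by (simp add: form_comb_def sum_option exp_field_deriv)
qed

lemma form_op_commute: "form_op m a (form_op l b w) = form_op l b (form_op m a w)"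
  by (cases a; cases b)
    (simp_all add: exp_field_commute[of "spatial m" _ "spatial l"] exp_field_u_current
      u_current_commute[of _ "spatial m" _ _ "spatial l"])

lemma form_comb_commute: "form_op k c (form_comb m f w) = form_comb m f (form_op k c w)"
  unfolding form_comb_def linop_sum[OF linop_form_op] linop_cscale[OF linop_form_op] form_op_commute[of k c m] ..

text \<open>The bracket \<open>[t\<^sup>m d\<^sub>a, t\<^sup>l k\<^sub>b]\<close>; it holds on all of \<open>\<D>\<close>.\<close>

lemma vf_op_form_op:
  "vf_op m a (form_op l b w) = form_op l b (vf_op m a w) + cscale (of_int (l $ a)) (form_op (m + l) b w)
     + (if a = b then form_comb (m + l) (coords m) w else 0)"
proof -
  have add: "spatial l + spatial m = spatial (m + l)" by (simp add: spatial_add add.commute)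
  show ?thesis
  proof (cases a)
    case a: None
    show ?thesis
    proof (cases b)
      case None
      have "form_comb (m + l) (coords m) w
          = cscale (of_int (m $ None)) (exp_field (spatial (m + l)) (m $ None + l $ None - 1) w)
            + u_current (spatial m) (spatial (m + l)) (m $ None + l $ None) w"
        unfolding form_comb_def sum_option u_current_expand[of "spatial m"] by simp
      moreover have "u_current (spatial l) (spatial (m + l)) (m $ None + l $ None) w
          = cscale (- of_int (m $ None + l $ None)) (exp_field (spatial (m + l)) (m $ None + l $ None - 1) w)
          - u_current (spatial m) (spatial (m + l)) (m $ None + l $ None) w"
        using exp_field_deriv[of "spatial (m + l)" "m $ None + l $ None" w]
          u_current_add[of "spatial l" "spatial m" "spatial (m + l)" "m $ None + l $ None" w, unfolded add]
        by (simp add: eq_diff_eq)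
      moreover have "m $ None + (l $ None - 1) + 1 = m $ None + l $ None" by simp
      moreover have "m $ None + (l $ None - 1) = m $ None + l $ None - 1" "(m + l) $ None - 1 = m $ None + l $ None - 1" by simp_all
      ultimately show ?thesis
        unfolding a None vf_op_simps form_op_simps time_op_exp_field add
        by (simp only:) (rule poly_mapping_eqI, simp add: lookup_add lookup_minus algebra_simps)
    next
      case (Some p)
      then show ?thesis
        unfolding a Some vf_op_simps form_op_simps time_op_u_current add by (simp add: add.commute)
    qed
  next
    case a: (Some p)
    show ?thesis
    proof (cases b)
      case None
      show ?thesis
        unfolding a None vf_op_simps form_op_simps v_current_exp_field add by (simp add: add_diff_eq)
    next
      case (Some q)
      have "form_comb (m + l) (coords m) w
          = cscale (of_int (m $ None)) (exp_field (spatial (m + l)) (l $ None + m $ None - 1) w)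
            + u_current (spatial m) (spatial (m + l)) (l $ None + m $ None) w"
        unfolding form_comb_def sum_option u_current_expand[of "spatial m"] by (simp add: add.commute)
      then show ?thesis
        unfolding a Some vf_op_simps form_op_simps v_current_u_current add
        by (simp add: axis_def add.commute)
    qed
  qed
qed

lemma vf_comb_form_op:
  "vf_comb m f (form_op l b w) = form_op l b (vf_comb m f w) + cscale (pairing l f) (form_op (m + l) b w)
     + cscale (f b) (form_comb (m + l) (coords m) w)"
proof -
  have "cscale (f a) (if a = b then v else 0) = (if a = b then cscale (f b) v else 0)" for a and v :: "'a fock" by simp
  then have "vf_comb m f (form_op l b w) = (\<Sum>a\<in>UNIV. cscale (f a) (form_op l b (vf_op m a w)))
     + (\<Sum>a\<in>UNIV. cscale (of_int (l $ a) * f a) (form_op (m + l) b w))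
     + (\<Sum>a\<in>UNIV. if a = b then cscale (f b) (form_comb (m + l) (coords m) w) else 0)"
    unfolding vf_comb_def vf_op_form_op
    by (simp only: fvec.scale_right_distrib sum.distrib fvec.scale_scale mult.commute)
  then show ?thesis
    by (simp add: vf_comb_def linop_sum[OF linop_form_op] linop_cscale[OF linop_form_op] pairing_def fvec.scale_sum_left)
qed

lemma vf_comb_form_comb:
  "vf_comb m f (form_comb l g w) = form_comb l g (vf_comb m f w) + cscale (pairing l f) (form_comb (m + l) g w)
     + cscale (\<Sum>a\<in>UNIV. f a * g a) (form_comb (m + l) (coords m) w)"
proof -
  have "vf_comb m f (form_comb l g w) = (\<Sum>b\<in>UNIV. cscale (g b) (vf_comb m f (form_op l b w)))"
    unfolding form_comb_def linop_sum[OF linop_vf_comb] linop_cscale[OF linop_vf_comb] ..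
  also have "\<dots> = (\<Sum>b\<in>UNIV. cscale (g b) (form_op l b (vf_comb m f w)))
      + (\<Sum>b\<in>UNIV. cscale (pairing l f) (cscale (g b) (form_op (m + l) b w)))
      + (\<Sum>b\<in>UNIV. cscale (f b * g b) (form_comb (m + l) (coords m) w))"
    unfolding vf_comb_form_op by (simp add: fvec.scale_right_distrib sum.distrib mult.commute)
  also have "(\<Sum>b\<in>UNIV. cscale (pairing l f) (cscale (g b) (form_op (m + l) b w)))
      = cscale (pairing l f) (form_comb (m + l) g w)"
    by (simp only: form_comb_def fvec.scale_sum_right)
  finally show ?thesis
    by (simp only: form_comb_def[of l] fvec.scale_sum_left)
qed

lemma heis_v_vf_op:
  "heis (hyp_v p) n (vf_op m b w) = vf_op m b (heis (hyp_v p) n w)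
     + cscale (of_int (m $ Some p)) (vf_op (m + axis None n) b w)
     - (if b = None then cscale (of_int n) (vf_op (m + axis None n) (Some p) w)
          + cscale (of_int (n * n * m $ Some p)) (form_op (m + axis None n) None w) else 0)"
  by (cases b) (simp_all add: heis_v_v_current heis_v_time_op spatial_add)

lemma heis_v_form_op:
  "heis (hyp_v p) n (form_op m b w) = form_op m b (heis (hyp_v p) n w)
     + cscale (of_int (m $ Some p)) (form_op (m + axis None n) b w)
     + (if b = Some p then cscale (of_int n) (form_op (m + axis None n) None w) else 0)"
proof (cases b)
  case None
  have e: "m $ None - 1 + n = (m + axis None n) $ None - 1" by simp
  show ?thesis unfolding None form_op_simps heis_v_exp_field e by (simp add: spatial_add)
next
  case (Some q)
  have "axis q 1 $ p = (if q = p then 1 else 0 :: int)" by (simp add: axis_def)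
  then show ?thesis by (auto simp: Some heis_v_u_current spatial_add)
qed

text \<open>The vector-field coefficients of the bracket of \<open>t\<^sub>0\<^sup>n d\<^sub>p\<close> with \<open>\<Sum>\<^sub>a f\<^sub>a t\<^sup>m d\<^sub>a\<close>\<close>

definition shift_coeff :: "'a::finite \<Rightarrow> int \<Rightarrow> 'a expo \<Rightarrow> ('a option \<Rightarrow> complex) \<Rightarrow> 'a option \<Rightarrow> complex" where
  "shift_coeff p n m f = (\<lambda>a. of_int (m $ Some p) * f a - (if a = Some p then of_int n * f None else 0))"

lemma vf_comb_shift_coeff:
  "vf_comb l (shift_coeff p n m f) w = cscale (of_int (m $ Some p)) (vf_comb l f w) - cscale (of_int n * f None) (vf_op l (Some p) w)"
  unfolding shift_coeff_def vf_comb_linear vf_comb_delta ..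

text \<open>
  The bracket of \<open>t\<^sub>0\<^sup>n d\<^sub>p\<close> with a vector field.  The last term is the cocycle, which is a multiple
  of \<open>n \<Sum>\<^sub>q m\<^sub>q t\<^sup>M k\<^sub>q\<close> with \<open>M = m + (n, 0, \<dots>, 0)\<close> and equals this multiple of \<open>- n\<^sup>2 t\<^sup>M k\<^sub>0\<close> modulo exact
  forms.
\<close>

lemma heis_v_vf_comb:
  "heis (hyp_v p) n (vf_comb m f w) = vf_comb m f (heis (hyp_v p) n w)
     + vf_comb (m + axis None n) (shift_coeff p n m f) w
     - cscale (of_int (n * n * m $ Some p) * f None) (form_op (m + axis None n) None w)"
proof -
  let ?m = "m + axis None n"
  have d: "cscale (f a) (if a = None then v else 0) = (if a = None then cscale (f None) v else 0)" for a and v :: "'a fock"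
    by simp
  have "heis (hyp_v p) n (vf_comb m f w) = (\<Sum>a\<in>UNIV. cscale (f a) (vf_op m a (heis (hyp_v p) n w))
      + cscale (of_int (m $ Some p)) (cscale (f a) (vf_op ?m a w))
      - (if a = None then cscale (f None) (cscale (of_int n) (vf_op ?m (Some p) w)
          + cscale (of_int (n * n * m $ Some p)) (form_op ?m None w)) else 0))"
    unfolding vf_comb_def heis_sum heis_cscale heis_v_vf_op fvec.scale_right_distrib fvec.scale_right_diff_distrib d
    by (intro sum.cong refl) (simp add: mult.commute)
  also have "\<dots> = vf_comb m f (heis (hyp_v p) n w) + cscale (of_int (m $ Some p)) (vf_comb ?m f w)
      - cscale (f None) (cscale (of_int n) (vf_op ?m (Some p) w) + cscale (of_int (n * n * m $ Some p)) (form_op ?m None w))"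
    unfolding sum_subtractf sum.distrib vf_comb_def fvec.scale_sum_right by simp
  finally show ?thesis
    unfolding vf_comb_shift_coeff by (simp add: fvec.scale_right_distrib algebra_simps)
qed

lemma heis_v_form_comb:
  "heis (hyp_v p) n (form_comb m g w) = form_comb m g (heis (hyp_v p) n w)
     + cscale (of_int (m $ Some p)) (form_comb (m + axis None n) g w)
     + cscale (of_int n * g (Some p)) (form_op (m + axis None n) None w)"
proof -
  let ?m = "m + axis None n"
  have d: "cscale (g a) (if a = Some p then v else 0) = (if a = Some p then cscale (g (Some p)) v else 0)" for a and v :: "'a fock"
    by simp
  have "heis (hyp_v p) n (form_comb m g w) = (\<Sum>a\<in>UNIV. cscale (g a) (form_op m a (heis (hyp_v p) n w))
      + cscale (of_int (m $ Some p)) (cscale (g a) (form_op ?m a w))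
      + (if a = Some p then cscale (g (Some p)) (cscale (of_int n) (form_op ?m None w)) else 0))"
    unfolding form_comb_def heis_sum heis_cscale heis_v_form_op fvec.scale_right_distrib d
    by (intro sum.cong refl) (simp add: mult.commute)
  also have "\<dots> = form_comb m g (heis (hyp_v p) n w) + cscale (of_int (m $ Some p)) (form_comb ?m g w)
      + cscale (g (Some p)) (cscale (of_int n) (form_op ?m None w))"
    unfolding sum.distrib form_comb_def fvec.scale_sum_right by simp
  finally show ?thesis by (simp add: mult.commute)
qed

section \<open>The defect of the bracket relation on vector fields\<close>

text \<open>
  The coefficients of the bracket of \<open>x = \<Sum>\<^sub>a f\<^sub>a t\<^sup>m d\<^sub>a\<close> and \<open>y = \<Sum>\<^sub>b g\<^sub>b t\<^sup>l d\<^sub>b\<close> as vector fields, and the difference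
  \<open>[\<rho>(x), \<rho>(y)] - \<rho>([x, y])\<close> for the bracket of \<open>\<D> \<oplus> \<K>\<close> with \<open>\<mu> = 1\<close>
\<close>

definition bracket_coeff :: "'a::finite expo \<Rightarrow> ('a option \<Rightarrow> complex) \<Rightarrow> 'a expo \<Rightarrow> ('a option \<Rightarrow> complex) \<Rightarrow> 'a option \<Rightarrow> complex" where
  "bracket_coeff m f l g = (\<lambda>a. pairing l f * g a - pairing m g * f a)"

definition defect :: "'a::finite expo \<Rightarrow> ('a option \<Rightarrow> complex) \<Rightarrow> 'a expo \<Rightarrow> ('a option \<Rightarrow> complex) \<Rightarrow> 'a fock \<Rightarrow> 'a fock" where
  "defect m f l g w = vf_comb m f (vf_comb l g w) - vf_comb l g (vf_comb m f w)
     - vf_comb (m + l) (bracket_coeff m f l g) w - cscale (pairing l f * pairing m g) (form_comb (m + l) (coords l) w)"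

lemma linop_defect: "linop (defect m f l g)"
  unfolding defect_def[abs_def]
  by (intro linop_minus2 linop_scale linop_comp[OF linop_vf_comb linop_vf_comb] linop_vf_comb linop_form_comb)

lemma homog_defect: "homog (m $ None + l $ None) (defect m f l g)"
proof -
  have "homog (m $ None + l $ None) (\<lambda>w. vf_comb m f (vf_comb l g w))"
    "homog (m $ None + l $ None) (\<lambda>w. vf_comb l g (vf_comb m f w))"
    by (rule homog_comp[OF homog_vf_comb homog_vf_comb], simp)+
  moreover have "homog (m $ None + l $ None) (vf_comb (m + l) (bracket_coeff m f l g))"
    "homog (m $ None + l $ None) (form_comb (m + l) (coords l))"
    using homog_vf_comb[of "m + l"] homog_form_comb[of "m + l"] by simp_all
  ultimately show ?thesis
    unfolding defect_def[abs_def] by (intro homog_minus2 homog_scale)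
qed

lemma pairing_linear: "pairing (m + l) f = pairing m f + pairing l f"
  "pairing m (\<lambda>a. c * f a - d * g a) = c * pairing m f - d * pairing m g"
  by (simp_all add: pairing_def algebra_simps sum.distrib sum_subtractf sum_distrib_left)

text \<open>By the Jacobi identity, as the brackets of \<open>\<D>\<close> with \<open>\<K>\<close> are respected\<close>

lemma form_op_defect: "form_op k c (defect m f l g w) = defect m f l g (form_op k c w)"
proof -
  let ?K = "m + (l + k)"
  have K: "l + (m + k) = ?K" "m + l + k = ?K" by (simp_all add: add_ac)
  have l: "vf_comb m f (form_comb (l + k) (coords l) w) = form_comb (l + k) (coords l) (vf_comb m f w)
      + cscale (pairing (l + k) f) (form_comb ?K (coords l) w) + cscale (pairing l f) (form_comb ?K (coords m) w)"
    unfolding vf_comb_form_comb by (simp add: pairing_def mult.commute)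
  have m: "vf_comb l g (form_comb (m + k) (coords m) w) = form_comb (m + k) (coords m) (vf_comb l g w)
      + cscale (pairing (m + k) g) (form_comb ?K (coords m) w) + cscale (pairing m g) (form_comb ?K (coords l) w)"
    unfolding vf_comb_form_comb K by (simp add: pairing_def mult.commute)
  have ml: "form_comb ?K (coords (m + l)) w = form_comb ?K (coords m) w + form_comb ?K (coords l) w"
    by (simp add: form_comb_linear)
  have k: "pairing k (bracket_coeff m f l g) = pairing l f * pairing k g - pairing m g * pairing k f"
    unfolding bracket_coeff_def pairing_linear ..
  show ?thesis
    unfolding defect_def vf_comb_form_op linop_add[OF linop_vf_comb] linop_cscale[OF linop_vf_comb] l m
      linop_diff[OF linop_form_op] linop_cscale[OF linop_form_op] form_comb_commute K ml k pairing_linear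
    by (rule poly_mapping_eqI) (simp add: lookup_add lookup_minus bracket_coeff_def algebra_simps)
qed

text \<open>
  The Jacobi identity for \<open>t\<^sub>0\<^sup>n d\<^sub>p\<close>, \<open>x\<close> and \<open>y\<close>, written out for the operators.  Neither \<open>x\<close> nor \<open>y\<close> need
  be divergence-free.
\<close>

lemma heis_v_defect:
  "heis (hyp_v p) n (defect m f l g w) = defect m f l g (heis (hyp_v p) n w)
     + (defect (m + axis None n) (shift_coeff p n m f) l g w + defect m f (l + axis None n) (shift_coeff p n l g) w)"
proof -
  let ?e = "axis None n :: 'a expo"
  define M where "M = m + l + ?e"
  have M: "m + ?e + l = M" "m + (l + ?e) = M" "l + (m + ?e) = M" "l + ?e + m = M" "m + l + ?e = M"
    by (simp_all add: M_def add_ac)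
  let ?N = "form_op M None w" and ?L = "form_comb M (coords l) w"
  have e: "form_comb M (coords ?e) w = cscale (of_int n) ?N"
  proof -
    have "coords ?e = (\<lambda>a. if a = None then of_int n else 0)" by (auto simp: axis_def)
    then show ?thesis by (simp only: form_comb_delta)
  qed
  have cm: "form_comb M (coords m) w = - ?L - cscale (of_int n) ?N"
  proof -
    have "form_comb M (coords m) w + ?L + form_comb M (coords ?e) w = form_comb M (coords M) w"
      unfolding form_comb_linear(1)[symmetric] by (simp add: M_def)
    then show ?thesis unfolding e form_comb_exact by (simp add: algebra_simps eq_neg_iff_add_eq_0)
  qed
  have cl: "form_comb M (coords (l + ?e)) w = ?L + cscale (of_int n) ?N"
    and cm': "form_comb M (coords (m + ?e)) w = - ?L"
    using cm by (simp_all add: form_comb_linear e)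
  have pe: "pairing ?e h = of_int n * h None" for h
    by (simp add: pairing_def axis_def if_distrib[of "\<lambda>x. of_int x * h _"] cong: if_cong)
  have ps: "pairing k (shift_coeff p n k' h) = of_int (k' $ Some p) * pairing k h - of_int (k $ Some p) * of_int n * h None"
    for k k' :: "'a expo" and h
    unfolding shift_coeff_def pairing_def
    by (simp add: algebra_simps sum_subtractf sum_distrib_left if_distrib[of "\<lambda>x. of_int _ * x"] cong: if_cong)
  have s: "shift_coeff p n k h None = of_int (k $ Some p) * h None" for k h
    by (simp add: shift_coeff_def)
  have b: "vf_comb M (bracket_coeff k h k' h') w = cscale (pairing k' h) (vf_comb M h' w) - cscale (pairing k h') (vf_comb M h w)" for k h k' h'
    unfolding bracket_coeff_def vf_comb_linear ..
  have c1: "vf_comb m f (form_op (l + ?e) None w) = form_op (l + ?e) None (vf_comb m f w)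
      + cscale (pairing (l + ?e) f) ?N + cscale (f None) (- ?L - cscale (of_int n) ?N)"
    unfolding vf_comb_form_op M cm ..
  have c2: "vf_comb l g (form_op (m + ?e) None w) = form_op (m + ?e) None (vf_comb l g w)
      + cscale (pairing (m + ?e) g) ?N + cscale (g None) ?L"
    unfolding vf_comb_form_op M ..
  have bn: "bracket_coeff m f l g None = pairing l f * g None - pairing m g * f None"
    by (simp add: bracket_coeff_def)
  show ?thesis
    unfolding defect_def linop_diff[OF linop_heis] heis_cscale heis_v_vf_comb heis_v_form_comb
      linop_add[OF linop_vf_comb] linop_diff[OF linop_vf_comb] linop_cscale[OF linop_vf_comb]
      M b vf_comb_shift_coeff c1 c2 cl cm' pairing_linear(1) ps pe s bn
    by (rule poly_mapping_eqI) (simp add: lookup_add lookup_minus algebra_simps)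
qed

text \<open>The bracket with \<open>t\<^sub>0\<^sup>n d\<^sub>p\<close> preserves divergence-free vector fields.\<close>

lemma pairing_shift_coeff:
  "pairing m f = 0 \<Longrightarrow> pairing (m + axis None n) (shift_coeff p n m f) = 0"
proof -
  assume m: "pairing m f = 0"
  have e: "axis None n $ a = (if a = None then n else 0)" for a :: "'a option"
    by (simp add: axis_def)
  have "pairing (m + axis None n) (shift_coeff p n m f) = of_int (m $ Some p) * pairing m f"
    unfolding pairing_option shift_coeff_def
    by (simp add: e algebra_simps sum_subtractf sum_distrib_left if_distrib[of "\<lambda>x. _ * x"] cong: if_cong)
  then show ?thesis by (simp add: m)
qed

lemma defect_swap: "defect l g m f w = - defect m f l g w"
proof -
  have "form_comb (m + l) (coords m) w + form_comb (m + l) (coords l) w = form_comb (m + l) (coords (m + l)) w"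
    unfolding form_comb_linear(1)[symmetric] by simp
  then have "form_comb (m + l) (coords m) w = - form_comb (m + l) (coords l) w"
    unfolding form_comb_exact by (simp add: eq_neg_iff_add_eq_0)
  then show ?thesis
    unfolding defect_def add.commute[of l m] bracket_coeff_def vf_comb_linear
    by (simp add: algebra_simps)
qed

section \<open>The defect on the vacuum\<close>

lemma homog_exp_vec: "homog d X \<Longrightarrow> d > 0 \<Longrightarrow> X (exp_vec q) = 0"
  using homogD[OF _ exp_vec_wspace] by (intro wspace_neg) auto

lemma virasoro_vacuum: "n \<ge> 0 \<Longrightarrow> virasoro n (exp_vec 0) = 0"
  using virasoro_exp_vec(1)[of 0] virasoro_exp_vec(2)[of n 0] by (cases "n = 0") auto

lemma heis_v_vacuum: "n \<ge> 0 \<Longrightarrow> heis (hyp_v p) n (exp_vec 0) = 0"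
  using heis_exp_vec(1)[of n "hyp_v p" 0] heis_exp_vec(2)[of "hyp_v p" 0] hyp_form_v_ru[of p 0] by (cases "n = 0") auto

lemma vf_comb_vacuum:
  assumes "m $ None \<ge> 0"
  shows "vf_comb m f (exp_vec 0) = (if m $ None = 0 then cscale (f None) (exp_vec (spatial m)) else 0)"
proof (cases "m $ None = 0")
  case True
  have "v_current p (spatial m) 0 (exp_vec 0) = 0" for p
    unfolding v_current_def
    by (rule nop_exp_vec_zero) (simp_all add: linop_basic heis_v_vacuum exp_field_exp_vec)
  moreover have "nop virasoro (exp_field (spatial m)) 1 (exp_vec 0) = 0"
    by (rule nop_exp_vec_zero)
      (simp_all add: linop_basic is_field_linop[OF is_field_virasoro] virasoro_vacuum exp_field_exp_vec)
  ultimately show ?thesis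
    using True by (simp add: vf_comb_def sum_option time_op_def exp_field_exp_vec)
next
  case False
  then have "m $ None > 0" using assms by linarith
  then show ?thesis using False homog_exp_vec[OF homog_vf_comb] by simp
qed

lemma form_op_exp_vec:
  "m $ None \<ge> 0 \<Longrightarrow> form_op m a (exp_vec q) = (if m $ None = 0 \<and> a = None then exp_vec (spatial m + q) else 0)"
  using exp_field_exp_vec(1)[of "m $ None - 1" "spatial m" q]
  by (cases a) (auto simp: exp_field_exp_vec u_current_exp_vec)

lemma form_comb_exp_vec:
  assumes "m $ None \<ge> 0"
  shows "form_comb m g (exp_vec q) = (if m $ None = 0 then cscale (g None) (exp_vec (spatial m + q)) else 0)"
proof -
  have "(\<Sum>p\<in>UNIV. cscale (g (Some p)) (form_op m (Some p) (exp_vec q))) = 0"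
    by (rule sum.neutral) (simp add: form_op_exp_vec assms del: form_op_simps)
  moreover have "form_op m None (exp_vec q) = (if m $ None = 0 then exp_vec (spatial m + q) else 0)"
    using assms by (simp add: form_op_exp_vec del: form_op_simps)
  ultimately show ?thesis by (simp add: form_comb_def sum_option del: form_op_simps)
qed

lemma form_op_form_op_vacuum:
  assumes "m $ None \<ge> 0" "l $ None = - m $ None"
  shows "form_op m a (form_op l c (exp_vec 0)) =
    (if m $ None = 0 \<and> a = None \<and> c = None then exp_vec (spatial m + spatial l) else 0)"
proof -
  have "form_op m a (form_op l c (exp_vec 0)) = form_op l c (form_op m a (exp_vec 0))"
    by (rule form_op_commute)
  also have "\<dots> = (if m $ None = 0 \<and> a = None \<and> c = None then exp_vec (spatial m + spatial l) else 0)"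
    using assms by (simp add: form_op_exp_vec linop_0[OF linop_form_op] add.commute del: form_op_simps)
  finally show ?thesis .
qed

lemma form_comb_form_op_vacuum:
  assumes "m $ None \<ge> 0" "l $ None = - m $ None"
  shows "form_comb m g (form_op l c (exp_vec 0)) =
    (if m $ None = 0 \<and> c = None then cscale (g None) (exp_vec (spatial m + spatial l)) else 0)"
proof -
  have "(\<Sum>p\<in>UNIV. cscale (g (Some p)) (form_op m (Some p) (form_op l c (exp_vec 0)))) = 0"
    by (rule sum.neutral) (simp add: form_op_form_op_vacuum[OF assms] del: form_op_simps)
  then show ?thesis
    by (simp add: form_comb_def sum_option form_op_form_op_vacuum[OF assms] del: form_op_simps)
qed

lemma vf_comb_form_op_vacuum:
  assumes "m $ None \<ge> 0" "l $ None = - m $ None"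
  shows "vf_comb m f (form_op l c (exp_vec 0)) =
    cscale ((if c = None then (if m $ None = 0 then f None else 0) + pairing l f else 0) + f c * of_int (m $ None))
      (exp_vec (spatial m + spatial l))"
proof -
  have 0: "(m + l) $ None = 0" using assms by simp
  have "form_op l c (vf_comb m f (exp_vec 0))
      = cscale (if c = None \<and> m $ None = 0 then f None else 0) (exp_vec (spatial m + spatial l))"
    using assms by (simp add: vf_comb_vacuum linop_cscale[OF linop_form_op] linop_0[OF linop_form_op] form_op_exp_vec
        add.commute del: form_op_simps)
  moreover have "form_op (m + l) c (exp_vec 0) = cscale (if c = None then 1 else 0) (exp_vec (spatial m + spatial l))"
    using 0 by (simp add: form_op_exp_vec spatial_add del: form_op_simps)
  moreover have "form_comb (m + l) (coords m) (exp_vec 0) = cscale (of_int (m $ None)) (exp_vec (spatial m + spatial l))"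
    using 0 by (simp add: form_comb_exp_vec spatial_add)
  ultimately show ?thesis
    unfolding vf_comb_form_op by (simp add: fvec.scale_left_distrib)
qed

lemma sum_of_nat: "(\<Sum>k=1..i. of_nat k :: complex) = of_nat i * (of_nat i + 1) / 2"
  by (induction i) (simp_all add: field_simps)

lemma sum_of_nat_squares: "(\<Sum>k=1..i. of_nat k * of_nat k :: complex) = of_nat i * (of_nat i + 1) * (2 * of_nat i + 1) / 6"
  by (induction i) (simp_all add: field_simps)

text \<open>
  The component at \<open>e\<^sup>q\<^sup>u\<close> is a linear functional that vanishes on the image of every creation operator,
  so an expansion of the inner operator in creation operators leaves only commutators with the outer one.
\<close>

lemma lookup_vf_comb_heis_v:
  "k > 0 \<Longrightarrow> Poly_Mapping.lookup (vf_comb m f (heis (hyp_v b) (- int k) w)) ({#}, q)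
    = - Poly_Mapping.lookup (vf_comb (m + axis None (- int k)) (shift_coeff b (- int k) m f) w) ({#}, q)
      + of_int (m $ Some b) * of_nat k * of_nat k * f None
        * Poly_Mapping.lookup (form_op (m + axis None (- int k)) None w) ({#}, q)"
proof -
  assume "k > 0"
  then have "Poly_Mapping.lookup (heis (hyp_v b) (- int k) (vf_comb m f w)) ({#}, q) = 0"
    by (simp add: lookup_heis_neg)
  then show ?thesis
    unfolding heis_v_vf_comb by (simp add: lookup_add lookup_minus algebra_simps del: form_op_simps)
qed

lemma lookup_vf_comb_v_current:
  assumes i: "m $ None = int i" "i > 0"
  shows "Poly_Mapping.lookup (vf_comb m f (v_current b s (- int i) (exp_vec 0))) ({#}, q)
    = - (of_nat i * of_int (m $ Some b) * (\<Sum>p\<in>UNIV. of_int (s $ p) * f (Some p))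
        + of_nat i * (of_nat i + 1) / 2 * f None * of_int (s $ b)
        + of_int (m $ Some b) * f None * (1 - of_nat i * of_nat i))
      * Poly_Mapping.lookup (exp_vec (spatial m + s)) ({#}, q)"
proof -
  let ?\<eta> = "Poly_Mapping.lookup (exp_vec (spatial m + s)) ({#}, q)"
  let ?F = "\<Sum>p\<in>UNIV. of_int (s $ p) * f (Some p)" and ?r = "complex_of_int (m $ Some b)"
  have "v_current b s (- int i) (exp_vec 0)
      = (\<Sum>k=1..i. heis (hyp_v b) (- int k) (exp_field s (- int i + int k - 1) (exp_vec 0)))"
    unfolding v_current_def by (rule nop_creation) (simp_all add: linop_basic heis_v_vacuum exp_field_exp_vec)
  moreover have "Poly_Mapping.lookup (vf_comb m f (heis (hyp_v b) (- int k) (exp_field s (- int i + int k - 1) (exp_vec 0)))) ({#}, q)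
      = - (?r * ?F + f None * of_int (s $ b) * of_nat k + (if k = i then ?r * f None * (1 - of_nat i * of_nat i) else 0)) * ?\<eta>"
    if k: "k \<in> {1..i}" for k
  proof -
    let ?m = "m + axis None (- int k)" and ?l = "mk_expo (- int i + int k) s" and ?f = "shift_coeff b (- int k) m f"
    have ml: "?m $ None \<ge> 0" "?l $ None = - ?m $ None" and m0: "?m $ None = 0 \<longleftrightarrow> k = i"
      using k i by auto
    have e: "exp_field s (- int i + int k - 1) = form_op ?l None" by simp
    have d: "of_int (s $ p) * (if p = b then x else 0) = (if p = b then of_int (s $ b) * x else 0)" for p and x :: complex
      by simp
    have pl: "pairing ?l ?f = (of_nat k - of_nat i) * ?r * f None + ?r * ?F + of_nat k * f None * of_int (s $ b)"
      unfolding pairing_option shift_coeff_def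
      by (simp add: algebra_simps sum_subtractf sum.distrib sum_distrib_left d)
    have fN: "?f None = ?r * f None" by (simp add: shift_coeff_def)
    have mN: "of_int (?m $ None) = (of_nat i - of_nat k :: complex)" using i by simp
    have "k > 0" using k by simp
    then show ?thesis
      unfolding e lookup_vf_comb_heis_v[OF \<open>k > 0\<close>] vf_comb_form_op_vacuum[OF ml] form_op_form_op_vacuum[OF ml] m0 pl fN mN
      by (simp add: lookup_add lookup_minus spatial_add algebra_simps)
  qed
  ultimately have "Poly_Mapping.lookup (vf_comb m f (v_current b s (- int i) (exp_vec 0))) ({#}, q)
      = (\<Sum>k=1..i. - (?r * ?F + f None * of_int (s $ b) * of_nat k + (if k = i then ?r * f None * (1 - of_nat i * of_nat i) else 0)) * ?\<eta>)"
    by (simp only: linop_sum[OF linop_vf_comb] lookup_sum cong: sum.cong)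
  also have "\<dots> = - ((\<Sum>k=1..i. ?r * ?F) + f None * of_int (s $ b) * (\<Sum>k=1..i. of_nat k)
      + (\<Sum>k=1..i. if k = i then ?r * f None * (1 - of_nat i * of_nat i) else 0)) * ?\<eta>"
    by (simp only: sum_distrib_left[symmetric] sum_distrib_right[symmetric] sum_negf sum.distrib)
  finally show ?thesis
    using i unfolding sum_of_nat by (simp add: algebra_simps)
qed

lemma lookup_vf_comb_nop_v_u:
  assumes i: "m $ None = int i" "i > 0"
  shows "Poly_Mapping.lookup (vf_comb m f (nop (heis (hyp_v p)) (u_current (axis p 1) s) (1 - int i) (exp_vec 0))) ({#}, q)
    = - (of_int (m $ Some p) * f (Some p) * (of_nat i * (of_nat i - 1) / 2)
         + f None * (of_nat i * (of_nat i * of_nat i - 1) / 6))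
      * Poly_Mapping.lookup (exp_vec (spatial m + s)) ({#}, q)"
proof -
  let ?\<eta> = "Poly_Mapping.lookup (exp_vec (spatial m + s)) ({#}, q)"
  let ?r = "complex_of_int (m $ Some p)"
  have "nop (heis (hyp_v p)) (u_current (axis p 1) s) (1 - int i) (exp_vec 0)
      = (\<Sum>k=1..i. heis (hyp_v p) (- int k) (u_current (axis p 1) s (1 - int i + int k - 1) (exp_vec 0)))"
    by (rule nop_creation) (simp_all add: linop_basic heis_v_vacuum u_current_exp_vec)
  moreover have "Poly_Mapping.lookup (vf_comb m f (heis (hyp_v p) (- int k) (u_current (axis p 1) s (1 - int i + int k - 1) (exp_vec 0)))) ({#}, q)
      = - (of_nat i * ?r * f (Some p) + (of_nat i * f None - ?r * f (Some p)) * of_nat k - f None * (of_nat k * of_nat k)) * ?\<eta>"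
    if k: "k \<in> {1..i}" for k
  proof -
    let ?m = "m + axis None (- int k)" and ?l = "mk_expo (- int i + int k) s" and ?f = "shift_coeff p (- int k) m f"
    have ml: "?m $ None \<ge> 0" "?l $ None = - ?m $ None"
      using k i by auto
    have e: "u_current (axis p 1) s (1 - int i + int k - 1) = form_op ?l (Some p)" by simp
    have fp: "?f (Some p) = ?r * f (Some p) + of_nat k * f None" by (simp add: shift_coeff_def)
    have mN: "of_int (?m $ None) = (of_nat i - of_nat k :: complex)" using i by simp
    have "k > 0" using k by simp
    then show ?thesis
      unfolding e lookup_vf_comb_heis_v[OF \<open>k > 0\<close>] vf_comb_form_op_vacuum[OF ml] form_op_form_op_vacuum[OF ml] fp mN
      by (simp add: lookup_add lookup_minus spatial_add algebra_simps)
  qed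
  ultimately have "Poly_Mapping.lookup (vf_comb m f (nop (heis (hyp_v p)) (u_current (axis p 1) s) (1 - int i) (exp_vec 0))) ({#}, q)
      = (\<Sum>k=1..i. - (of_nat i * ?r * f (Some p) + (of_nat i * f None - ?r * f (Some p)) * of_nat k - f None * (of_nat k * of_nat k)) * ?\<eta>)"
    by (simp only: linop_sum[OF linop_vf_comb] lookup_sum cong: sum.cong)
  also have "\<dots> = - ((\<Sum>k=1..i. of_nat i * ?r * f (Some p)) + (of_nat i * f None - ?r * f (Some p)) * (\<Sum>k=1..i. of_nat k)
      - f None * (\<Sum>k=1..i. of_nat k * of_nat k)) * ?\<eta>"
    by (simp only: sum_distrib_left[symmetric] sum_distrib_right[symmetric] sum_negf sum.distrib sum_subtractf)
  finally show ?thesis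
    unfolding sum_of_nat sum_of_nat_squares by (simp add: field_simps)
qed

lemma lookup_vf_comb_u_deriv:
  assumes i: "m $ None = int i" "i > 0"
  shows "Poly_Mapping.lookup (vf_comb m f (u_deriv_field s (1 - int i) (exp_vec 0))) ({#}, q)
    = of_nat i * (of_nat i - 1) * (\<Sum>p\<in>UNIV. of_int (s $ p) * f (Some p))
      * Poly_Mapping.lookup (exp_vec (spatial m + s)) ({#}, q)"
proof -
  let ?\<eta> = "Poly_Mapping.lookup (exp_vec (spatial m + s)) ({#}, q)"
  let ?F = "\<Sum>p\<in>UNIV. of_int (s $ p) * f (Some p)"
  have fz: "fderiv (heis (hyp_ru s)) n (exp_vec 0) = 0" if "n \<ge> 0" for n
    using that by (cases "n = 0") (simp_all add: fderiv_def heis_ru_exp_vec)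
  have "u_deriv_field s (1 - int i) (exp_vec 0)
      = (\<Sum>k=1..i-1. fderiv (heis (hyp_ru s)) (- int k) (exp_field s (1 - int i + int k - 1) (exp_vec 0)))"
    unfolding u_deriv_field_def
    by (rule nop_creation) (use i in \<open>simp_all add: linop_basic is_field_linop[OF is_field_fderiv_heis] fz exp_field_exp_vec of_nat_diff\<close>)
  moreover have "Poly_Mapping.lookup (vf_comb m f (fderiv (heis (hyp_ru s)) (- int k) (exp_field s (1 - int i + int k - 1) (exp_vec 0)))) ({#}, q)
      = (if k = i - 1 then of_nat k * of_nat i * ?F * ?\<eta> else 0)" if k: "k \<in> {1..i-1}" for k
  proof -
    let ?n = "- int k - 1" and ?l = "mk_expo (- int i + int k + 1) s"
    let ?w = "form_op ?l None (exp_vec 0)" and ?m = "m + axis None (- int k - 1)"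
    have ml: "?m $ None \<ge> 0" "?l $ None = - ?m $ None" and m0: "?m $ None = 0 \<longleftrightarrow> k = i - 1"
      using k i by auto
    have u: "heis (hyp_u p) ?n = form_op (axis None ?n) (Some p)" for p
      by (simp add: u_current_0 hyp_u_ru)
    have "Poly_Mapping.lookup (vf_comb m f (heis (hyp_u p) ?n ?w)) ({#}, q)
        = (if k = i - 1 then f (Some p) * of_nat i * ?\<eta> else 0)" for p
    proof -
      have "Poly_Mapping.lookup (form_op (axis None ?n) (Some p) (vf_comb m f ?w)) ({#}, q) = 0"
        unfolding u[symmetric] by (rule lookup_heis_neg) simp
      then show ?thesis
        unfolding u vf_comb_form_op form_op_form_op_vacuum[OF ml] form_comb_form_op_vacuum[OF ml] m0
        using i by (simp add: lookup_add spatial_add)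
    qed
    then have "Poly_Mapping.lookup (vf_comb m f (heis (hyp_ru s) ?n ?w)) ({#}, q) = (if k = i - 1 then of_nat i * ?F * ?\<eta> else 0)"
      unfolding heis_ru_expand[of s] linop_sum[OF linop_vf_comb] linop_cscale[OF linop_vf_comb] lookup_sum lookup_cscale
      by (simp add: sum_distrib_left sum_distrib_right mult_ac)
    moreover have "fderiv (heis (hyp_ru s)) (- int k) (exp_field s (1 - int i + int k - 1) (exp_vec 0))
        = cscale (of_nat k) (heis (hyp_ru s) ?n ?w)"
      by (simp add: fderiv_def)
    ultimately show ?thesis by (simp add: linop_cscale[OF linop_vf_comb])
  qed
  ultimately have "Poly_Mapping.lookup (vf_comb m f (u_deriv_field s (1 - int i) (exp_vec 0))) ({#}, q)
      = (\<Sum>k=1..i-1. if k = i - 1 then of_nat k * of_nat i * ?F * ?\<eta> else 0)"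
    by (simp only: linop_sum[OF linop_vf_comb] lookup_sum cong: sum.cong)
  then show ?thesis
    using i by (cases "i = 1") (auto simp: of_nat_diff mult.commute)
qed

text \<open>
  The contributions of \<open>\<rho>(x) \<rho>(y) \<one>\<close> are compared with those of \<open>\<rho>([x, y]) \<one>\<close>, while \<open>\<rho>(x) \<one> = 0\<close>
  because \<open>x\<close> has positive degree.  The number of variables enters through the sum over \<open>p\<close> in \<open>E2\<close>.
\<close>

lemma defect_vacuum_pos:
  fixes m l :: "'a::finite expo"
  assumes N: "CARD('a) = 12" and i: "m $ None = int i" "i > 0" and l: "l $ None = - int i"
    and mf: "pairing m f = 0" and lg: "pairing l g = 0"
  shows "Poly_Mapping.lookup (defect m f l g (exp_vec 0)) ({#}, q) = 0"
proof -
  define s where "s = spatial l"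
  define \<eta> where "\<eta> = Poly_Mapping.lookup (exp_vec (spatial m + s)) ({#}, q)"
  define F where "F = (\<Sum>p\<in>UNIV. of_int (s $ p) * f (Some p))"
  define G where "G = (\<Sum>p\<in>UNIV. of_int (m $ Some p) * g (Some p))"
  define c where "c = complex_of_nat i"
  let ?L = "\<lambda>w. Poly_Mapping.lookup w ({#}, q)"
  \<comment> \<open>\<open>R\<close> and \<open>S\<close> say that both vector fields are divergence-free\<close>
  have R: "(\<Sum>p\<in>UNIV. of_int (m $ Some p) * f (Some p)) = - c * f None"
    using mf i by (simp add: pairing_option c_def eq_neg_iff_add_eq_0 add.commute)
  have S: "(\<Sum>p\<in>UNIV. of_int (s $ p) * g (Some p)) = c * g None"
    using lg l by (simp add: pairing_option c_def s_def)
  have lf: "pairing l f = F - c * f None" and mg: "pairing m g = G + c * g None"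
    using i l by (simp_all add: pairing_option F_def G_def c_def s_def)
  have T: "?L (vf_comb m f (time_op (- int i) s (exp_vec 0)))
      = ((1 - c * c) * F + f None * (- c * c * (c - 1) / 2 + 2 * c * (c * c - 1))) * \<eta>"
  proof -
    have E1: "?L (vf_comb m f (exp_field s (- int i - 1) (exp_vec 0))) = F * \<eta>"
    proof -
      have ml: "m $ None \<ge> 0" "l $ None = - m $ None" using i l by simp_all
      have "exp_field s (- int i - 1) = form_op l None" using l by (simp add: s_def)
      then show ?thesis
        using i by (simp add: vf_comb_form_op_vacuum[OF ml] lf c_def \<eta>_def s_def del: form_op_simps)
    qed
    have E2: "(\<Sum>p\<in>UNIV. ?L (vf_comb m f (nop (heis (hyp_v p)) (u_current (axis p 1) s) (1 - int i) (exp_vec 0))))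
        = - ((- c * f None) * (c * (c - 1) / 2) + 12 * (f None * (c * (c * c - 1) / 6))) * \<eta>"
      unfolding lookup_vf_comb_nop_v_u[OF i] R[symmetric] c_def[symmetric] \<eta>_def[symmetric]
      by (simp only: sum_distrib_right[symmetric] sum_negf sum.distrib sum_constant N of_nat_numeral)
        (simp only: mult.assoc[of 12])
    have E3: "?L (vf_comb m f (u_deriv_field s (1 - int i) (exp_vec 0))) = c * (c - 1) * F * \<eta>"
      unfolding lookup_vf_comb_u_deriv[OF i] by (simp add: c_def F_def \<eta>_def)
    have E4: "- int i + 1 = 1 - int i" "complex_of_int (- int i) = - c" by (simp_all add: c_def)
    show ?thesis
      unfolding time_op_def nop_virasoro_exp_field linop_diff[OF linop_vf_comb] linop_add[OF linop_vf_comb]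
        linop_cscale[OF linop_vf_comb] linop_sum[OF linop_vf_comb] lookup_minus lookup_add lookup_cscale lookup_sum E4 E1 E2 E3
      by (simp add: field_simps)
  qed
  have V: "(\<Sum>b\<in>UNIV. g (Some b) * ?L (vf_comb m f (v_current b s (- int i) (exp_vec 0))))
      = - (c * G * F + c * (c + 1) / 2 * f None * (c * g None) + G * f None * (1 - c * c)) * \<eta>"
  proof -
    let ?K1 = "- (c * F + f None * (1 - c * c)) * \<eta>" and ?K2 = "- (c * (c + 1) / 2 * f None) * \<eta>"
    have "(\<Sum>b\<in>UNIV. g (Some b) * ?L (vf_comb m f (v_current b s (- int i) (exp_vec 0))))
        = (\<Sum>b\<in>UNIV. of_int (m $ Some b) * g (Some b) * ?K1 + of_int (s $ b) * g (Some b) * ?K2)"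
      unfolding lookup_vf_comb_v_current[OF i] c_def[symmetric] \<eta>_def[symmetric] F_def[symmetric]
      by (rule sum.cong[OF refl]) (simp add: field_simps)
    also have "\<dots> = G * ?K1 + (c * g None) * ?K2"
      by (simp only: sum.distrib sum_distrib_right[symmetric] S G_def)
    finally show ?thesis by (simp add: field_simps)
  qed
  have H1: "?L (vf_comb m f (vf_comb l g (exp_vec 0))) = g None * ?L (vf_comb m f (time_op (- int i) s (exp_vec 0)))
      + (\<Sum>b\<in>UNIV. g (Some b) * ?L (vf_comb m f (v_current b s (- int i) (exp_vec 0))))"
    unfolding vf_comb_def[of l] sum_option linop_add[OF linop_vf_comb] linop_sum[OF linop_vf_comb]
      linop_cscale[OF linop_vf_comb] lookup_add lookup_sum lookup_cscale
    using l by (simp add: s_def)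
  have H2: "vf_comb m f (exp_vec 0) = 0"
    using i by (simp add: vf_comb_vacuum)
  have H3: "?L (vf_comb (m + l) (bracket_coeff m f l g) (exp_vec 0)) = ((F - c * f None) * g None - (G + c * g None) * f None) * \<eta>"
    using i l by (simp add: vf_comb_vacuum bracket_coeff_def lf mg spatial_add \<eta>_def s_def)
  have H4: "?L (form_comb (m + l) (coords l) (exp_vec 0)) = - c * \<eta>"
    using i l by (simp add: form_comb_exp_vec spatial_add \<eta>_def s_def c_def)
  show ?thesis
    unfolding defect_def lookup_minus lookup_cscale H1 H2 H3 H4 T V lf mg linop_0[OF linop_vf_comb] lookup_zero
    by (simp add: field_simps)
qed

lemma defect_vacuum_zero:
  assumes m: "m $ None = 0" and l: "l $ None = 0" and mf: "pairing m f = 0" and lg: "pairing l g = 0"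
  shows "defect m f l g (exp_vec 0) = 0"
proof -
  have e: "exp_vec (spatial m) = form_op m None (exp_vec 0)" "exp_vec (spatial l) = form_op l None (exp_vec 0)"
    using m l by (simp_all add: form_op_exp_vec del: form_op_simps)
  have "vf_comb m f (exp_vec (spatial l)) = cscale (f None + pairing l f) (exp_vec (spatial m + spatial l))"
    "vf_comb l g (exp_vec (spatial m)) = cscale (g None + pairing m g) (exp_vec (spatial m + spatial l))"
    unfolding e using m l by (simp_all add: vf_comb_form_op_vacuum add.commute del: form_op_simps)
  then show ?thesis
    using m l unfolding defect_def
    by (simp add: vf_comb_vacuum form_comb_exp_vec linop_cscale[OF linop_vf_comb] bracket_coeff_def spatial_add)
      (rule poly_mapping_eqI, simp add: lookup_minus algebra_simps)
qed

text \<open>On divergence-free vector fields the operators satisfy the relations of \<open>\<D>\<K>(1)\<close>.\<close>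

theorem defect_eq_0:
  fixes m l :: "'a::finite expo"
  assumes N: "CARD('a) = 12" and mf: "pairing m f = 0" and lg: "pairing l g = 0"
  shows "defect m f l g w = 0"
proof -
  define \<X> where "\<X> d = {X. \<exists>(m :: 'a expo) f l g. X = defect m f l g \<and> pairing m f = 0 \<and> pairing l g = 0
      \<and> m $ None + l $ None = d}" for d
  have vac: "Poly_Mapping.lookup (defect m f l g (exp_vec 0)) ({#}, q) = 0"
    if h: "pairing m f = 0" "pairing l g = 0" "m $ None + l $ None = 0" for m l :: "'a expo" and f g q
  proof -
    consider "m $ None > 0" | "l $ None > 0" | "m $ None = 0" "l $ None = 0" using h(3) by linarith
    then show ?thesis
    proof cases
      case 1
      show ?thesis
        by (rule defect_vacuum_pos[OF N, of m "nat (m $ None)"]) (use 1 h in auto)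
    next
      case 2
      have "Poly_Mapping.lookup (defect l g m f (exp_vec 0)) ({#}, q) = 0"
        by (rule defect_vacuum_pos[OF N, of l "nat (l $ None)"]) (use 2 h in auto)
      then show ?thesis by (simp add: defect_swap[of m f l g])
    next
      case 3
      then show ?thesis using h by (simp add: defect_vacuum_zero)
    qed
  qed
  show ?thesis
  proof (rule operators_vanish[where \<X> = \<X> and X = "defect m f l g" and d = "m $ None + l $ None"])
    show "defect m f l g \<in> \<X> (m $ None + l $ None)"
      unfolding \<X>_def using mf lg by blast
  next
    fix d X assume "X \<in> \<X> d"
    then obtain m l :: "'a expo" and f g where X: "X = defect m f l g" "pairing m f = 0" "pairing l g = 0"
      "m $ None + l $ None = d" unfolding \<X>_def by blast
    show "linop X" unfolding X by (rule linop_defect)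
    show "homog d X" using homog_defect X by blast
    show "heis (hyp_u p) n (X w) = X (heis (hyp_u p) n w)" for p n w
      using form_op_defect[of "axis None n" "Some p" m f l g w] by (simp add: X u_current_0 hyp_u_ru)
    fix p n
    have "defect (m + axis None n) (shift_coeff p n m f) l g \<in> \<X> (d + n)"
      "defect m f (l + axis None n) (shift_coeff p n l g) \<in> \<X> (d + n)"
      unfolding \<X>_def using pairing_shift_coeff[OF X(2), of n p] pairing_shift_coeff[OF X(3), of n p] X by force+
    then show "\<exists>Y\<in>\<X> (d + n). \<exists>Z\<in>\<X> (d + n). \<forall>w. heis (hyp_v p) n (X w) = X (heis (hyp_v p) n w) + (Y w + Z w)"
      using heis_v_defect[of p n m f l g] X(1) by blast
  next
    fix X and q q' :: "int ^ 'a" assume "X \<in> \<X> 0"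
    then obtain m l :: "'a expo" and f g where X: "X = defect m f l g" "pairing m f = 0" "pairing l g = 0"
      "m $ None + l $ None = 0" unfolding \<X>_def by blast
    \<comment> \<open>\<open>X\<close> commutes with the modes of \<open>Y(e\<^sup>q\<^sup>u, z)\<close>, so the vacuum suffices\<close>
    have ws: "X (exp_vec 0) \<in> wspace 0"
      using homogD[OF homog_defect[of m l f g] exp_vec_wspace[of 0]] X by simp
    have "Poly_Mapping.lookup (X (exp_vec 0)) (M, r) = 0" for M r
    proof (rule ccontr)
      assume nz: "Poly_Mapping.lookup (X (exp_vec 0)) (M, r) \<noteq> 0"
      then have "M = {#}" using ws by (auto simp: wspace_def wt_eq_0)
      then show False using nz vac[OF X(2-4)] by (simp add: X(1))
    qed
    then have "X (exp_vec 0) = 0" by (intro poly_mapping_eqI) (metis surj_pair lookup_zero)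
    moreover have "exp_vec q = form_op (mk_expo 0 q) None (exp_vec 0)"
      by (simp add: exp_field_exp_vec)
    ultimately have "X (exp_vec q) = 0"
      by (simp add: X(1) form_op_defect[symmetric] linop_0[OF linop_form_op] del: form_op_simps)
    then show "Poly_Mapping.lookup (X (exp_vec q)) ({#}, q') = 0" by simp
  qed
qed

section \<open>The representation\<close>

lemma lin_ext_lin_ext: "lin_ext g (lin_ext h v) = lin_ext (\<lambda>k. lin_ext g (h k)) v"
  by (simp add: lin_ext_def[of _ v] lin_ext_sum lin_ext_cscale)

text \<open>The linear extensions of the operators above to \<open>\<D>\<close> and to \<open>\<Omega>\<^sub>\<R>\<close>; the latter factors through \<open>\<K>\<close>.\<close>

definition rho_vf :: "'a::finite vfield \<Rightarrow> 'a fock \<Rightarrow> 'a fock" where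
  "rho_vf X w = lin_ext (\<lambda>(m, a). vf_op m a w) X"

definition rho_form :: "'a::finite oneform \<Rightarrow> 'a fock \<Rightarrow> 'a fock" where
  "rho_form \<theta> w = lin_ext (\<lambda>(m, a). form_op m a w) \<theta>"

lemma rho_form_exact: "rho_form (exterior_d f) w = 0"
proof -
  have "lin_ext (\<lambda>(m, a). form_op m a w) (\<Sum>p\<in>UNIV. Poly_Mapping.single (r, p) (of_int (r $ p))) = 0" for r
    using form_comb_exact[of r w] by (simp add: lin_ext_sum lin_ext_single form_comb_def del: form_op_simps)
  then show ?thesis
    by (simp add: rho_form_def exterior_d_def lin_ext_lin_ext lin_ext_def[of "\<lambda>_. 0"])
qed

lift_definition rho_K :: "'a::finite Kspace \<Rightarrow> 'a fock \<Rightarrow> 'a fock" is rho_form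
proof (rule ext)
  fix \<theta> \<theta>' :: "'a oneform" and w
  assume "exact_rel \<theta> \<theta>'"
  then obtain f where "\<theta> - \<theta>' = exterior_d f" by (auto simp: exact_rel_def)
  then have "rho_form (\<theta> - \<theta>') w = 0" by (simp add: rho_form_exact)
  then show "rho_form \<theta> w = rho_form \<theta>' w" by (simp add: rho_form_def lin_ext_diff)
qed

definition rho :: "'a::finite dk \<Rightarrow> 'a fock \<Rightarrow> 'a fock" where
  "rho x w = rho_vf (fst x) w + rho_K (snd x) w"

lemma rho_vf_linear: "rho_vf (X + Y) w = rho_vf X w + rho_vf Y w" "rho_vf (X - Y) w = rho_vf X w - rho_vf Y w"
  "rho_vf (cscale c X) w = cscale c (rho_vf X w)"
  by (simp_all add: rho_vf_def lin_ext_add lin_ext_diff lin_ext_cscale)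

lemma rho_K_linear: "rho_K (X + Y) w = rho_K X w + rho_K Y w" "rho_K (X - Y) w = rho_K X w - rho_K Y w"
  "rho_K (K_scale c X) w = cscale c (rho_K X w)"
  by (transfer, simp add: rho_form_def lin_ext_add lin_ext_diff lin_ext_cscale)+

lemma linop_rho_vf: "linop (rho_vf X)"
  unfolding rho_vf_def[abs_def] lin_ext_def by (intro linop_sum_op linop_scale) (auto simp: linop_vf_op)

lemma linop_rho_form: "linop (rho_form X)"
  unfolding rho_form_def[abs_def] lin_ext_def by (intro linop_sum_op linop_scale) (auto simp: linop_form_op)

lemma linop_rho_K: "linop (rho_K \<kappa>)"
  by transfer (rule linop_rho_form)

lemma linop_rho: "linop (rho x)"
  unfolding rho_def[abs_def] by (intro linop_plus linop_rho_vf linop_rho_K)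

lemma rho_add: "rho (x + y) w = rho x w + rho y w"
  and rho_diff: "rho (x - y) w = rho x w - rho y w"
  and rho_scale: "rho (dk_scale c x) w = cscale c (rho x w)"
  by (simp_all add: rho_def rho_vf_linear rho_K_linear dk_scale_def fvec.scale_right_distrib)

lemma rho_minus: "rho (- x) w = - rho x w"
  using rho_diff[of 0 x w] by (simp add: rho_diff[of 0 0, simplified])

lemma rho_td: "rho (td j r a) = vf_op (mk_expo j r) a"
  and rho_tk: "rho (tk j r a) = form_op (mk_expo j r) a"
proof -
  have "rho_K 0 w = 0" "rho_vf 0 w = 0" for w :: "'a fock"
    by (transfer, simp add: rho_form_def) (simp add: rho_vf_def)
  then show "rho (td j r a) = vf_op (mk_expo j r) a" "rho (tk j r a) = form_op (mk_expo j r) a"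
    by (auto intro!: ext simp: rho_def td_def tk_def rho_vf_def rho_K.abs_eq rho_form_def lin_ext_single
        simp del: vf_op_simps form_op_simps)
qed

text \<open>The homogeneous element \<open>\<Sum>\<^sub>a f\<^sub>a t\<^sup>m d\<^sub>a\<close> (or \<open>\<Sum>\<^sub>a f\<^sub>a t\<^sup>m k\<^sub>a\<close>)\<close>

definition homog_elt :: "'a::finite expo \<Rightarrow> ('a option \<Rightarrow> complex) \<Rightarrow> ('a expo \<times> 'a option) \<Rightarrow>\<^sub>0 complex" where
  "homog_elt m f = (\<Sum>a\<in>UNIV. Poly_Mapping.single (m, a) (f a))"

lemma homog_elt_expansion:
  assumes "finite S" "fst ` Poly_Mapping.keys X \<subseteq> S"
  shows "X = (\<Sum>m\<in>S. homog_elt m (\<lambda>a. Poly_Mapping.lookup X (m, a)))"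
proof (rule poly_mapping_eqI)
  fix k :: "'a expo \<times> 'a option"
  obtain l b where k: "k = (l, b)" by fastforce
  have "Poly_Mapping.lookup (homog_elt m (\<lambda>a. Poly_Mapping.lookup X (m, a))) k
      = (if m = l then Poly_Mapping.lookup X k else 0)" for m
  proof -
    have "Poly_Mapping.lookup (homog_elt m (\<lambda>a. Poly_Mapping.lookup X (m, a))) k
        = (\<Sum>a\<in>UNIV. if a = b then (if m = l then Poly_Mapping.lookup X k else 0) else 0)"
      unfolding homog_elt_def lookup_sum by (rule sum.cong) (auto simp: k lookup_single when_def)
    then show ?thesis by simp
  qed
  then have "Poly_Mapping.lookup (\<Sum>m\<in>S. homog_elt m (\<lambda>a. Poly_Mapping.lookup X (m, a))) k
      = (if l \<in> S then Poly_Mapping.lookup X k else 0)"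
    by (simp add: lookup_sum assms(1))
  moreover have "Poly_Mapping.lookup X k = 0" if "l \<notin> S"
    using that assms(2) k by (force simp: in_keys_iff)
  ultimately show "Poly_Mapping.lookup X k
      = Poly_Mapping.lookup (\<Sum>m\<in>S. homog_elt m (\<lambda>a. Poly_Mapping.lookup X (m, a))) k" by simp
qed

lemma rho_vf_homog_elt: "rho_vf (homog_elt m f) w = vf_comb m f w"
  and rho_form_homog_elt: "rho_form (homog_elt m f) w = form_comb m f w"
  by (simp_all add: rho_vf_def rho_form_def homog_elt_def vf_comb_def form_comb_def lin_ext_sum lin_ext_single
      del: vf_op_simps form_op_simps)

lemma lin_ext_bilin_ext_homog_elt:
  "lin_ext F (bilin_ext h (homog_elt m f) (homog_elt l g))
    = (\<Sum>b\<in>UNIV. \<Sum>a\<in>UNIV. cscale (f a * g b) (lin_ext F (h (m, a) (l, b))))"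
  by (simp add: homog_elt_def bilin_ext_sum lin_ext_sum)
    (simp add: bilin_ext_def lin_ext_single lin_ext_cscale)

lemma rho_vf_bracket_homog_elt:
  "rho_vf (vf_bracket (homog_elt m f) (homog_elt l g)) w = vf_comb (m + l) (bracket_coeff m f l g) w"
proof -
  let ?V = "\<lambda>a. vf_op (m + l) a w"
  have "rho_vf (vf_bracket (homog_elt m f) (homog_elt l g)) w
      = (\<Sum>b\<in>UNIV. \<Sum>a\<in>UNIV. cscale (of_int (l $ a) * f a * g b) (?V b) - cscale (f a * (of_int (m $ b) * g b)) (?V a))"
    unfolding rho_vf_def vf_bracket_def lin_ext_bilin_ext_homog_elt
    by (intro sum.cong refl)
      (simp add: lin_ext_diff lin_ext_single fvec.scale_right_diff_distrib mult_ac del: vf_op_simps)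
  also have "\<dots> = (\<Sum>b\<in>UNIV. \<Sum>a\<in>UNIV. cscale (of_int (l $ a) * f a * g b) (?V b))
      - (\<Sum>a\<in>UNIV. \<Sum>b\<in>UNIV. cscale (f a * (of_int (m $ b) * g b)) (?V a))"
    unfolding sum_subtractf by (subst (2) sum.swap) simp
  also have "\<dots> = (\<Sum>b\<in>UNIV. cscale (pairing l f * g b) (?V b)) - (\<Sum>a\<in>UNIV. cscale (pairing m g * f a) (?V a))"
    by (simp add: pairing_def sum_distrib_right sum_distrib_left fvec.scale_sum_left mult_ac del: vf_op_simps)
  finally show ?thesis
    by (simp add: vf_comb_def bracket_coeff_def fvec.scale_left_diff_distrib sum_subtractf)
qed

lemma rho_form_cocycle_homog_elt:
  "rho_form (vf_cocycle (homog_elt m f) (homog_elt l g)) w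
    = cscale (pairing l f * pairing m g) (form_comb (m + l) (coords l) w)"
proof -
  let ?W = "form_comb (m + l) (coords l) w"
  have "rho_form (vf_cocycle (homog_elt m f) (homog_elt l g)) w
      = (\<Sum>b\<in>UNIV. \<Sum>a\<in>UNIV. cscale ((of_int (l $ a) * f a) * (of_int (m $ b) * g b)) ?W)"
    unfolding rho_form_def vf_cocycle_def lin_ext_bilin_ext_homog_elt
    by (intro sum.cong refl)
      (simp add: lin_ext_sum lin_ext_single form_comb_def fvec.scale_sum_right mult_ac del: form_op_simps)
  also have "\<dots> = cscale (\<Sum>b\<in>UNIV. \<Sum>a\<in>UNIV. (of_int (l $ a) * f a) * (of_int (m $ b) * g b)) ?W"
    by (simp only: fvec.scale_sum_left)
  also have "(\<Sum>b\<in>UNIV. \<Sum>a\<in>UNIV. (of_int (l $ a) * f a) * (of_int (m $ b) * g b)) = pairing l f * pairing m g"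
    by (simp only: pairing_def sum_product) (rule sum.swap)
  finally show ?thesis .
qed

lemma rho_form_action_homog_elt:
  "rho_form (vf_form_action (homog_elt m f) (homog_elt l g)) w
    = cscale (pairing l f) (form_comb (m + l) g w) + cscale (\<Sum>a\<in>UNIV. f a * g a) (form_comb (m + l) (coords m) w)"
proof -
  let ?W = "form_comb (m + l) (coords m) w" and ?Q = "\<lambda>a. form_op (m + l) a w"
  have "rho_form (vf_form_action (homog_elt m f) (homog_elt l g)) w
      = (\<Sum>b\<in>UNIV. \<Sum>a\<in>UNIV. cscale (of_int (l $ a) * f a * g b) (?Q b) + (if a = b then cscale (f b * g b) ?W else 0))"
    unfolding rho_form_def vf_form_action_def lin_ext_bilin_ext_homog_elt
    by (intro sum.cong refl)
      (auto simp add: lin_ext_add lin_ext_sum lin_ext_single form_comb_def fvec.scale_sum_right fvec.scale_right_distrib mult_ac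
        simp del: form_op_simps)
  also have "\<dots> = (\<Sum>b\<in>UNIV. cscale (pairing l f) (cscale (g b) (?Q b))) + (\<Sum>b\<in>UNIV. cscale (f b * g b) ?W)"
    by (simp add: sum.distrib pairing_def sum_distrib_right fvec.scale_sum_left del: form_op_simps)
  finally show ?thesis
    by (simp only: form_comb_def[of _ g] fvec.scale_sum_right fvec.scale_sum_left)
qed

lemma D_div_pairing: "X \<in> D_div \<Longrightarrow> pairing m (\<lambda>a. Poly_Mapping.lookup X (m, a)) = 0"
  by (simp add: D_div_def pairing_def)

lemma rho_vf_bracket:
  fixes X Y :: "'a::finite vfield"
  assumes N: "CARD('a) = 12" and X: "X \<in> D_div" and Y: "Y \<in> D_div"
  shows "rho_vf (vf_bracket X Y) w + rho_form (vf_cocycle X Y) w = rho_vf X (rho_vf Y w) - rho_vf Y (rho_vf X w)"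
proof -
  define S where "S = fst ` Poly_Mapping.keys X \<union> fst ` Poly_Mapping.keys Y"
  define f where "f m a = Poly_Mapping.lookup X (m, a)" for m a
  define g where "g m a = Poly_Mapping.lookup Y (m, a)" for m a
  have fin: "finite S" by (simp add: S_def)
  have Xe: "X = (\<Sum>m\<in>S. homog_elt m (f m))" and Ye: "Y = (\<Sum>m\<in>S. homog_elt m (g m))"
    unfolding f_def[abs_def] g_def[abs_def] by (rule homog_elt_expansion[OF fin], simp add: S_def)+
  have pf: "pairing m (f m) = 0" and pg: "pairing m (g m) = 0" for m
    using D_div_pairing[OF X] D_div_pairing[OF Y] by (simp_all add: f_def[abs_def] g_def[abs_def])
  have rX: "rho_vf X v = (\<Sum>m\<in>S. vf_comb m (f m) v)" and rY: "rho_vf Y v = (\<Sum>m\<in>S. vf_comb m (g m) v)" for v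
    unfolding Xe Ye by (simp_all add: rho_vf_def lin_ext_sum flip: rho_vf_homog_elt)
  have "rho_vf (vf_bracket X Y) w = (\<Sum>l\<in>S. \<Sum>m\<in>S. rho_vf (vf_bracket (homog_elt m (f m)) (homog_elt l (g l))) w)"
    unfolding Xe Ye vf_bracket_def bilin_ext_sum by (simp add: rho_vf_def lin_ext_sum)
  then have b: "rho_vf (vf_bracket X Y) w = (\<Sum>l\<in>S. \<Sum>m\<in>S. vf_comb (m + l) (bracket_coeff m (f m) l (g l)) w)"
    unfolding rho_vf_bracket_homog_elt .
  have "rho_form (vf_cocycle X Y) w = (\<Sum>l\<in>S. \<Sum>m\<in>S. rho_form (vf_cocycle (homog_elt m (f m)) (homog_elt l (g l))) w)"
    unfolding Xe Ye vf_cocycle_def bilin_ext_sum by (simp add: rho_form_def lin_ext_sum)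
  then have c: "rho_form (vf_cocycle X Y) w
      = (\<Sum>l\<in>S. \<Sum>m\<in>S. cscale (pairing l (f m) * pairing m (g l)) (form_comb (m + l) (coords l) w))"
    unfolding rho_form_cocycle_homog_elt .
  have d: "vf_comb (m + l) (bracket_coeff m (f m) l (g l)) w + cscale (pairing l (f m) * pairing m (g l)) (form_comb (m + l) (coords l) w)
      = vf_comb m (f m) (vf_comb l (g l) w) - vf_comb l (g l) (vf_comb m (f m) w)" for m l
    using defect_eq_0[OF N pf[of m] pg[of l], of w] by (simp add: defect_def algebra_simps)
  have "rho_vf (vf_bracket X Y) w + rho_form (vf_cocycle X Y) w
      = (\<Sum>l\<in>S. \<Sum>m\<in>S. vf_comb m (f m) (vf_comb l (g l) w) - vf_comb l (g l) (vf_comb m (f m) w))"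
    unfolding b c sum.distrib[symmetric] d ..
  also have "\<dots> = (\<Sum>m\<in>S. \<Sum>l\<in>S. vf_comb m (f m) (vf_comb l (g l) w)) - (\<Sum>l\<in>S. \<Sum>m\<in>S. vf_comb l (g l) (vf_comb m (f m) w))"
    unfolding sum_subtractf by (subst sum.swap) simp
  also have "\<dots> = rho_vf X (rho_vf Y w) - rho_vf Y (rho_vf X w)"
    unfolding rX rY linop_sum[OF linop_vf_comb] ..
  finally show ?thesis .
qed

lemma rho_form_action:
  "rho_form (vf_form_action X \<theta>) w = rho_vf X (rho_form \<theta> w) - rho_form \<theta> (rho_vf X w)"
proof -
  define S where "S = fst ` Poly_Mapping.keys X \<union> fst ` Poly_Mapping.keys \<theta>"
  define f where "f m a = Poly_Mapping.lookup X (m, a)" for m a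
  define g where "g m a = Poly_Mapping.lookup \<theta> (m, a)" for m a
  have fin: "finite S" by (simp add: S_def)
  have Xe: "X = (\<Sum>m\<in>S. homog_elt m (f m))" and Ye: "\<theta> = (\<Sum>m\<in>S. homog_elt m (g m))"
    unfolding f_def[abs_def] g_def[abs_def] by (rule homog_elt_expansion[OF fin], simp add: S_def)+
  have rX: "rho_vf X v = (\<Sum>m\<in>S. vf_comb m (f m) v)" and rY: "rho_form \<theta> v = (\<Sum>m\<in>S. form_comb m (g m) v)" for v
    unfolding Xe Ye by (simp_all add: rho_vf_def rho_form_def lin_ext_sum flip: rho_vf_homog_elt rho_form_homog_elt)
  have "rho_form (vf_form_action X \<theta>) w = (\<Sum>l\<in>S. \<Sum>m\<in>S. rho_form (vf_form_action (homog_elt m (f m)) (homog_elt l (g l))) w)"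
    unfolding Xe Ye vf_form_action_def bilin_ext_sum
    by (simp add: rho_form_def lin_ext_sum)
  also have "\<dots> = (\<Sum>l\<in>S. \<Sum>m\<in>S. vf_comb m (f m) (form_comb l (g l) w) - form_comb l (g l) (vf_comb m (f m) w))"
    unfolding rho_form_action_homog_elt vf_comb_form_comb by (simp add: algebra_simps)
  also have "\<dots> = (\<Sum>m\<in>S. \<Sum>l\<in>S. vf_comb m (f m) (form_comb l (g l) w)) - (\<Sum>l\<in>S. \<Sum>m\<in>S. form_comb l (g l) (vf_comb m (f m) w))"
    unfolding sum_subtractf by (subst sum.swap) simp
  also have "\<dots> = rho_vf X (rho_form \<theta> w) - rho_form \<theta> (rho_vf X w)"
    unfolding rX rY linop_sum[OF linop_vf_comb] linop_sum[OF linop_form_comb] ..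
  finally show ?thesis .
qed

lemma rho_form_commute: "rho_form \<theta> (rho_form \<theta>' w) = rho_form \<theta>' (rho_form \<theta> w)"
proof -
  have "linop (\<lambda>w. case k of (m, a) \<Rightarrow> form_op m a w)" for k :: "'a expo \<times> 'a option"
    by (cases k) (simp add: linop_form_op del: form_op_simps)
  note l = linop_sum[OF this] linop_cscale[OF this]
  have "rho_form \<theta> (rho_form \<theta>' w) = (\<Sum>k\<in>Poly_Mapping.keys \<theta>. \<Sum>k'\<in>Poly_Mapping.keys \<theta>'.
      cscale (Poly_Mapping.lookup \<theta> k) (cscale (Poly_Mapping.lookup \<theta>' k') (case k of (m, a) \<Rightarrow> form_op m a (case k' of (m', a') \<Rightarrow> form_op m' a' w))))"
    unfolding rho_form_def lin_ext_def l fvec.scale_sum_right ..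
  also have "\<dots> = (\<Sum>k\<in>Poly_Mapping.keys \<theta>. \<Sum>k'\<in>Poly_Mapping.keys \<theta>'.
      cscale (Poly_Mapping.lookup \<theta>' k') (cscale (Poly_Mapping.lookup \<theta> k) (case k' of (m', a') \<Rightarrow> form_op m' a' (case k of (m, a) \<Rightarrow> form_op m a w))))"
    by (intro sum.cong refl) (auto simp: form_op_commute fvec.scale_left_commute mult.commute split: prod.splits simp del: form_op_simps)
  also have "\<dots> = rho_form \<theta>' (rho_form \<theta> w)"
    unfolding rho_form_def lin_ext_def l fvec.scale_sum_right by (rule sum.swap)
  finally show ?thesis .
qed

lemma rho_K_action: "rho_K (K_action X \<kappa>) w = rho_vf X (rho_K \<kappa> w) - rho_K \<kappa> (rho_vf X w)"
  by transfer (rule rho_form_action)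

lemma rho_K_commute: "rho_K \<kappa> (rho_K \<kappa>' w) = rho_K \<kappa>' (rho_K \<kappa> w)"
  by transfer (rule rho_form_commute)

theorem lie_module_rho:
  assumes N: "CARD('a::finite) = 12"
  shows "lie_module DK dk_scale (dk_bracket 1) cscale (rho :: 'a dk \<Rightarrow> 'a fock \<Rightarrow> 'a fock)"
  unfolding lie_module_def
proof (intro conjI ballI allI)
  fix x y :: "'a dk" and w :: "'a fock"
  assume "x \<in> DK" "y \<in> DK"
  then have D: "fst x \<in> D_div" "fst y \<in> D_div" by (auto simp: DK_def)
  have "rho_K (abs_K (cscale 1 (vf_cocycle (fst x) (fst y)))) w = rho_form (vf_cocycle (fst x) (fst y)) w"
    by (simp add: rho_K.abs_eq)
  then have "rho (dk_bracket 1 x y) w = (rho_vf (vf_bracket (fst x) (fst y)) w + rho_form (vf_cocycle (fst x) (fst y)) w)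
      + rho_K (K_action (fst x) (snd y)) w - rho_K (K_action (fst y) (snd x)) w"
    unfolding rho_def dk_bracket_def by (simp add: rho_K_linear)
  then show "rho (dk_bracket 1 x y) w = rho x (rho y w) - rho y (rho x w)"
    unfolding rho_vf_bracket[OF N D] rho_K_action
    by (simp add: rho_def linop_add[OF linop_rho_vf] linop_add[OF linop_rho_K] rho_K_commute[of "snd x"])
qed (simp_all add: linear_iff_linop linop_rho rho_add rho_scale)

section \<open>Irreducibility\<close>

lemma lookup_heis_0:
  fixes w :: "'a::finite fock"
  shows "Poly_Mapping.lookup (heis x 0 w) (M, r) = of_int (hyp_form x (hyp_ru r)) * Poly_Mapping.lookup w (M, r)"
proof -
  have "(Poly_Mapping.single (M, r) (Poly_Mapping.lookup (heis x 0 w) (M, r)) :: 'a fock)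
      = Poly_Mapping.single (M, r) (of_int (hyp_form x (hyp_ru r)) * Poly_Mapping.lookup w (M, r))"
  proof (rule linop_eqI[where f = "\<lambda>w. Poly_Mapping.single (M, r) (Poly_Mapping.lookup (heis x 0 w) (M, r))"
        and g = "\<lambda>w. Poly_Mapping.single (M, r) (of_int (hyp_form x (hyp_ru r)) * Poly_Mapping.lookup w (M, r))"])
    show "linop (\<lambda>w. Poly_Mapping.single (M, r) (Poly_Mapping.lookup (heis x 0 w) (M, r)) :: 'a fock)"
      by (rule linop_single) (simp_all add: heis_add heis_cscale lookup_add)
    show "linop (\<lambda>w. Poly_Mapping.single (M, r) (of_int (hyp_form x (hyp_ru r)) * Poly_Mapping.lookup w (M, r)) :: 'a fock)"
      by (rule linop_single) (simp_all add: lookup_add algebra_simps)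
  qed (auto simp: heis_0 lookup_single when_def)
  from arg_cong[OF this, of "\<lambda>v. Poly_Mapping.lookup v (M, r)"] show ?thesis
    unfolding lookup_single_eq .
qed

text \<open>Annihilation operators lead from any nonzero vector to a nonzero combination of the \<open>e\<^sup>r\<^sup>u\<close>.\<close>

lemma exists_weight_zero_vector:
  fixes W :: "'a::finite fock set"
  assumes u: "\<And>p n w. w \<in> W \<Longrightarrow> heis (hyp_u p) n w \<in> W" and v: "\<And>p n w. w \<in> W \<Longrightarrow> heis (hyp_v p) n w \<in> W"
  shows "w \<in> W \<Longrightarrow> w \<noteq> 0 \<Longrightarrow> (\<And>M r. Poly_Mapping.lookup w (M, r) \<noteq> 0 \<Longrightarrow> wt M \<le> int K)
    \<Longrightarrow> \<exists>w'\<in>W. w' \<noteq> 0 \<and> (\<forall>M r. Poly_Mapping.lookup w' (M, r) \<noteq> 0 \<longrightarrow> M = {#})"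
proof (induction K arbitrary: w rule: less_induct)
  case (less K)
  show ?case
  proof (cases "\<exists>x n. n > 0 \<and> heis x n w \<noteq> 0 \<and> heis x n w \<in> W")
    case True
    then obtain x n where xn: "n > 0" "heis x n w \<noteq> 0" "heis x n w \<in> W" by blast
    have b: "wt M \<le> int K - n" if "Poly_Mapping.lookup (heis x n w) (M, r) \<noteq> 0" for M r
    proof -
      have "\<exists>b. Poly_Mapping.lookup w (add_mset (b, nat (n - 1)) M, r) \<noteq> 0"
      proof (rule ccontr)
        assume "\<not> ?thesis"
        then have "Poly_Mapping.lookup (heis x n w) (M, r) = 0"
          unfolding lookup_heis_pos[OF xn(1)] by simp
        then show False using that by simp
      qed
      then obtain b where "Poly_Mapping.lookup w (add_mset (b, nat (n - 1)) M, r) \<noteq> 0" by blast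
      then have "wt (add_mset (b, nat (n - 1)) M) \<le> int K" by (rule less.prems(3))
      then show ?thesis using xn(1) by simp
    qed
    obtain M r where "Poly_Mapping.lookup (heis x n w) (M, r) \<noteq> 0"
      using xn(2) by (metis lookup_zero poly_mapping_eqI surj_pair)
    then have "int K - n \<ge> 0" using b wt_nonneg[of M] by fastforce
    then have K: "nat (int K - n) < K" "int (nat (int K - n)) = int K - n" using xn(1) by auto
    show ?thesis
      by (rule less.IH[OF K(1) xn(3,2)]) (simp only: K(2) b)
  next
    case False
    then have "heis (hyp_u p) n w = 0" "heis (hyp_v p) n w = 0" if "n > 0" for p n
      using that u[OF less.prems(1)] v[OF less.prems(1)] by blast+
    then have "\<forall>M r. Poly_Mapping.lookup w (M, r) \<noteq> 0 \<longrightarrow> M = {#}" using singular_vector by blast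
    then show ?thesis using less.prems by blast
  qed
qed

text \<open>The zero modes of the \<open>v\<^sub>p\<close> separate the vectors \<open>e\<^sup>r\<^sup>u\<close>.\<close>

lemma exists_exp_vec:
  fixes W :: "'a::finite fock set"
  assumes W: "fvec.subspace W" and v: "\<And>p w. w \<in> W \<Longrightarrow> heis (hyp_v p) 0 w \<in> W"
  shows "w \<in> W \<Longrightarrow> w \<noteq> 0 \<Longrightarrow> (\<And>M r. Poly_Mapping.lookup w (M, r) \<noteq> 0 \<Longrightarrow> M = {#}) \<Longrightarrow> \<exists>q. exp_vec q \<in> W"
proof (induction "card (Poly_Mapping.keys w)" arbitrary: w rule: less_induct)
  case less
  obtain k where k: "k \<in> Poly_Mapping.keys w" using less.prems(2) by (metis equals0I keys_eq_empty)
  then obtain q where q: "k = ({#}, q)" using less.prems(3) by (metis in_keys_iff surj_pair)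
  show ?case
  proof (cases "Poly_Mapping.keys w = {k}")
    case True
    then have "w = Poly_Mapping.single k (Poly_Mapping.lookup w k)"
      by (subst basis_expansion[of w]) simp
    from arg_cong[OF this, of "cscale (1 / Poly_Mapping.lookup w k)"]
    have "cscale (1 / Poly_Mapping.lookup w k) w = exp_vec q"
      using k unfolding cscale_single exp_vec_def q by (simp add: in_keys_iff)
    then show ?thesis using fvec.subspace_scale[OF W less.prems(1)] by metis
  next
    case False
    then obtain k' where k': "k' \<in> Poly_Mapping.keys w" "k' \<noteq> k" using k by blast
    then obtain q' where q': "k' = ({#}, q')" using less.prems(3) by (metis in_keys_iff surj_pair)
    have "q \<noteq> q'" using k'(2) q q' by blast
    then obtain p where p: "q $ p \<noteq> q' $ p" unfolding vec_eq_iff by blast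
    define w' where "w' = heis (hyp_v p) 0 w - cscale (of_int (q $ p)) w"
    have l: "Poly_Mapping.lookup w' (M, r) = of_int (r $ p - q $ p) * Poly_Mapping.lookup w (M, r)" for M r
      by (simp add: w'_def lookup_minus lookup_heis_0 hyp_form_v_ru algebra_simps)
    have "w' \<in> W"
      unfolding w'_def by (intro fvec.subspace_diff[OF W] v fvec.subspace_scale[OF W] less.prems(1))
    moreover have "Poly_Mapping.lookup w' k' \<noteq> 0" using k'(1) p by (simp add: q' l in_keys_iff)
    then have "w' \<noteq> 0" by auto
    moreover have "M = {#}" if "Poly_Mapping.lookup w' (M, r) \<noteq> 0" for M r
      using that less.prems(3)[of M r] by (auto simp: l)
    moreover have "Poly_Mapping.keys w' \<subset> Poly_Mapping.keys w"
    proof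
      show "Poly_Mapping.keys w' \<subseteq> Poly_Mapping.keys w"
      proof
        fix x assume "x \<in> Poly_Mapping.keys w'"
        then show "x \<in> Poly_Mapping.keys w" by (cases x) (auto simp: in_keys_iff l)
      qed
      have "k \<notin> Poly_Mapping.keys w'" by (simp add: q in_keys_iff l)
      then show "Poly_Mapping.keys w' \<noteq> Poly_Mapping.keys w" using k by blast
    qed
    then have "card (Poly_Mapping.keys w') < card (Poly_Mapping.keys w)" by (simp add: psubset_card_mono)
    ultimately show ?thesis using less.hyps by blast
  qed
qed

theorem fock_irreducible:
  fixes W :: "'a::finite fock set"
  assumes W: "fvec.subspace W" and inv: "\<And>x w. x \<in> DK \<Longrightarrow> w \<in> W \<Longrightarrow> rho x w \<in> W" and "W \<noteq> {0}"
  shows "W = UNIV"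
proof -
  have k: "form_op (mk_expo j r) a w \<in> W" if "w \<in> W" for j r a w
  proof -
    have "tk j r a \<in> DK" by (simp add: DK_def tk_def D_div_def)
    then show ?thesis using inv that by (simp add: rho_tk[symmetric] del: form_op_simps)
  qed
  have u: "heis (hyp_u p) n w \<in> W" if "w \<in> W" for p n w
    using k[OF that, of n 0 "Some p"] by (simp add: u_current_0 hyp_u_ru)
  have v: "heis (hyp_v p) n w \<in> W" if "w \<in> W" for p n w
  proof -
    have "td n 0 (Some p) \<in> DK"
      by (auto simp: DK_def td_def D_div_def lookup_single when_def mk_expo_def intro!: sum.neutral)
    from inv[OF this that] show ?thesis by (simp add: rho_td v_current_0)
  qed
  obtain w where w: "w \<in> W" "w \<noteq> 0" using assms(3) fvec.subspace_0[OF W] by blast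
  have b: "wt M \<le> int (\<Sum>x\<in>Poly_Mapping.keys w. nat (wt (fst x)))" if "Poly_Mapping.lookup w (M, r) \<noteq> 0" for M r
    using member_le_sum[of "(M, r)" "Poly_Mapping.keys w" "\<lambda>x. nat (wt (fst x))"] that wt_nonneg[of M]
    by (simp add: in_keys_iff del: of_nat_sum)
  have "\<exists>w'\<in>W. w' \<noteq> 0 \<and> (\<forall>M r. Poly_Mapping.lookup w' (M, r) \<noteq> 0 \<longrightarrow> M = {#})"
    by (rule exists_weight_zero_vector[of W w]) (erule u | erule v | rule w | erule b)+
  then obtain w' where w': "w' \<in> W" "w' \<noteq> 0" "\<And>M r. Poly_Mapping.lookup w' (M, r) \<noteq> 0 \<Longrightarrow> M = {#}"
    by blast
  have "\<exists>q. exp_vec q \<in> W"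
    by (rule exists_exp_vec[of W w', OF W]) (erule v | rule w' | erule w'(3))+
  then obtain q where q: "exp_vec q \<in> W" by blast
  have e: "exp_vec r \<in> W" for r
    using k[OF q, of 0 "r - q" None] by (simp add: exp_field_exp_vec)
  have m: "Poly_Mapping.single (M, r) 1 \<in> W" for M r
  proof (induction M)
    case empty
    then show ?case using e by (simp add: exp_vec_def)
  next
    case (add x M)
    obtain b k where x: "x = (b, k)" by fastforce
    have "heis (axis b 1) (- int k - 1) (Poly_Mapping.single (M, r) 1) \<in> W"
      by (rule axis_cases) (auto intro: u v add)
    then show ?case by (simp add: x heis_axis_neg)
  qed
  have "w \<in> W" for w
  proof -
    have "w = (\<Sum>k\<in>Poly_Mapping.keys w. cscale (Poly_Mapping.lookup w k) (Poly_Mapping.single k 1))"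
      using basis_expansion[of w] by (simp add: cscale_single)
    moreover have "Poly_Mapping.single k 1 \<in> W" for k using m by (cases k) simp
    ultimately show ?thesis
      using fvec.subspace_sum[OF W] fvec.subspace_scale[OF W] by (metis (no_types, lifting))
  qed
  then show ?thesis by blast
qed

section \<open>The module structure on the Fock space\<close>

theorem theorem5p6:
  assumes "CARD('n::finite) = 12"
  shows "\<exists>\<rho> :: 'n dk \<Rightarrow> 'n fock \<Rightarrow> 'n fock.
    irreducible_lie_module DK dk_scale (dk_bracket 1) cscale \<rho> \<and>
    (\<forall>r j. \<rho> (tk j r None) = zcoeff (vertex_op (exp_vec r)) (- j)) \<and>
    (\<forall>p r j. \<rho> (tk j r (Some p)) =
       zcoeff (fprod (heis (hyp_u p)) (vertex_op (exp_vec r))) (- j - 1)) \<and>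
    (\<forall>a b r j. \<rho> (td_ab j r a b) =
       zcoeff (nop (fscale (of_int (r $ b)) (heis (hyp_v a)) - fscale (of_int (r $ a)) (heis (hyp_v b)))
                 (vertex_op (exp_vec r))) (- j - 1)) \<and>
    \<rho> (td 0 0 None) = (\<lambda>w. w - vertex_op omega 1 w) \<and>
    (\<forall>p j. \<rho> (td j 0 (Some p)) = zcoeff (heis (hyp_v p)) (- j - 1)) \<and>
    (\<forall>a r j. \<rho> (td_hat 1 1 j r a) =
       zcoeff (fscale (of_int (r $ a)) (nop (vertex_op omega) (vertex_op (exp_vec r)))
                 - (zinv_mult (nop (heis (hyp_v a)) (vertex_op (exp_vec r)))
                    + fderiv (nop (heis (hyp_v a)) (vertex_op (exp_vec r))))) (- j - 2))"
proof (intro exI[of _ rho] conjI allI)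
  have "(UNIV :: 'n fock set) \<noteq> {0}"
  proof
    assume "(UNIV :: 'n fock set) = {0}"
    then have "(vacuum :: 'n fock) = 0" by blast
    then have "Poly_Mapping.lookup (vacuum :: 'n fock) ({#}, 0) = 0" by simp
    then show False by (simp add: vacuum_def exp_vec_def)
  qed
  moreover have "W = {0} \<or> W = UNIV" if "fvec.subspace W \<and> (\<forall>x\<in>DK. rho x ` W \<subseteq> W)" for W :: "'n fock set"
    using fock_irreducible[of W] that by blast
  ultimately show "irreducible_lie_module DK dk_scale (dk_bracket 1) cscale (rho :: 'n dk \<Rightarrow> 'n fock \<Rightarrow> 'n fock)"
    unfolding irreducible_lie_module_def using lie_module_rho[OF assms] by blast
next
  fix r :: "int ^ 'n" and j
  show "rho (tk j r None) = zcoeff (vertex_op (exp_vec r)) (- j)"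
    by (simp add: rho_tk zcoeff_def vertex_op_exp_vec)
  fix p
  have "fprod (heis (hyp_u p)) (exp_field r) = u_current (axis p 1) r"
    unfolding u_current_def hyp_u_ru by (intro fprod_nop_commuting heis_ru_exp_field)
  then show "rho (tk j r (Some p)) = zcoeff (fprod (heis (hyp_u p)) (vertex_op (exp_vec r))) (- j - 1)"
    by (simp add: rho_tk zcoeff_def vertex_op_exp_vec)
next
  fix a b and r :: "int ^ 'n" and j
  have f: "is_field (\<lambda>n w. cscale c (heis (hyp_v p) n w))" for c and p :: 'n
    using is_field_scale[OF is_field_heis, of "\<lambda>_. c"] .
  have "fscale (of_int (r $ b)) (heis (hyp_v a)) - fscale (of_int (r $ a)) (heis (hyp_v b))
      = (\<lambda>n w. cscale (of_int (r $ b)) (heis (hyp_v a) n w) + cscale (- of_int (r $ a)) (heis (hyp_v b) n w))"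
    by (intro ext) (simp add: fscale_def)
  then show "rho (td_ab j r a b) =
       zcoeff (nop (fscale (of_int (r $ b)) (heis (hyp_v a)) - fscale (of_int (r $ a)) (heis (hyp_v b)))
                 (vertex_op (exp_vec r))) (- j - 1)"
    by (intro ext)
      (simp only: zcoeff_def vertex_op_exp_vec nop_plus_left[OF f f is_field_exp_field] nop_scale_left[OF is_field_heis is_field_exp_field]
        td_ab_def rho_diff rho_scale rho_td v_current_def vf_op_simps mk_expo_nth spatial_mk_expo, simp)
next
  have "nop virasoro (exp_field 0 :: 'n field) = virasoro"
    by (rule nop_exp_field_0) (rule is_field_0[OF is_field_virasoro])
  then show "rho (td 0 0 None :: 'n dk) = (\<lambda>w. w - vertex_op omega 1 w)"
    by (intro ext) (simp add: rho_td time_op_def vertex_op_virasoro exp_field_0)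
next
  fix p :: 'n and j
  show "rho (td j 0 (Some p)) = zcoeff (heis (hyp_v p)) (- j - 1)"
    by (simp add: rho_td zcoeff_def v_current_0)
next
  fix a and r :: "int ^ 'n" and j
  \<comment> \<open>The multiples of \<open>Y(e\<^sup>r\<^sup>u)\<^sub>(\<^sub>j\<^sub>-\<^sub>1\<^sub>)\<close> add up to \<open>-(j + 1) + (j + 1/2) + 1/2 = 0\<close>\<close>
  have c: "of_int (r $ a) / (2 * 1 * of_nat CARD('n)) * (of_nat CARD('n) - 1 + 1 * 1) = (of_int (r $ a) / 2 :: complex)"
    using assms by simp
  show "rho (td_hat 1 1 j r a) =
       zcoeff (fscale (of_int (r $ a)) (nop (vertex_op omega) (vertex_op (exp_vec r)))
                 - (zinv_mult (nop (heis (hyp_v a)) (vertex_op (exp_vec r)))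
                    + fderiv (nop (heis (hyp_v a)) (vertex_op (exp_vec r))))) (- j - 2)"
  proof (intro ext poly_mapping_eqI)
    fix w k
    have j: "- (- j - 2) - 1 = j + 1" by simp
    show "Poly_Mapping.lookup (rho (td_hat 1 1 j r a) w) k = Poly_Mapping.lookup
       (zcoeff (fscale (of_int (r $ a)) (nop (vertex_op omega) (vertex_op (exp_vec r)))
                 - (zinv_mult (nop (heis (hyp_v a)) (vertex_op (exp_vec r)))
                    + fderiv (nop (heis (hyp_v a)) (vertex_op (exp_vec r))))) (- j - 2) w) k"
      unfolding td_hat_def td0_tilde_def c zcoeff_def j
      by (simp add: rho_add rho_diff rho_scale rho_minus rho_td rho_tk time_op_def vertex_op_virasoro vertex_op_exp_vec
          fscale_def zinv_mult_def fderiv_def v_current_def lookup_add lookup_minus field_simps)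
  qed
qed

end
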